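(* Let $f$, $g$ and $h$ be three-times differentiable functions satisfying the functional equation $$\begin{vmatrix} 1 & 1 & 1\\ f(x) & g(y) & h(z)\\ f'(x) & g'(y) & h'(z)\end{vmatrix}=0,\qquad x+y+z=0.$$ This equation is invariant under the simultaneous transformations $$f(x)\rightarrow \alpha f(\delta x+\gamma_1)+\beta,\quad g(x)\rightarrow \alpha g(\delta x+\gamma_2)+\beta,\quad h(x)\rightarrow \alpha h(\delta x+\gamma_3)+\beta,$$ where $\alpha,\beta,\delta,\gamma_1,\gamma_2,\gamma_3$ are constants with $\gamma_1+\gamma_2+\gamma_3=0$. Up to this invariance: (A) The nonconstant solutions (none of $f,g,h$ constant) are given by $f(x)=g(x)=h(x)=e^{x}$, or $f(x)=g(x)=h(x)=x$, or $f(x)=g(x)=h(x)=\wp(x)$, where $\wp$ is a Weierstrass $\wp$-function. (B) If one of the functions, say $h(z)$, is a constant, then either 1. one of the functions $f(x)$ or $g(y)$ is the same constant as $h(z)$, in which case the remaining function is arbitrary, or 2. $f(x)=g(x)=e^{x}$.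
   Context: The functional equation is required for all $x,y,z$ with $x+y+z=0$ at which the functions involved are defined (the solutions may have poles). The constants $\alpha,\beta,\delta,\gamma_i$ may be complex. "Up to the invariance" means that every solution triple is obtained from one of the listed triples by a transformation of the displayed form, with the same $\alpha,\beta,\delta$ for all three functions; in case (B)2 the value $\delta=0$ is allowed (giving constant $f$ and $g$). The Weierstrass $\wp$-function $\wp(x)=\wp(x;g_2,g_3)$ is the meromorphic solution, with a double pole at the origin, of $\wp'^2=4\wp^3-g_2\wp-g_3$, where $g_2,g_3$ are arbitrary constants; its degenerations (when the cubic has a repeated root, giving trigonometric, hyperbolic or rational functions) are included. *)

theory Defs
  imports "HOL-Complex_Analysis.Complex_Analysis"
begin

definition three_times_differentiable_on :: "(complex \<Rightarrow> complex) \<Rightarrow> complex set \<Rightarrow> bool"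
    (infixl "three'_times'_differentiable'_on" 50) where
  "f three_times_differentiable_on U \<longleftrightarrow>
     (\<forall>n<3. \<forall>x\<in>U. ((deriv ^^ n) f) field_differentiable (at x))"

(* U, V, W are the sets on which f, g, h are defined (in particular, poles are left out). *)
definition det_equation ::
    "complex set \<Rightarrow> complex set \<Rightarrow> complex set \<Rightarrow>
     (complex \<Rightarrow> complex) \<Rightarrow> (complex \<Rightarrow> complex) \<Rightarrow> (complex \<Rightarrow> complex) \<Rightarrow> bool" where
  "det_equation U V W f g h \<longleftrightarrow>
     (\<forall>x\<in>U. \<forall>y\<in>V. \<forall>z\<in>W. x + y + z = 0 \<longrightarrow>
        det (vector [vector [1, 1, 1],
                     vector [f x, g y, h z],
                     vector [deriv f x, deriv g y, deriv h z]] :: complex^3^3) = 0)"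

definition affine_transform ::
    "complex \<Rightarrow> complex \<Rightarrow> complex \<Rightarrow> complex \<Rightarrow> (complex \<Rightarrow> complex) \<Rightarrow> complex \<Rightarrow> complex" where
  "affine_transform \<alpha> \<beta> \<delta> \<gamma> p = (\<lambda>x. \<alpha> * p (\<delta> * x + \<gamma>) + \<beta>)"

(* The triple (f, g, h), given on U, V, W, is obtained from the triple (p, q, r) of functions
   defined on D. The case \<delta> = 0 makes f, g and h constant, so it only matters for
   triples of constants. *)
definition arises_from ::
    "complex set \<Rightarrow> (complex \<Rightarrow> complex) \<Rightarrow> (complex \<Rightarrow> complex) \<Rightarrow> (complex \<Rightarrow> complex) \<Rightarrow>
     complex set \<Rightarrow> complex set \<Rightarrow> complex set \<Rightarrow>
     (complex \<Rightarrow> complex) \<Rightarrow> (complex \<Rightarrow> complex) \<Rightarrow> (complex \<Rightarrow> complex) \<Rightarrow> bool" where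
  "arises_from D p q r U V W f g h \<longleftrightarrow>
     (\<exists>\<alpha> \<beta> \<delta> \<gamma>\<^sub>1 \<gamma>\<^sub>2 \<gamma>\<^sub>3. \<alpha> \<noteq> 0 \<and> \<gamma>\<^sub>1 + \<gamma>\<^sub>2 + \<gamma>\<^sub>3 = 0 \<and>
        (\<forall>x\<in>U. \<delta> * x + \<gamma>\<^sub>1 \<in> D \<and> f x = affine_transform \<alpha> \<beta> \<delta> \<gamma>\<^sub>1 p x) \<and>
        (\<forall>x\<in>V. \<delta> * x + \<gamma>\<^sub>2 \<in> D \<and> g x = affine_transform \<alpha> \<beta> \<delta> \<gamma>\<^sub>2 q x) \<and>
        (\<forall>x\<in>W. \<delta> * x + \<gamma>\<^sub>3 \<in> D \<and> h x = affine_transform \<alpha> \<beta> \<delta> \<gamma>\<^sub>3 r x))"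

(* No condition on the discriminant: a repeated root of the cubic gives the trigonometric,
   hyperbolic and rational degenerations. The "nicely" only fixes the irrelevant values at
   poles and excludes removable singularities. *)
definition weierstrass_p :: "complex \<Rightarrow> complex \<Rightarrow> (complex \<Rightarrow> complex) \<Rightarrow> bool" where
  "weierstrass_p g\<^sub>2 g\<^sub>3 P \<longleftrightarrow>
     P nicely_meromorphic_on UNIV \<and> is_pole P 0 \<and> zorder P 0 = -2 \<and>
     (\<forall>x. \<not> is_pole P x \<longrightarrow> (deriv P x)\<^sup>2 = 4 * P x ^ 3 - g\<^sub>2 * P x - g\<^sub>3)"

end

theory Submission
  imports Defs
begin

text \<open>
  The determinant vanishes exactly when the three points \<open>(f x, f' x)\<close>, \<open>(g y, g' y)\<close>,
  \<open>(h z, h' z)\<close> lie on one line. Let \<open>m\<close> be the slope of this line, a function on the plane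
  \<open>x + y + z = 0\<close>. Near a triple where the three values are distinct, differentiating in a
  direction that fixes one of the three points shows that
  \<open>\<kappa> = (f'' - m f') / ((f - g) (f - h))\<close> is symmetric in the three functions and that
  \<open>\<partial>m = \<kappa> (f - h)\<close>; one more differentiation, applied to the expression for \<open>\<kappa>\<close> that
  contains only first derivatives of the moving functions, gives \<open>\<partial>\<kappa> = 0\<close>
  (\<open>curvature_constant\<close>). So \<open>\<kappa>\<close> is a constant.

  If \<open>\<kappa> = 0\<close>, the line itself does not move, all three functions satisfy
  \<open>k' = \<mu> k + \<nu>\<close>, and they are exponentials or linear functions. If \<open>\<kappa> \<noteq> 0\<close>, the coefficients of the
  cubic \<open>2 \<kappa> (X - f) (X - g) (X - h) + (m X + n)\<^sup>2\<close>, where \<open>Y = m X + n\<close> is the line, are constant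
  (\<open>cubic_case\<close>), so the three points run on one cubic curve, and an affine change of the values
  brings it to Weierstrass form \<open>Y\<^sup>2 = 4 X\<^sup>3 - g\<^sub>2 X - g\<^sub>3\<close>.

  It remains to know the solutions of \<open>f'\<^sup>2 = 4 f\<^sup>3 - g\<^sub>2 f - g\<^sub>3\<close> for arbitrary \<open>g\<^sub>2, g\<^sub>3\<close>, including
  the degenerate cubics; this is done without lattices. A germ of \<open>\<wp>\<close> is \<open>1 / s\<^sup>2\<close> with \<open>s\<close> the
  inverse function of the integral of \<open>1 / sqrt (1 - g\<^sub>2 w\<^sup>4 / 4 - g\<^sub>3 w\<^sup>6 / 4)\<close>
  (\<open>sqrt_inverse_integrand_uniformizer\<close>); the duplication formula extends it to the whole plane
  (\<open>weierstrass_p_exists\<close>). The addition theorem (\<open>collinear\<close>) holds because, for a fixed point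
  \<open>(a, b)\<close> of the curve, the third intersection of the chord through \<open>(a, b)\<close> and \<open>(\<wp> x, \<wp>' x)\<close>
  again solves the differential equation in \<open>x\<close>, with the initial value \<open>(a, b)\<close> at \<open>0\<close>. Finally the
  values of \<open>\<wp>\<close> are dense by the theorem of Liouville and nonconstant solutions are open maps, so
  every nonconstant solution agrees with some translate of \<open>\<wp>\<close> to first order at one point, and
  hence is this translate (\<open>solution_is_translate\<close>).

  If \<open>h\<close> is a constant \<open>c\<close> and neither \<open>f\<close> nor \<open>g\<close> is identically \<open>c\<close>, the equation separates into
  \<open>f' / (f - c) = g' / (g - c)\<close> for independent arguments, and both sides are one constant.
\<close>

section \<open>Differentiation, identity and pole lemmas\<close>

lemma deriv_cong_open:
  assumes "open S" "x \<in> S" "\<And>t. t \<in> S \<Longrightarrow> f t = g t"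
  shows "deriv f x = deriv g x"
  by (rule deriv_cong_ev) (use eventually_nhds_in_open[OF assms(1,2)] assms(3) in \<open>auto elim: eventually_mono\<close>)

lemma has_field_derivative_deriv:
  assumes "f holomorphic_on S" "open S" "x \<in> S"
  shows "(f has_field_derivative deriv f x) (at x)"
  using assms holomorphic_derivI by blast

text \<open>
  Repeated differentiation of the equation expresses every derivative of \<open>d\<close> at \<open>x0\<close> of order at
  least two through derivatives of lower order, so all of them vanish. This is the uniqueness
  theorem used for the Weierstrass equation: the difference of two solutions of
  \<open>f'' = 6 f\<^sup>2 - g\<^sub>2 / 2\<close> satisfies such a linear equation.
\<close>

lemma second_order_linear_zero:
  assumes d: "d holomorphic_on S" and k: "k holomorphic_on S" and S: "open S" "connected S"
    and x0: "x0 \<in> S" "d x0 = 0" "deriv d x0 = 0"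
    and ode: "\<And>x. x \<in> S \<Longrightarrow> deriv (deriv d) x = k x * d x"
    and x: "x \<in> S"
  shows "d x = 0"
proof -
  have all0: "(deriv ^^ n) d x0 = 0" for n
  proof (induction n rule: less_induct)
    case (less n)
    show ?case
    proof (cases "n \<le> 1")
      case True
      then consider "n = 0" | "n = 1" by linarith
      then show ?thesis using x0 by cases auto
    next
      case False
      define j where "j = n - 2"
      have j: "n = Suc (Suc j)"
        using False by (simp add: j_def)
      have "(deriv ^^ n) d x0 = (deriv ^^ j) (deriv (deriv d)) x0"
        unfolding j by (simp add: funpow_swap1)
      also have "\<dots> = (deriv ^^ j) (\<lambda>x. k x * d x) x0"
        by (rule higher_deriv_cong_ev) (use eventually_nhds_in_open[OF S(1) x0(1)] ode in \<open>auto elim: eventually_mono\<close>)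
      also have "\<dots> = (\<Sum>i = 0..j. of_nat (j choose i) * (deriv ^^ i) k x0 * (deriv ^^ (j - i)) d x0)"
        by (rule higher_deriv_mult[OF k d]) (use S x0 in auto)
      also have "\<dots> = 0"
        by (rule sum.neutral) (use less j in auto)
      finally show ?thesis .
    qed
  qed
  show ?thesis
    by (rule holomorphic_fun_eq_0_on_connected[OF d S(1) S(2) all0 x0(1) x])
qed

lemma has_field_derivative_zero_const_two:
  fixes F :: "complex \<Rightarrow> complex \<Rightarrow> complex"
  assumes A: "open A" "connected A" and B: "open B" "connected B"
    and X: "\<And>x y. x \<in> A \<Longrightarrow> y \<in> B \<Longrightarrow> ((\<lambda>t. F t y) has_field_derivative 0) (at x)"
    and Y: "\<And>x y. x \<in> A \<Longrightarrow> y \<in> B \<Longrightarrow> ((\<lambda>t. F x t) has_field_derivative 0) (at y)"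
  obtains c where "\<And>x y. x \<in> A \<Longrightarrow> y \<in> B \<Longrightarrow> F x y = c"
proof (cases "A = {} \<or> B = {}")
  case True
  then show ?thesis using that by blast
next
  case False
  then obtain x0 y0 where xy0: "x0 \<in> A" "y0 \<in> B" by blast
  have "F x y = F x0 y0" if "x \<in> A" "y \<in> B" for x y
  proof -
    have "\<exists>c. \<forall>t\<in>A. F t y = c"
      by (rule has_field_derivative_0_imp_constant_on[unfolded constant_on_def])
         (use A X that in \<open>auto simp: has_field_derivative_at_within\<close>)
    moreover have "\<exists>c. \<forall>t\<in>B. F x0 t = c"
      by (rule has_field_derivative_0_imp_constant_on[unfolded constant_on_def])
         (use B Y xy0 in \<open>auto simp: has_field_derivative_at_within\<close>)
    ultimately show ?thesis using that xy0 by metis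
  qed
  then show ?thesis using that by blast
qed

lemma has_field_derivative_quotient:
  fixes F G :: "complex \<Rightarrow> complex"
  assumes "(F has_field_derivative F') (at x)" "(G has_field_derivative G') (at x)" "G x \<noteq> 0"
  shows "((\<lambda>t. F t / G t) has_field_derivative (F' - F x / G x * G') / G x) (at x)"
  by (rule DERIV_cong[OF DERIV_divide[OF assms]]) (use assms(3) in \<open>simp add: field_simps\<close>)

lemma pole_imp_not_constant_on:
  fixes f :: "complex \<Rightarrow> complex"
  assumes "is_pole f z" "eventually (\<lambda>x. x \<in> S) (at z)"
  shows "\<not> f constant_on S"
proof
  assume "f constant_on S"
  then obtain c where "\<And>x. x \<in> S \<Longrightarrow> f x = c" by (auto simp: constant_on_def)
  then have "eventually (\<lambda>x. f x = c) (at z)"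
    using assms(2) by (auto elim: eventually_mono)
  then have "frequently (\<lambda>x. f x = c) (at z)" by (simp add: eventually_frequently)
  then show False using frequently_const_imp_not_is_pole assms(1) by blast
qed

lemma eventually_punctured_ball:
  "r > 0 \<Longrightarrow> eventually (\<lambda>x. x \<in> ball z r - {z}) (at (z :: complex))"
  by (intro eventually_at_in_open) auto

lemma filterlim_sign_affine:
  fixes x c e :: complex
  assumes "e = 1 \<or> e = -1"
  shows "filterlim (\<lambda>y. e * y + c) (at (e * x + c)) (at x)"
proof (rule filterlim_atI)
  show "((\<lambda>y. e * y + c) \<longlongrightarrow> e * x + c) (at x)" by (intro tendsto_intros)
  have "e \<noteq> 0" using assms by auto
  then show "eventually (\<lambda>y. e * y + c \<noteq> e * x + c) (at x)"
    using eventually_neq_at_within[of x x UNIV] by (auto elim: eventually_mono)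
qed

lemma nicely_meromorphic_nonpoles:
  assumes P: "P nicely_meromorphic_on UNIV"
  shows "countable {x. is_pole P x}" and "open {x. \<not> is_pole P x}"
    and "connected {x. \<not> is_pole P x}" and "P holomorphic_on {x. \<not> is_pole P x}"
proof -
  have mero: "P meromorphic_on UNIV" using P by (simp add: nicely_meromorphic_on_def)
  have sparse: "{x. is_pole P x} sparse_in UNIV"
    using meromorphic_on_imp_not_pole_cosparse[OF mero] by (simp add: eventually_cosparse)
  then show "countable {x. is_pole P x}" using sparse_imp_countable[OF open_UNIV] by fastforce
  have N: "{x. \<not> is_pole P x} = UNIV - {x. is_pole P x}" by auto
  show "open {x. \<not> is_pole P x}"
    unfolding N using sparse_in_UNIV_imp_closed[OF sparse] by (simp add: open_Diff)
  show "connected {x. \<not> is_pole P x}"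
    unfolding N by (rule sparse_imp_connected[OF _ _ _ sparse]) auto
  have "P analytic_on {x. \<not> is_pole P x}"
    using nicely_meromorphic_on_imp_analytic_at[OF P]
    by (subst analytic_on_analytic_at) auto
  then show "P holomorphic_on {x. \<not> is_pole P x}" by (rule analytic_imp_holomorphic)
qed

section \<open>The line through three points of solution curves\<close>

text \<open>
  A solution on a product of two connected open sets on which the three values stay distinct, so
  that the slope of the line through the three points can be computed from any two of them.
  The point \<open>z = - x - y\<close> is eliminated, hence differentiating in \<open>x\<close> fixes the point of \<open>g\<close> and
  differentiating in \<open>y\<close> fixes the point of \<open>f\<close>.
\<close>

locale collinear_triple =
  fixes f g h :: "complex \<Rightarrow> complex" and A B C :: "complex set"
  assumes A: "open A" "connected A" and B: "open B" "connected B" and C: "open C"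
    and f: "f holomorphic_on A" and g: "g holomorphic_on B" and h: "h holomorphic_on C"
    and third_arg: "\<And>x y. x \<in> A \<Longrightarrow> y \<in> B \<Longrightarrow> - x - y \<in> C"
    and distinct: "\<And>x y. x \<in> A \<Longrightarrow> y \<in> B \<Longrightarrow> f x \<noteq> g y"
                  "\<And>x y. x \<in> A \<Longrightarrow> y \<in> B \<Longrightarrow> f x \<noteq> h (- x - y)"
                  "\<And>x y. x \<in> A \<Longrightarrow> y \<in> B \<Longrightarrow> g y \<noteq> h (- x - y)"
    and collinear: "\<And>x y. x \<in> A \<Longrightarrow> y \<in> B \<Longrightarrow>
          deriv f x * (h (- x - y) - g y) + deriv g y * (f x - h (- x - y))
            + deriv h (- x - y) * (g y - f x) = 0"
begin

definition slope :: "complex \<Rightarrow> complex \<Rightarrow> complex" where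
  "slope x y = (deriv f x - deriv g y) / (f x - g y)"

text \<open>
  If all three points lie on \<open>Y\<^sup>2 = 4 X\<^sup>3 - g\<^sub>2 X - g\<^sub>3\<close> and move along it with \<open>k' = Y\<close>, this quotient
  is \<open>2\<close>; it is \<open>0\<close> if the line through the points does not move.
\<close>

definition curvature :: "complex \<Rightarrow> complex \<Rightarrow> complex" where
  "curvature x y = (deriv (deriv h) (- x - y) - slope x y * deriv h (- x - y)) /
     ((h (- x - y) - f x) * (h (- x - y) - g y))"

lemma slope_mult:
  assumes "x \<in> A" "y \<in> B"
  shows "slope x y * (f x - g y) = deriv f x - deriv g y"
    and "slope x y * (f x - h (- x - y)) = deriv f x - deriv h (- x - y)"
    and "slope x y * (g y - h (- x - y)) = deriv g y - deriv h (- x - y)"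
proof -
  note d = distinct[OF assms] and c = collinear[OF assms]
  show 1: "slope x y * (f x - g y) = deriv f x - deriv g y"
    using d by (simp add: slope_def)
  have "(f x - g y) * (slope x y * (f x - h (- x - y)) - (deriv f x - deriv h (- x - y))) = 0"
    using 1 c by algebra
  then show 2: "slope x y * (f x - h (- x - y)) = deriv f x - deriv h (- x - y)"
    using d by simp
  show "slope x y * (g y - h (- x - y)) = deriv g y - deriv h (- x - y)"
    using 1 2 by algebra
qed

lemma derivs:
  shows "x \<in> A \<Longrightarrow> (f has_field_derivative deriv f x) (at x)"
    and "x \<in> A \<Longrightarrow> (deriv f has_field_derivative deriv (deriv f) x) (at x)"
    and "y \<in> B \<Longrightarrow> (g has_field_derivative deriv g y) (at y)"
    and "y \<in> B \<Longrightarrow> (deriv g has_field_derivative deriv (deriv g) y) (at y)"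
    and "x \<in> A \<Longrightarrow> y \<in> B \<Longrightarrow>
      ((\<lambda>t. h (- t - y)) has_field_derivative - deriv h (- x - y)) (at x)"
    and "x \<in> A \<Longrightarrow> y \<in> B \<Longrightarrow>
      ((\<lambda>t. deriv h (- t - y)) has_field_derivative - deriv (deriv h) (- x - y)) (at x)"
    and "x \<in> A \<Longrightarrow> y \<in> B \<Longrightarrow>
      ((\<lambda>t. h (- x - t)) has_field_derivative - deriv h (- x - y)) (at y)"
    and "x \<in> A \<Longrightarrow> y \<in> B \<Longrightarrow>
      ((\<lambda>t. deriv h (- x - t)) has_field_derivative - deriv (deriv h) (- x - y)) (at y)"
proof -
  show "x \<in> A \<Longrightarrow> (f has_field_derivative deriv f x) (at x)"
    and "y \<in> B \<Longrightarrow> (g has_field_derivative deriv g y) (at y)"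
    using has_field_derivative_deriv f g A B by blast+
  show "x \<in> A \<Longrightarrow> (deriv f has_field_derivative deriv (deriv f) x) (at x)"
    and "y \<in> B \<Longrightarrow> (deriv g has_field_derivative deriv (deriv g) y) (at y)"
    using has_field_derivative_deriv holomorphic_deriv f g A B by blast+
  have h1: "(h has_field_derivative deriv h z) (at z)" 
    and h2: "(deriv h has_field_derivative deriv (deriv h) z) (at z)" if "z \<in> C" for z
    using has_field_derivative_deriv holomorphic_deriv h C that by blast+
  assume xy: "x \<in> A" "y \<in> B"
  note z = third_arg[OF xy]
  have a: "((\<lambda>t. - t - y) has_field_derivative -1) (at x)"
    and b: "((\<lambda>t. - x - t) has_field_derivative -1) (at y)"
    by (auto intro!: derivative_eq_intros)
  show "((\<lambda>t. h (- t - y)) has_field_derivative - deriv h (- x - y)) (at x)"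
    "((\<lambda>t. deriv h (- t - y)) has_field_derivative - deriv (deriv h) (- x - y)) (at x)"
    "((\<lambda>t. h (- x - t)) has_field_derivative - deriv h (- x - y)) (at y)"
    "((\<lambda>t. deriv h (- x - t)) has_field_derivative - deriv (deriv h) (- x - y)) (at y)"
    using DERIV_chain2[OF h1[OF z] a] DERIV_chain2[OF h2[OF z] a]
      DERIV_chain2[OF h1[OF z] b] DERIV_chain2[OF h2[OF z] b] by simp_all
qed

text \<open>
  Two expressions for the same derivative: the slope is a quotient of differences between the
  points of \<open>f\<close> and \<open>g\<close>, and also between those of \<open>g\<close> and \<open>h\<close>. Their equality is what makes
  the curvature symmetric in \<open>f\<close>, \<open>g\<close>, \<open>h\<close>.
\<close>

lemma slope_derivative_first:
  assumes xy: "x \<in> A" "y \<in> B"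
  shows "((\<lambda>t. slope t y) has_field_derivative
           (deriv (deriv f) x - slope x y * deriv f x) / (f x - g y)) (at x)"
    and "((\<lambda>t. slope t y) has_field_derivative
           (deriv (deriv h) (- x - y) - slope x y * deriv h (- x - y)) / (g y - h (- x - y))) (at x)"
proof -
  note d = distinct[OF xy] and ds = derivs(1,2)[OF xy(1)] derivs(5-8)[OF xy]
  show "((\<lambda>t. slope t y) has_field_derivative
           (deriv (deriv f) x - slope x y * deriv f x) / (f x - g y)) (at x)"
    using has_field_derivative_quotient[OF DERIV_diff[OF ds(2) DERIV_const[of "deriv g y"]]
        DERIV_diff[OF ds(1) DERIV_const[of "g y"]]] d
    by (simp add: slope_def)
  have "((\<lambda>t. (deriv g y - deriv h (- t - y)) / (g y - h (- t - y))) has_field_derivative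
           (deriv (deriv h) (- x - y) - slope x y * deriv h (- x - y)) / (g y - h (- x - y))) (at x)"
    using has_field_derivative_quotient[OF DERIV_diff[OF DERIV_const[of "deriv g y"] ds(4)]
        DERIV_diff[OF DERIV_const[of "g y"] ds(3)]] d
    by (simp flip: slope_mult(3)[OF xy])
  then show "((\<lambda>t. slope t y) has_field_derivative
           (deriv (deriv h) (- x - y) - slope x y * deriv h (- x - y)) / (g y - h (- x - y))) (at x)"
    by (rule has_field_derivative_transform_within_open[OF _ A(1) xy(1)])
       (simp add: distinct xy flip: slope_mult(3))
qed

lemma slope_derivative_second:
  assumes xy: "x \<in> A" "y \<in> B"
  shows "((\<lambda>t. slope x t) has_field_derivative
           (deriv (deriv g) y - slope x y * deriv g y) / (g y - f x)) (at y)"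
    and "((\<lambda>t. slope x t) has_field_derivative
           (deriv (deriv h) (- x - y) - slope x y * deriv h (- x - y)) / (f x - h (- x - y))) (at y)"
proof -
  note d = distinct[OF xy] and ds = derivs(3,4)[OF xy(2)] derivs(5-8)[OF xy]
  have "(- deriv (deriv g) y - slope x y * (- deriv g y)) / (f x - g y)
      = (deriv (deriv g) y - slope x y * deriv g y) / (g y - f x)"
    by (metis (no_types, lifting) minus_diff_eq minus_divide_left minus_divide_right minus_minus mult_minus_right uminus_add_conv_diff diff_minus_eq_add add.commute)
  then show "((\<lambda>t. slope x t) has_field_derivative
           (deriv (deriv g) y - slope x y * deriv g y) / (g y - f x)) (at y)"
    using has_field_derivative_quotient[OF DERIV_diff[OF DERIV_const[of "deriv f x"] ds(2)]
        DERIV_diff[OF DERIV_const[of "f x"] ds(1)]] d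
    by (simp add: slope_def)
  have "((\<lambda>t. (deriv f x - deriv h (- x - t)) / (f x - h (- x - t))) has_field_derivative
           (deriv (deriv h) (- x - y) - slope x y * deriv h (- x - y)) / (f x - h (- x - y))) (at y)"
    using has_field_derivative_quotient[OF DERIV_diff[OF DERIV_const[of "deriv f x"] ds(6)]
        DERIV_diff[OF DERIV_const[of "f x"] ds(5)]] d
    by (simp flip: slope_mult(2)[OF xy])
  then show "((\<lambda>t. slope x t) has_field_derivative
           (deriv (deriv h) (- x - y) - slope x y * deriv h (- x - y)) / (f x - h (- x - y))) (at y)"
    by (rule has_field_derivative_transform_within_open[OF _ B(1) xy(2)])
       (simp add: distinct xy flip: slope_mult(2))
qed

lemma curvature_mult:
  assumes xy: "x \<in> A" "y \<in> B"
  shows "deriv (deriv h) (- x - y) - slope x y * deriv h (- x - y)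
           = curvature x y * ((h (- x - y) - f x) * (h (- x - y) - g y))"
    and "deriv (deriv f) x - slope x y * deriv f x
           = curvature x y * ((f x - g y) * (f x - h (- x - y)))"
    and "deriv (deriv g) y - slope x y * deriv g y
           = curvature x y * ((g y - f x) * (g y - h (- x - y)))"
proof -
  note d = distinct[OF xy]
  show *: "deriv (deriv h) (- x - y) - slope x y * deriv h (- x - y)
           = curvature x y * ((h (- x - y) - f x) * (h (- x - y) - g y))"
    using d by (simp add: curvature_def)
  have swap: "P = k * ((p - q) * (p - r))"
    if "P / (p - q) = k * ((r - p) * (r - q)) / (q - r)" "p \<noteq> q" "q \<noteq> r" for P k p q r :: complex
  proof -
    have "k * ((r - p) * (r - q)) / (q - r) = k * (p - r)"
      using that(3) by (simp add: field_simps)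
    with that(1) have "P / (p - q) = k * (p - r)" by simp
    then show ?thesis using that(2) by (simp add: divide_eq_eq mult_ac)
  qed
  have "(deriv (deriv f) x - slope x y * deriv f x) / (f x - g y) =
        (deriv (deriv h) (- x - y) - slope x y * deriv h (- x - y)) / (g y - h (- x - y))"
    using DERIV_unique slope_derivative_first[OF xy] by blast
  then show "deriv (deriv f) x - slope x y * deriv f x
           = curvature x y * ((f x - g y) * (f x - h (- x - y)))"
    unfolding * by (intro swap) (use d in auto)
  have "(deriv (deriv g) y - slope x y * deriv g y) / (g y - f x) =
        (deriv (deriv h) (- x - y) - slope x y * deriv h (- x - y)) / (f x - h (- x - y))"
    using DERIV_unique slope_derivative_second[OF xy] by blast
  then show "deriv (deriv g) y - slope x y * deriv g y
           = curvature x y * ((g y - f x) * (g y - h (- x - y)))"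
    unfolding * by (intro swap) (use d in \<open>auto simp: mult.commute\<close>)
qed

lemma slope_derivative:
  assumes xy: "x \<in> A" "y \<in> B"
  shows "((\<lambda>t. slope t y) has_field_derivative curvature x y * (f x - h (- x - y))) (at x)"
    and "((\<lambda>t. slope x t) has_field_derivative curvature x y * (g y - h (- x - y))) (at y)"
  using slope_derivative_first(1)[OF xy] slope_derivative_second(1)[OF xy]
    curvature_mult(2,3)[OF xy] distinct[OF xy] by simp_all

text \<open>
  To differentiate the curvature in \<open>x\<close>, use the expression built on the second derivative of
  \<open>g\<close>, which does not depend on \<open>x\<close>: no third derivative occurs, and after inserting the
  derivative of the slope the numerator is a multiple of the determinant. The derivative in \<open>y\<close> is
  treated in the same way with the expression built on \<open>f\<close>.
\<close>

lemma curvature_constant: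
  obtains \<kappa> where "\<And>x y. x \<in> A \<Longrightarrow> y \<in> B \<Longrightarrow> curvature x y = \<kappa>"
proof (rule has_field_derivative_zero_const_two[OF A B])
  fix x y assume xy: "x \<in> A" "y \<in> B"
  note d = distinct[OF xy] and ds = derivs(1,2)[OF xy(1)] derivs(3,4)[OF xy(2)] derivs(5-8)[OF xy]
    and sd = slope_derivative[OF xy] and cl = collinear[OF xy]
  define k where "k = curvature x y"
  have "- (k * (f x - h (- x - y)) * deriv g y)
     - k * (- deriv f x * (g y - h (- x - y)) + deriv h (- x - y) * (g y - f x)) = 0"
    using cl by algebra
  with has_field_derivative_quotient
      [OF DERIV_diff[OF DERIV_const[of "deriv (deriv g) y"] DERIV_cmult_right[OF sd(1), of "deriv g y"]]
          DERIV_mult[OF DERIV_diff[OF DERIV_const[of "g y"] ds(1)]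
                        DERIV_diff[OF DERIV_const[of "g y"] ds(5)]]]
  have "((\<lambda>t. (deriv (deriv g) y - slope t y * deriv g y) / ((g y - f t) * (g y - h (- t - y))))
          has_field_derivative 0) (at x)"
    using d curvature_mult(3)[OF xy] by (simp add: k_def)
  then show "((\<lambda>t. curvature t y) has_field_derivative 0) (at x)"
    by (rule has_field_derivative_transform_within_open[OF _ A(1) xy(1)])
       (simp add: curvature_mult(3) xy(2) distinct distinct[symmetric])
  have "- (k * (g y - h (- x - y)) * deriv f x)
     - k * (- deriv g y * (f x - h (- x - y)) + deriv h (- x - y) * (f x - g y)) = 0"
    using cl by algebra
  with has_field_derivative_quotient
      [OF DERIV_diff[OF DERIV_const[of "deriv (deriv f) x"] DERIV_cmult_right[OF sd(2), of "deriv f x"]]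
          DERIV_mult[OF DERIV_diff[OF DERIV_const[of "f x"] ds(3)]
                        DERIV_diff[OF DERIV_const[of "f x"] ds(7)]]]
  have "((\<lambda>t. (deriv (deriv f) x - slope x t * deriv f x) / ((f x - g t) * (f x - h (- x - t))))
          has_field_derivative 0) (at y)"
    using d curvature_mult(2)[OF xy] by (simp add: k_def)
  then show "((\<lambda>t. curvature x t) has_field_derivative 0) (at y)"
    by (rule has_field_derivative_transform_within_open[OF _ B(1) xy(2)])
       (simp add: curvature_mult(2) xy(1) distinct)
qed (use that in blast)

definition intercept :: "complex \<Rightarrow> complex \<Rightarrow> complex" where
  "intercept x y = deriv f x - slope x y * f x"

lemma on_line:
  assumes "x \<in> A" "y \<in> B"
  shows "deriv f x = slope x y * f x + intercept x y"
    and "deriv g y = slope x y * g y + intercept x y"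
    and "deriv h (- x - y) = slope x y * h (- x - y) + intercept x y"
  using slope_mult(1,2)[OF assms] by (simp_all add: intercept_def algebra_simps)

lemma intercept_derivative:
  assumes xy: "x \<in> A" "y \<in> B"
  shows "((\<lambda>t. intercept t y) has_field_derivative
           - curvature x y * (f x - h (- x - y)) * g y) (at x)"
    and "((\<lambda>t. intercept x t) has_field_derivative
           - curvature x y * (g y - h (- x - y)) * f x) (at y)"
proof -
  note ds = derivs(1,2)[OF xy(1)] slope_derivative[OF xy]
  show "((\<lambda>t. intercept t y) has_field_derivative
           - curvature x y * (f x - h (- x - y)) * g y) (at x)"
    unfolding intercept_def
    by (rule DERIV_cong[OF DERIV_diff[OF ds(2) DERIV_mult[OF ds(3,1)]]])
       (use curvature_mult(2)[OF xy] in \<open>simp add: algebra_simps\<close>)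
  show "((\<lambda>t. intercept x t) has_field_derivative
           - curvature x y * (g y - h (- x - y)) * f x) (at y)"
    unfolding intercept_def
    by (rule DERIV_cong[OF DERIV_diff[OF DERIV_const DERIV_cmult_right[OF ds(4)]]]) simp
qed

text \<open>
  With curvature zero neither the slope nor the intercept of the line changes.
\<close>

lemma straight_case:
  assumes "x0 \<in> A" "y0 \<in> B" and flat: "\<And>x y. x \<in> A \<Longrightarrow> y \<in> B \<Longrightarrow> curvature x y = 0"
  obtains \<mu> \<nu> where
    "\<And>x. x \<in> A \<Longrightarrow> deriv f x = \<mu> * f x + \<nu>"
    "\<And>y. y \<in> B \<Longrightarrow> deriv g y = \<mu> * g y + \<nu>"
    "\<And>x y. x \<in> A \<Longrightarrow> y \<in> B \<Longrightarrow> deriv h (- x - y) = \<mu> * h (- x - y) + \<nu>"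
proof -
  obtain \<mu> where \<mu>: "\<And>x y. x \<in> A \<Longrightarrow> y \<in> B \<Longrightarrow> slope x y = \<mu>"
    by (rule has_field_derivative_zero_const_two[OF A B, of slope])
       (use slope_derivative flat in fastforce)+
  obtain \<nu> where \<nu>: "\<And>x y. x \<in> A \<Longrightarrow> y \<in> B \<Longrightarrow> intercept x y = \<nu>"
    by (rule has_field_derivative_zero_const_two[OF A B, of intercept])
       (use intercept_derivative flat in fastforce)+
  show thesis
    by (rule that[of \<mu> \<nu>]) (use on_line \<mu> \<nu> assms(1,2) in auto)
qed

text \<open>
  The polynomial \<open>2 \<kappa> (X - f) (X - g) (X - h) + (m X + n)\<^sup>2\<close> has the leading coefficient \<open>2 \<kappa>\<close>, and
  its value at each of \<open>f\<close>, \<open>g\<close>, \<open>h\<close> is the square of the corresponding derivative. Its other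
  coefficients \<open>J1\<close>, \<open>J2\<close>, \<open>J3\<close> turn out to have vanishing partial derivatives.
\<close>

lemma cubic_case:
  assumes xy0: "x0 \<in> A" "y0 \<in> B"
    and curved: "\<And>x y. x \<in> A \<Longrightarrow> y \<in> B \<Longrightarrow> curvature x y = \<kappa>"
  obtains c\<^sub>1 c\<^sub>2 c\<^sub>3 where
    "\<And>x. x \<in> A \<Longrightarrow> (deriv f x)\<^sup>2 = 2 * \<kappa> * f x ^ 3 + c\<^sub>1 * (f x)\<^sup>2 + c\<^sub>2 * f x + c\<^sub>3"
    "\<And>y. y \<in> B \<Longrightarrow> (deriv g y)\<^sup>2 = 2 * \<kappa> * g y ^ 3 + c\<^sub>1 * (g y)\<^sup>2 + c\<^sub>2 * g y + c\<^sub>3"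
    "\<And>x y. x \<in> A \<Longrightarrow> y \<in> B \<Longrightarrow> (slope x y)\<^sup>2 = 2 * \<kappa> * (f x + g y + h (- x - y)) + c\<^sub>1"
proof -
  define J1 where "J1 = (\<lambda>x y. slope x y * slope x y - 2 * \<kappa> * (f x + g y + h (- x - y)))"
  define J2 where "J2 = (\<lambda>x y. 2 * \<kappa> * (f x * g y + g y * h (- x - y) + h (- x - y) * f x)
                           + 2 * (slope x y * intercept x y))"
  define J3 where "J3 = (\<lambda>x y. intercept x y * intercept x y
                           - 2 * \<kappa> * (f x * g y * h (- x - y)))"
  note J_defs = J1_def J2_def J3_def
  have X: "((\<lambda>t. J1 t y) has_field_derivative 0) (at x)"
          "((\<lambda>t. J2 t y) has_field_derivative 0) (at x)"
          "((\<lambda>t. J3 t y) has_field_derivative 0) (at x)"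
    and Y: "((\<lambda>t. J1 x t) has_field_derivative 0) (at y)"
           "((\<lambda>t. J2 x t) has_field_derivative 0) (at y)"
           "((\<lambda>t. J3 x t) has_field_derivative 0) (at y)"
    if xy: "x \<in> A" "y \<in> B" for x y
  proof -
    note ds = derivs(1)[OF xy(1)] derivs(3)[OF xy(2)] derivs(5,7)[OF xy]
      slope_derivative[OF xy, unfolded curved[OF xy]]
      intercept_derivative[OF xy, unfolded curved[OF xy]]
    show "((\<lambda>t. J1 t y) has_field_derivative 0) (at x)"
         "((\<lambda>t. J2 t y) has_field_derivative 0) (at x)"
         "((\<lambda>t. J3 t y) has_field_derivative 0) (at x)"
         "((\<lambda>t. J1 x t) has_field_derivative 0) (at y)"
         "((\<lambda>t. J2 x t) has_field_derivative 0) (at y)"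
         "((\<lambda>t. J3 x t) has_field_derivative 0) (at y)"
      unfolding J_defs
      by (rule DERIV_cong, (rule ds derivative_intros)+, unfold on_line[OF xy], algebra)+
  qed
  obtain c1 where c1: "\<And>x y. x \<in> A \<Longrightarrow> y \<in> B \<Longrightarrow> J1 x y = c1"
    using has_field_derivative_zero_const_two[OF A B X(1) Y(1)] by blast
  obtain c2 where c2: "\<And>x y. x \<in> A \<Longrightarrow> y \<in> B \<Longrightarrow> J2 x y = c2"
    using has_field_derivative_zero_const_two[OF A B X(2) Y(2)] by blast
  obtain c3 where c3: "\<And>x y. x \<in> A \<Longrightarrow> y \<in> B \<Longrightarrow> J3 x y = c3"
    using has_field_derivative_zero_const_two[OF A B X(3) Y(3)] by blast
  have "(deriv f x)\<^sup>2 = 2 * \<kappa> * f x ^ 3 + J1 x y * (f x)\<^sup>2 + J2 x y * f x + J3 x y"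
       "(deriv g y)\<^sup>2 = 2 * \<kappa> * g y ^ 3 + J1 x y * (g y)\<^sup>2 + J2 x y * g y + J3 x y"
       "(slope x y)\<^sup>2 = 2 * \<kappa> * (f x + g y + h (- x - y)) + J1 x y"
    if xy: "x \<in> A" "y \<in> B" for x y
    unfolding J_defs on_line[OF xy] by algebra+
  then show thesis
    using xy0 c1 c2 c3 by (intro that[of c1 c2 c3]) auto
qed

end

section \<open>The Weierstrass differential equation\<close>

locale cubic_ode =
  fixes g\<^sub>2 g\<^sub>3 :: complex
begin

definition cubic :: "complex \<Rightarrow> complex" where
  "cubic X = 4 * X ^ 3 - g\<^sub>2 * X - g\<^sub>3"

text \<open>
  The second-order equation is recorded together with the first-order one. It follows by
  differentiation when \<open>f\<close> is not constant. A constant simple root of the cubic satisfies only the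
  first-order equation, which therefore does not determine the solutions through such a value.
\<close>

definition solves :: "(complex \<Rightarrow> complex) \<Rightarrow> complex set \<Rightarrow> bool" where
  "solves f S \<longleftrightarrow> f holomorphic_on S \<and>
     (\<forall>x\<in>S. (deriv f x)\<^sup>2 = cubic (f x) \<and> deriv (deriv f) x = 6 * (f x)\<^sup>2 - g\<^sub>2 / 2)"

lemma solvesD:
  assumes "solves f S"
  shows "f holomorphic_on S"
    and "x \<in> S \<Longrightarrow> (deriv f x)\<^sup>2 = cubic (f x)"
    and "x \<in> S \<Longrightarrow> deriv (deriv f) x = 6 * (f x)\<^sup>2 - g\<^sub>2 / 2"
  using assms by (auto simp: solves_def)

lemma solves_subset: "solves f S \<Longrightarrow> T \<subseteq> S \<Longrightarrow> solves f T"
  by (auto simp: solves_def intro: holomorphic_on_subset)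

lemma solves_cong:
  assumes "solves f S" "open S" "\<And>x. x \<in> S \<Longrightarrow> f x = g x"
  shows "solves g S"
proof -
  have d: "deriv g x = deriv f x" if "x \<in> S" for x
    by (rule deriv_cong_open[OF assms(2) that]) (simp add: assms(3))
  have "deriv (deriv g) x = deriv (deriv f) x" if "x \<in> S" for x
    by (rule deriv_cong_open[OF assms(2) that d])
  with d show ?thesis
    using assms holomorphic_cong[of S S f g] by (auto simp: solves_def)
qed

text \<open>
  The equation is autonomous and even in the derivative, so translations and reflections of the
  argument preserve it. The sign \<open>e\<close> serves to match two solutions whose derivatives agree only up
  to sign.
\<close>

lemma solves_affine:
  assumes f: "solves f S" and S: "open S" and e: "e = 1 \<or> e = -1"
  shows "solves (\<lambda>x. f (e * x + c)) {x. e * x + c \<in> S}"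
    and "\<And>x. e * x + c \<in> S \<Longrightarrow> deriv (\<lambda>x. f (e * x + c)) x = e * deriv f (e * x + c)"
proof -
  let ?T = "{x. e * x + c \<in> S}"
  have T: "open ?T"
    using open_vimage[OF S, of "\<lambda>x. e * x + c"]
    by (simp add: vimage_def continuous_intros)
  have inner: "((\<lambda>x. e * x + c) has_field_derivative e) (at x)" for x
    by (auto intro!: derivative_eq_intros)
  have d1: "((\<lambda>x. f (e * x + c)) has_field_derivative e * deriv f (e * x + c)) (at x)"
    if "x \<in> ?T" for x
    using DERIV_chain2[OF has_field_derivative_deriv[OF solvesD(1)[OF f] S] inner, of x] that
    by (simp add: mult.commute)
  have d2: "((\<lambda>x. e * deriv f (e * x + c)) has_field_derivative e * (deriv (deriv f) (e * x + c) * e)) (at x)"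
    if "x \<in> ?T" for x
    using DERIV_cmult[OF DERIV_chain2[OF has_field_derivative_deriv[OF holomorphic_deriv[OF solvesD(1)[OF f] S] S] inner, of x], of e] that
    by simp
  show D: "deriv (\<lambda>x. f (e * x + c)) x = e * deriv f (e * x + c)" if "e * x + c \<in> S" for x
    using d1[of x] that DERIV_imp_deriv by blast
  have D2: "deriv (deriv (\<lambda>x. f (e * x + c))) x = e * (deriv (deriv f) (e * x + c) * e)"
    if "x \<in> ?T" for x
    using deriv_cong_open[OF T that, of "deriv (\<lambda>x. f (e * x + c))"] D
      DERIV_imp_deriv[OF d2[OF that]] by simp
  have "(\<lambda>x. f (e * x + c)) holomorphic_on ?T"
    using d1 T by (subst holomorphic_on_open) blast+
  moreover have "e\<^sup>2 = 1" "e * (y * e) = y" for y using e by auto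
  ultimately show "solves (\<lambda>x. f (e * x + c)) ?T"
    using D D2 solvesD[OF f] by (auto simp: solves_def power_mult_distrib)
qed

lemma solves_unique:
  assumes f: "solves f S" and g: "solves g S" and S: "open S" "connected S"
    and x0: "x0 \<in> S" "f x0 = g x0" "deriv f x0 = deriv g x0" and x: "x \<in> S"
  shows "f x = g x"
proof -
  note hol = solvesD(1)[OF f] solvesD(1)[OF g]
  note hold = hol[THEN holomorphic_deriv, OF S(1)]
  have fd: "f field_differentiable at y" "g field_differentiable at y"
      "deriv f field_differentiable at y" "deriv g field_differentiable at y" if "y \<in> S" for y
    using hol hold S(1) that holomorphic_on_imp_differentiable_at by blast+
  have d1: "deriv (\<lambda>x. f x - g x) y = deriv f y - deriv g y" if "y \<in> S" for y
    using fd[OF that] by (intro deriv_diff) auto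
  have "f x - g x = 0"
  proof (rule second_order_linear_zero[where k = "\<lambda>x. 6 * (f x + g x)" and S = S and d = "\<lambda>x. f x - g x"])
    show "(\<lambda>x. f x - g x) holomorphic_on S" "(\<lambda>x. 6 * (f x + g x)) holomorphic_on S"
      using hol by (auto intro!: holomorphic_intros)
    show "deriv (\<lambda>x. f x - g x) x0 = 0" using d1[OF x0(1)] x0 by simp
    fix y assume y: "y \<in> S"
    have "deriv (deriv (\<lambda>x. f x - g x)) y = deriv (\<lambda>x. deriv f x - deriv g x) y"
      by (rule deriv_cong_open[OF S(1) y d1])
    also have "\<dots> = deriv (deriv f) y - deriv (deriv g) y"
      using fd[OF y] by (intro deriv_diff) auto
    also have "\<dots> = 6 * (f y + g y) * (f y - g y)"
      unfolding solvesD(3)[OF f y] solvesD(3)[OF g y] by algebra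
    finally show "deriv (deriv (\<lambda>x. f x - g x)) y = 6 * (f y + g y) * (f y - g y)" .
  qed (use S x0 x in auto)
  then show ?thesis by simp
qed

text \<open>
  Differentiating the first-order equation gives the second-order one multiplied by \<open>f'\<close>. The
  factor can be cancelled where \<open>f'\<close> does not vanish, and the identity theorem does the rest.
\<close>

lemma nonconstant_solves:
  assumes f: "f holomorphic_on S" and S: "open S" "connected S" and nc: "\<not> f constant_on S"
    and ode: "\<And>x. x \<in> S \<Longrightarrow> (deriv f x)\<^sup>2 = cubic (f x)"
  shows "solves f S"
proof -
  have d1: "(f has_field_derivative deriv f x) (at x)"
    and d2: "(deriv f has_field_derivative deriv (deriv f) x) (at x)" if "x \<in> S" for x
    using has_field_derivative_deriv f holomorphic_deriv S(1) that by blast+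
  have prod0: "deriv f x * (deriv (deriv f) x - (6 * (f x)\<^sup>2 - g\<^sub>2 / 2)) = 0" if "x \<in> S" for x
  proof -
    have "((\<lambda>x. deriv f x * deriv f x) has_field_derivative
             deriv (deriv f) x * deriv f x + deriv (deriv f) x * deriv f x) (at x)"
      by (rule DERIV_mult[OF d2[OF that] d2[OF that]])
    moreover have "((\<lambda>x. 4 * (f x * (f x * f x)) - g\<^sub>2 * f x - g\<^sub>3) has_field_derivative
        (4 * (deriv f x * (f x * f x) + (deriv f x * f x + deriv f x * f x) * f x)
           - g\<^sub>2 * deriv f x - 0)) (at x)"
      by (rule DERIV_diff DERIV_cmult DERIV_mult DERIV_const d1 that)+
    then have "((\<lambda>x. deriv f x * deriv f x) has_field_derivative
        (4 * (deriv f x * (f x * f x) + (deriv f x * f x + deriv f x * f x) * f x)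
           - g\<^sub>2 * deriv f x - 0)) (at x)"
      by (rule has_field_derivative_transform_within_open[OF _ S(1) that])
         (use ode in \<open>simp add: cubic_def power2_eq_square power3_eq_cube mult.assoc\<close>)
    ultimately have "deriv (deriv f) x * deriv f x + deriv (deriv f) x * deriv f x =
        (4 * (deriv f x * (f x * f x) + (deriv f x * f x + deriv f x * f x) * f x)
           - g\<^sub>2 * deriv f x - 0)" by (rule DERIV_unique)
    then have "2 * (deriv f x * (deriv (deriv f) x - (6 * (f x)\<^sup>2 - g\<^sub>2 / 2))) = 0"
      by (simp add: algebra_simps power2_eq_square)
    then show ?thesis by simp
  qed
  obtain x1 where x1: "x1 \<in> S" "deriv f x1 \<noteq> 0"
  proof (rule ccontr)
    assume "\<not> thesis"
    then have "\<And>x. x \<in> S \<Longrightarrow> (f has_field_derivative 0) (at x)" using d1 that by metis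
    then have "f constant_on S"
      by (intro has_field_derivative_0_imp_constant_on S) (auto simp: has_field_derivative_at_within)
    with nc show False by simp
  qed
  have hold: "deriv f holomorphic_on S" "deriv (deriv f) holomorphic_on S"
    using f S(1) by (auto intro!: holomorphic_deriv)
  have "open (S \<inter> deriv f -` (- {0}))"
    by (rule continuous_open_preimage) (use hold S holomorphic_on_imp_continuous_on in auto)
  then have "deriv (deriv f) x = 6 * (f x)\<^sup>2 - g\<^sub>2 / 2" if "x \<in> S" for x
    by (rule analytic_continuation_open[where s' = S])
       (use prod0 x1 S hold f that in \<open>auto intro!: holomorphic_intros\<close>)
  then show ?thesis using f ode by (simp add: solves_def)
qed

text \<open>
  The classical duplication formula: \<open>\<wp>(2 x)\<close> is this rational function of \<open>\<wp>(x)\<close>.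
\<close>

definition duplicate :: "complex \<Rightarrow> complex" where
  "duplicate X = (X ^ 4 + g\<^sub>2 / 2 * X\<^sup>2 + 2 * g\<^sub>3 * X + g\<^sub>2\<^sup>2 / 16) / cubic X"

text \<open>
  The map carries solutions \<open>k(x)\<close> to solutions \<open>duplicate (k (x / 2))\<close>; the factor \<open>4\<close> compensates
  for halving the argument. Behind it is a polynomial identity of degree twelve.
\<close>

lemma duplicate_derivative:
  assumes "cubic X \<noteq> 0"
  obtains D where "(duplicate has_field_derivative D) (at X)"
    "D\<^sup>2 * cubic X = 4 * cubic (duplicate X)"
proof
  define N where "N = X ^ 4 + g\<^sub>2 / 2 * X\<^sup>2 + 2 * g\<^sub>3 * X + g\<^sub>2\<^sup>2 / 16"
  define N' where "N' = 4 * X ^ 3 + g\<^sub>2 * X + 2 * g\<^sub>3"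
  define C where "C = cubic X"
  define C' where "C' = 12 * X\<^sup>2 - g\<^sub>2"
  have dN: "((\<lambda>X. X ^ 4 + g\<^sub>2 / 2 * X\<^sup>2 + 2 * g\<^sub>3 * X + g\<^sub>2\<^sup>2 / 16) has_field_derivative N') (at X)"
    by (auto intro!: derivative_eq_intros simp: N'_def)
  have dC: "(cubic has_field_derivative C') (at X)"
    unfolding cubic_def by (auto intro!: derivative_eq_intros simp: C'_def)
  have "C \<noteq> 0" using assms by (simp add: C_def)
  show "(duplicate has_field_derivative (N' * C - N * C') / (C * C)) (at X)"
    unfolding duplicate_def
    using DERIV_divide[OF dN dC] assms by (simp add: N_def C_def)
  have "(N' * C - N * C')\<^sup>2 = 4 * (4 * N ^ 3 - g\<^sub>2 * N * C\<^sup>2 - g\<^sub>3 * C ^ 3)"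
    unfolding N_def N'_def C_def C'_def cubic_def by (simp add: field_simps) algebra
  then have "((N' * C - N * C') / (C * C))\<^sup>2 * C = 4 * (4 * N ^ 3 - g\<^sub>2 * N * C\<^sup>2 - g\<^sub>3 * C ^ 3) / C ^ 3"
    using \<open>C \<noteq> 0\<close> by (simp add: power_divide power_mult_distrib eval_nat_numeral)
  also have "\<dots> = 4 * (4 * (N / C) ^ 3 - g\<^sub>2 * (N / C) - g\<^sub>3)"
    using \<open>C \<noteq> 0\<close> by (simp add: field_simps eval_nat_numeral)
  also have "N / C = duplicate X"
    by (simp add: duplicate_def N_def C_def)
  finally show "((N' * C - N * C') / (C * C))\<^sup>2 * cubic X = 4 * cubic (duplicate X)"
    by (simp add: cubic_def[of "duplicate X"] C_def)
qed

text \<open>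
  The line through the fixed point \<open>(a, b)\<close> and the moving point \<open>(f x, f' x)\<close> meets the curve
  \<open>Y\<^sup>2 = 4 X\<^sup>3 - g\<^sub>2 X - g\<^sub>3\<close> in a third point. The three abscissas add up to a quarter of the squared
  slope, which gives \<open>chord_third\<close>.
\<close>

definition chord_slope :: "(complex \<Rightarrow> complex) \<Rightarrow> complex \<Rightarrow> complex \<Rightarrow> complex \<Rightarrow> complex" where
  "chord_slope f a b x = (deriv f x - b) / (f x - a)"

definition chord_third :: "(complex \<Rightarrow> complex) \<Rightarrow> complex \<Rightarrow> complex \<Rightarrow> complex \<Rightarrow> complex" where
  "chord_third f a b x = (chord_slope f a b x)\<^sup>2 / 4 - f x - a"

text \<open>
  The derivative of the slope is \<open>2 (f - K)\<close>, where \<open>K\<close> is the third abscissa. Hence \<open>K'\<close> is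
  the negative of the third ordinate \<open>f' + m (K - f)\<close>: the reflection of the third point in the
  horizontal axis moves along the curve in the same way as \<open>(f, f')\<close>.
\<close>

lemma chord_third_solves:
  assumes f: "solves f S" and S: "open S" and b: "b\<^sup>2 = cubic a"
    and ne: "\<And>x. x \<in> S \<Longrightarrow> f x \<noteq> a"
  shows "solves (chord_third f a b) S"
    and "\<And>x. x \<in> S \<Longrightarrow> deriv (chord_third f a b) x
           = chord_slope f a b x * (f x - chord_third f a b x) - deriv f x"
proof -
  let ?m = "chord_slope f a b" and ?K = "chord_third f a b"
  let ?K' = "\<lambda>x. ?m x * (f x - ?K x) - deriv f x"
  have K4: "4 * ?K x = (?m x)\<^sup>2 - 4 * f x - 4 * a" for x
    by (simp add: chord_third_def)
  have m: "?m x * (f x - a) = deriv f x - b" if "x \<in> S" for x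
    using ne[OF that] by (simp add: chord_slope_def)
  have g2: "g\<^sub>2 = 4 * ((f x)\<^sup>2 + f x * a + a\<^sup>2) - ?m x * (deriv f x + b)" if "x \<in> S" for x
  proof -
    have "(f x - a) * (4 * ((f x)\<^sup>2 + f x * a + a\<^sup>2) - ?m x * (deriv f x + b) - g\<^sub>2) = 0"
      using m[OF that] solvesD(2)[OF f that] b unfolding cubic_def by algebra
    then show ?thesis using ne[OF that] by simp
  qed
  have g3: "g\<^sub>3 = 4 * f x ^ 3 - g\<^sub>2 * f x - (deriv f x)\<^sup>2" if "x \<in> S" for x
    using solvesD(2)[OF f that] by (simp add: cubic_def)
  have f2: "2 * deriv (deriv f) x = 12 * (f x)\<^sup>2 - g\<^sub>2" if "x \<in> S" for x
    using solvesD(3)[OF f that] by simp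
  note hol = solvesD(1)[OF f] holomorphic_deriv[OF solvesD(1)[OF f] S]
  note d = hol[THEN has_field_derivative_deriv, OF S]
  have dm: "(?m has_field_derivative 2 * (f x - ?K x)) (at x)" if x: "x \<in> S" for x
  proof -
    have "(?m has_field_derivative (deriv (deriv f) x - ?m x * deriv f x) / (f x - a)) (at x)"
      unfolding chord_slope_def
      using has_field_derivative_quotient[OF DERIV_diff[OF d(2)[OF x] DERIV_const[of b]]
          DERIV_diff[OF d(1)[OF x] DERIV_const[of a]]] ne[OF x] by simp
    moreover
    have "2 * (deriv (deriv f) x - ?m x * deriv f x) = 2 * (2 * (f x - ?K x) * (f x - a))"
      using f2[OF x] g2[OF x] m[OF x] K4[of x] by algebra
    then have "deriv (deriv f) x - ?m x * deriv f x = 2 * (f x - ?K x) * (f x - a)"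
      by (metis mult_left_cancel zero_neq_numeral)
    ultimately show ?thesis using ne[OF x] by (simp del: right_diff_distrib_numeral)
  qed
  have dK: "(?K has_field_derivative ?K' x) (at x)" if x: "x \<in> S" for x
    unfolding chord_third_def[abs_def] power2_eq_square
    by (rule DERIV_cong[OF DERIV_diff[OF DERIV_diff[OF DERIV_cdivide[OF DERIV_mult[OF dm[OF x] dm[OF x]]]
          d(1)[OF x]] DERIV_const]])
       (simp add: chord_third_def power2_eq_square)
  have dK': "(?K' has_field_derivative 6 * (?K x)\<^sup>2 - g\<^sub>2 / 2) (at x)" if x: "x \<in> S" for x
  proof (rule DERIV_cong[OF DERIV_diff[OF DERIV_mult[OF dm[OF x] DERIV_diff[OF d(1)[OF x] dK[OF x]]] d(2)[OF x]]])
    have "2 * (2 * (f x - ?K x) * (f x - ?K x) + (deriv f x - ?K' x) * ?m x - deriv (deriv f) x)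
        = 12 * (?K x)\<^sup>2 - g\<^sub>2"
      using f2[OF x] g2[OF x] m[OF x] K4[of x] by algebra
    then show "2 * (f x - ?K x) * (f x - ?K x) + (deriv f x - ?K' x) * ?m x - deriv (deriv f) x
        = 6 * (?K x)\<^sup>2 - g\<^sub>2 / 2" by (simp add: field_simps)
  qed
  show D: "deriv ?K x = ?K' x" if "x \<in> S" for x
    using dK[OF that] by (rule DERIV_imp_deriv)
  have D2: "deriv (deriv ?K) x = 6 * (?K x)\<^sup>2 - g\<^sub>2 / 2" if "x \<in> S" for x
    using deriv_cong_open[OF S that D] DERIV_imp_deriv[OF dK'[OF that]] by simp
  have "(?K' x)\<^sup>2 = cubic (?K x)" if x: "x \<in> S" for x
    using g3[OF x] g2[OF x] m[OF x] K4[of x] unfolding cubic_def by algebra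
  moreover have "?K holomorphic_on S"
    using dK S by (subst holomorphic_on_open) blast+
  ultimately show "solves ?K S" using D D2 by (simp add: solves_def)
qed

lemma solves_fill_puncture:
  assumes f: "f holomorphic_on ball z \<rho>" and \<rho>: "\<rho> > 0" and s: "solves f (ball z \<rho> - {z})"
  shows "solves f (ball z \<rho>)"
proof -
  let ?B = "ball z \<rho>"
  have hol: "deriv f holomorphic_on ?B" "deriv (deriv f) holomorphic_on ?B"
    using f by (auto intro!: holomorphic_deriv)
  have "z + of_real (\<rho> / 2) \<in> ?B - {z}" using \<rho> by (simp add: dist_norm)
  then have ne: "?B - {z} \<noteq> {}" by blast
  have "(deriv f x)\<^sup>2 = cubic (f x)" if "x \<in> ?B" for x
    by (rule analytic_continuation_open[OF _ open_ball ne connected_ball, of z \<rho>])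
       (use that solvesD(2)[OF s] in \<open>auto simp: cubic_def intro!: holomorphic_intros hol f\<close>)
  moreover have "deriv (deriv f) x = 6 * (f x)\<^sup>2 - g\<^sub>2 / 2" if "x \<in> ?B" for x
    by (rule analytic_continuation_open[OF _ open_ball ne connected_ball, of z \<rho>])
       (use that solvesD(3)[OF s] in \<open>auto intro!: holomorphic_intros hol f\<close>)
  ultimately show ?thesis using f by (simp add: solves_def)
qed

end

section \<open>The germ of a Weierstrass function at its pole\<close>

text \<open>
  Separation of variables: a solution of \<open>s'\<^sup>2 = Q(s)\<close> with \<open>s 0 = 0\<close> is the local inverse of a
  primitive of \<open>1 / sqrt Q\<close>. The primitive vanishing at \<open>0\<close> is odd because \<open>Q\<close> is even, so \<open>s\<close>
  is odd.
\<close>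

lemma sqrt_inverse_integrand_uniformizer:
  fixes Q :: "complex \<Rightarrow> complex"
  assumes Q: "Q holomorphic_on UNIV" "Q 0 = 1" "\<And>w. Q (- w) = Q w"
  obtains s r where "r > 0" "s holomorphic_on ball 0 r" "s 0 = 0"
    "\<And>x. x \<in> ball 0 r \<Longrightarrow> (deriv s x)\<^sup>2 = Q (s x)"
    "\<And>x. x \<in> ball 0 r \<Longrightarrow> deriv s x \<noteq> 0"
    "\<And>x. x \<in> ball 0 r \<Longrightarrow> s (- x) = - s x"
    "\<And>x. x \<in> ball 0 r \<Longrightarrow> s x = 0 \<Longrightarrow> x = 0"
proof -
  have contQ: "continuous_on UNIV Q" using Q holomorphic_on_imp_continuous_on by blast
  have "open (Q -` {z. Re z > 0})"
    by (rule open_vimage[OF open_halfspace_Re_gt contQ])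
  moreover have "0 \<in> Q -` {z. Re z > 0}" using Q by simp
  ultimately obtain \<rho> where \<rho>: "\<rho> > 0" "ball 0 \<rho> \<subseteq> Q -` {z. Re z > 0}"
    using openE by blast
  define q where "q = (\<lambda>w. 1 / csqrt (Q w))"
  have nonneg: "Q w \<notin> \<real>\<^sub>\<le>\<^sub>0" "Q w \<noteq> 0" if "w \<in> ball 0 \<rho>" for w
    using \<rho>(2) that by (auto simp: complex_nonpos_Reals_iff)
  have q_hol: "q holomorphic_on ball 0 \<rho>"
    unfolding q_def
    by (intro holomorphic_intros holomorphic_on_subset[OF Q(1)]) (use nonneg in auto)
  have q2: "(q w)\<^sup>2 = 1 / Q w" "q w \<noteq> 0" if "w \<in> ball 0 \<rho>" for w
    using nonneg[OF that] by (auto simp: q_def power_divide)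
  obtain G0 where G0: "\<And>w. w \<in> ball 0 \<rho> \<Longrightarrow> (G0 has_field_derivative q w) (at w within ball 0 \<rho>)"
    using holomorphic_convex_primitive'[OF convex_ball open_ball q_hol] by blast
  define G where "G = (\<lambda>w. G0 w - G0 0)"
  have G: "(G has_field_derivative q w) (at w)" if "w \<in> ball 0 \<rho>" for w
    unfolding G_def using G0[OF that] that
    by (auto intro!: derivative_eq_intros simp: at_within_open[OF that open_ball])
  have G_hol: "G holomorphic_on ball 0 \<rho>"
    using G by (subst holomorphic_on_open) blast+
  have dG: "deriv G w = q w" if "w \<in> ball 0 \<rho>" for w
    using G[OF that] by (rule DERIV_imp_deriv)
  have G_odd: "G (- w) = - G w" if "w \<in> ball 0 \<rho>" for w
  proof -
    have "((\<lambda>w. G w + G (- w)) has_field_derivative 0) (at w within ball 0 \<rho>)"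
      if "w \<in> ball 0 \<rho>" for w
    proof -
      have "((\<lambda>w. - w) has_field_derivative -1) (at w)" by (auto intro!: derivative_eq_intros)
      from DERIV_chain2[OF _ this, of G "q (- w)"] that G[of "- w"]
      have "((\<lambda>w. G (- w)) has_field_derivative - q (- w)) (at w)" by simp
      from DERIV_add[OF G[OF that] this] show ?thesis
        by (simp add: q_def Q has_field_derivative_at_within)
    qed
    from has_field_derivative_zero_constant[OF convex_ball this]
    obtain c where c: "\<And>w. w \<in> ball 0 \<rho> \<Longrightarrow> G w + G (- w) = c" by blast
    from c[of 0] \<rho> have "c = 0" by (simp add: G_def)
    with c[OF that] show ?thesis by (simp add: eq_neg_iff_add_eq_0 add.commute)
  qed
  have z0: "0 \<in> ball 0 \<rho>" using \<rho>(1) by simp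
  have dz: "deriv G 0 \<noteq> 0" using dG[OF z0] q2(2)[OF z0] by simp
  obtain \<sigma> where \<sigma>: "\<sigma> > 0" "ball 0 \<sigma> \<subseteq> ball (0 :: complex) \<rho>" "inj_on G (ball 0 \<sigma>)"
    using has_complex_derivative_locally_injective[OF G_hol z0 open_ball dz] by metis
  have G_hol': "G holomorphic_on ball 0 \<sigma>"
    using holomorphic_on_subset[OF G_hol \<sigma>(2)] .
  obtain s where s: "s holomorphic_on G ` ball 0 \<sigma>"
      "\<And>w. w \<in> ball 0 \<sigma> \<Longrightarrow> deriv G w * deriv s (G w) = 1"
      "\<And>w. w \<in> ball 0 \<sigma> \<Longrightarrow> s (G w) = w"
    using holomorphic_has_inverse[OF G_hol' open_ball \<sigma>(3)] by metis
  have "open (G ` ball 0 \<sigma>)" by (rule open_mapping_thm3[OF G_hol' open_ball \<sigma>(3)])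
  moreover have "0 \<in> G ` ball 0 \<sigma>" using \<sigma>(1) by (intro image_eqI[of _ _ 0]) (auto simp: G_def)
  ultimately obtain r where r: "r > 0" "ball 0 r \<subseteq> G ` ball 0 \<sigma>" using openE by blast
  show thesis
  proof (rule that[of r s])
    show "r > 0" by fact
    show "s holomorphic_on ball 0 r" using s(1) r(2) holomorphic_on_subset by blast
    show "s 0 = 0" using s(3)[of 0] \<sigma>(1) by (simp add: G_def)
    fix x :: complex assume "x \<in> ball 0 r"
    then obtain w where w: "w \<in> ball 0 \<sigma>" "x = G w" using r by blast
    then have w': "w \<in> ball 0 \<rho>" using \<sigma> by blast
    have ds: "q w * deriv s x = 1" using s(2)[OF w(1)] dG[OF w'] w by simp
    then show "deriv s x \<noteq> 0" by auto
    have "(q w)\<^sup>2 * (deriv s x)\<^sup>2 = 1" using ds by (simp flip: power_mult_distrib)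
    then show "(deriv s x)\<^sup>2 = Q (s x)"
      using q2[OF w'] nonneg[OF w'] s(3)[OF w(1)] w(2) by (simp add: field_simps)
    have "s (- x) = s (G (- w))" using G_odd[OF w'] w by simp
    also have "\<dots> = - w" by (rule s(3)) (use w in simp)
    finally show "s (- x) = - s x" using s(3)[OF w(1)] w(2) by simp
    show "x = 0" if "s x = 0"
      using that s(3)[OF w(1)] w(2) by (simp add: G_def)
  qed
qed

text \<open>
  Near a double pole a solution can be written as \<open>1 / s\<^sup>2\<close>; substitution into the Weierstrass
  equation turns it into the regular equation \<open>s'\<^sup>2 = 1 - g\<^sub>2 s\<^sup>4 / 4 - g\<^sub>3 s\<^sup>6 / 4\<close>.
\<close>

locale wp_germ = cubic_ode g\<^sub>2 g\<^sub>3 for g\<^sub>2 g\<^sub>3 +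
  fixes s :: "complex \<Rightarrow> complex" and r :: real
  assumes r_pos: "r > 0" and s_hol: "s holomorphic_on ball 0 r" and s_0: "s 0 = 0"
    and s_ode: "\<And>x. x \<in> ball 0 r \<Longrightarrow> (deriv s x)\<^sup>2 = 1 - g\<^sub>2 / 4 * s x ^ 4 - g\<^sub>3 / 4 * s x ^ 6"
    and s_deriv_nz: "\<And>x. x \<in> ball 0 r \<Longrightarrow> deriv s x \<noteq> 0"
    and s_odd: "\<And>x. x \<in> ball 0 r \<Longrightarrow> s (- x) = - s x"
    and s_zero: "\<And>x. x \<in> ball 0 r \<Longrightarrow> s x = 0 \<Longrightarrow> x = 0"
begin

definition p :: "complex \<Rightarrow> complex" where "p x = 1 / (s x)\<^sup>2"

abbreviation "D \<equiv> ball 0 r - {0 :: complex}"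

lemma s_nz: "x \<in> D \<Longrightarrow> s x \<noteq> 0"
  using s_zero by auto

lemma s_deriv: "x \<in> ball 0 r \<Longrightarrow> (s has_field_derivative deriv s x) (at x)"
  using has_field_derivative_deriv[OF s_hol open_ball] .

lemma p_hol: "p holomorphic_on D"
  unfolding p_def
  by (intro holomorphic_intros holomorphic_on_subset[OF s_hol]) (use s_nz in auto)

lemma p_deriv: "x \<in> D \<Longrightarrow> deriv p x = - 2 * deriv s x / s x ^ 3"
  unfolding p_def
  by (rule DERIV_imp_deriv, (rule derivative_eq_intros s_deriv refl | simp add: s_nz)+)
     (simp_all add: s_nz divide_simps eval_nat_numeral)

lemma p_pole: "is_pole p 0"
  unfolding p_def
proof (rule is_pole_divide)
  have "isCont s 0"
    using s_hol r_pos holomorphic_on_imp_continuous_on continuous_on_interior[of "ball 0 r" s 0] by simp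
  then have "((\<lambda>x. (s x)\<^sup>2) \<longlongrightarrow> 0) (at 0)"
    using isContD s_0 by (fastforce intro!: tendsto_eq_intros)
  moreover have "eventually (\<lambda>x. (s x)\<^sup>2 \<noteq> 0) (at 0)"
    using eventually_punctured_ball[OF r_pos, of 0] by eventually_elim (use s_nz in auto)
  ultimately show "filterlim (\<lambda>x. (s x)\<^sup>2) (at 0) (at 0)"
    by (simp add: filterlim_at)
qed auto

lemma p_even: "x \<in> ball 0 r \<Longrightarrow> p (- x) = p x"
  by (simp add: p_def s_odd)

lemma p_cubic_nz: "x \<in> D \<Longrightarrow> cubic (p x) \<noteq> 0"
  and p_ode: "x \<in> D \<Longrightarrow> (deriv p x)\<^sup>2 = cubic (p x)"
proof -
  assume x: "x \<in> D"
  have "(deriv p x)\<^sup>2 = 4 * (deriv s x)\<^sup>2 / s x ^ 6"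
    using p_deriv[OF x] by (simp add: power_divide power_mult_distrib)
  also have "\<dots> = cubic (p x)"
  proof -
    have "4 * (1 - g\<^sub>2 / 4 * a ^ 4 - g\<^sub>3 / 4 * a ^ 6) / a ^ 6
        = 4 * (1 / a\<^sup>2) ^ 3 - g\<^sub>2 * (1 / a\<^sup>2) - g\<^sub>3" if "a \<noteq> 0" for a :: complex
      using that by (simp add: field_simps eval_nat_numeral)
    then show ?thesis using s_ode[of x] x s_nz[OF x] by (simp add: cubic_def p_def)
  qed
  finally show *: "(deriv p x)\<^sup>2 = cubic (p x)" .
  have "deriv p x \<noteq> 0" using p_deriv[OF x] s_nz[OF x] s_deriv_nz[of x] x by simp
  with * show "cubic (p x) \<noteq> 0" by auto
qed

lemma connected_D: "connected D" and open_D: "open D"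
  by (auto intro: connected_punctured_ball)

lemma p_solves: "solves p D"
  by (rule nonconstant_solves[OF p_hol open_D connected_D])
     (use p_ode pole_imp_not_constant_on[OF p_pole eventually_punctured_ball[OF r_pos]] in auto)

lemma p_large_values:
  assumes "\<delta> > 0"
  obtains R where "\<And>w. norm w > R \<Longrightarrow> \<exists>t\<in>D. norm t < \<delta> \<and> p t = w"
proof -
  let ?B = "ball 0 (min \<delta> r)"
  have nc: "\<not> s constant_on ball 0 r"
  proof
    assume "s constant_on ball 0 r"
    moreover have "of_real (r / 2) \<in> ball (0 :: complex) r" "0 \<in> ball (0 :: complex) r"
      using r_pos by auto
    ultimately have "s (of_real (r / 2)) = s 0" unfolding constant_on_def by metis
    then show False using s_zero[of "of_real (r / 2)"] r_pos s_0 by simp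
  qed
  have "open (s ` ?B)"
    by (rule open_mapping_thm[OF s_hol open_ball connected_ball open_ball _ nc]) auto
  moreover have "0 \<in> s ` ?B" using assms r_pos s_0 by (intro image_eqI[of _ _ 0]) auto
  ultimately obtain \<eta> where \<eta>: "\<eta> > 0" "ball 0 \<eta> \<subseteq> s ` ?B" using openE by blast
  show thesis
  proof (rule that[of "1 / \<eta>\<^sup>2"])
    fix w :: complex assume w: "norm w > 1 / \<eta>\<^sup>2"
    have "0 < 1 / \<eta>\<^sup>2" using \<eta>(1) by simp
    with w have w0: "norm w > 0" "w \<noteq> 0" by auto
    have "inverse (norm w) < \<eta>\<^sup>2"
      using w \<eta>(1) w0(1) by (simp add: field_simps)
    then have "sqrt (inverse (norm w)) < \<eta>"
      using \<eta>(1) real_less_lsqrt by auto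
    then have "norm (1 / csqrt w) < \<eta>"
      by (simp add: norm_divide real_sqrt_inverse inverse_eq_divide real_sqrt_divide)
    then obtain t where t: "t \<in> ?B" "s t = 1 / csqrt w" using \<eta>(2) by force
    have "t \<noteq> 0" using t s_0 w0 by auto
    moreover have "p t = w" using t w0 by (simp add: p_def power_divide)
    ultimately show "\<exists>t\<in>D. norm t < \<delta> \<and> p t = w" using t by (intro bexI[of _ t]) auto
  qed
qed

text \<open>
  Both functions take all large values near the pole, so \<open>q\<close> agrees with some \<open>p (e x + c)\<close>, where
  \<open>e\<close> is a sign and \<open>c\<close> is small, to first order at a point close to \<open>0\<close>, and hence on a
  neighbourhood of \<open>0\<close> without the points \<open>0\<close> and \<open>- e c\<close>. Since \<open>q\<close> has its pole at \<open>0\<close> and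
  the other function has it at \<open>- e c\<close>, the shift \<open>c\<close> is \<open>0\<close>; the sign disappears because \<open>p\<close>
  is even.
\<close>

lemma germ_unique:
  assumes q: "solves q (ball 0 \<rho> - {0})" and pole: "is_pole q 0" and \<rho>: "\<rho> > 0"
    and x: "x \<in> ball 0 (min \<rho> r) - {0}"
  shows "q x = p x"
proof -
  define \<delta> where "\<delta> = min \<rho> r / 4"
  have \<delta>: "\<delta> > 0" "4 * \<delta> \<le> \<rho>" "4 * \<delta> \<le> r" using \<rho> r_pos by (auto simp: \<delta>_def)
  obtain R where R: "\<And>w. norm w > R \<Longrightarrow> \<exists>t\<in>D. norm t < \<delta> \<and> p t = w"
    using p_large_values[OF \<delta>(1)] by blast
  have "eventually (\<lambda>x. norm (q x) > R) (at 0)"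
    using pole unfolding is_pole_def by (rule filterlim_at_infinity_imp_norm_at_top[THEN filterlim_at_top_dense[THEN iffD1, rule_format]])
  with eventually_punctured_ball[OF \<delta>(1), of 0]
  have "eventually (\<lambda>x. norm (q x) > R \<and> x \<in> ball 0 \<delta> - {0}) (at 0)"
    by (simp add: eventually_conj)
  then obtain x0 where x0: "norm (q x0) > R" "norm x0 < \<delta>" "x0 \<noteq> 0"
    using eventually_happens[of _ "at (0::complex)"] by auto
  obtain t where t: "t \<in> D" "norm t < \<delta>" "p t = q x0" using R[OF x0(1)] by blast
  have x0': "x0 \<in> ball 0 \<rho> - {0}" using x0 \<delta> by auto
  have "(deriv q x0)\<^sup>2 = (deriv p t)\<^sup>2"
    using solvesD(2)[OF q x0'] p_ode[OF t(1)] t by simp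
  then have "deriv q x0 = deriv p t \<or> deriv q x0 = - deriv p t"
    by (simp add: power2_eq_iff)
  then obtain e :: complex where e: "e = 1 \<or> e = -1" "deriv q x0 = e * deriv p t"
    by (metis mult_1 mult_minus1)
  define c where "c = t - e * x0"
  have ne: "norm (e * y) = norm y" for y using e by (auto simp: norm_mult)
  have nc: "norm c < 2 * \<delta>"
    using norm_triangle_ineq4[of t "e * x0"] ne[of x0] x0 t by (simp add: c_def)
  define S where "S = ball 0 (2 * \<delta>) - {0, - e * c}"
  have S_sub: "S \<subseteq> ball 0 \<rho> - {0}" using \<delta> by (auto simp: S_def)
  have S_in: "e * x + c \<in> D" if "x \<in> S" for x
  proof -
    have "norm (e * x + c) \<le> norm x + norm c" using norm_triangle_ineq[of "e * x" c] ne[of x] by simp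
    also have "\<dots> < r" using that nc \<delta> by (auto simp: S_def)
    finally have "e * x + c \<in> ball 0 r" by simp
    moreover have "e * x + c \<noteq> 0"
    proof
      assume "e * x + c = 0"
      then have "e * (e * x) = - e * c" by (simp add: add_eq_0_iff2)
      then show False using that e(1) by (auto simp: S_def)
    qed
    ultimately show ?thesis by simp
  qed
  note aff = solves_affine[OF p_solves open_D e(1), where c = c]
  have S: "open S" "connected S"
    unfolding S_def by (auto intro!: connected_open_delete_finite open_Diff finite_imp_closed)
  have t_eq: "e * x0 + c = t" by (simp add: c_def)
  have x0S: "x0 \<in> S"
  proof -
    have "x0 \<noteq> - e * c" using t_eq t(1) e(1) by (auto simp: algebra_simps)
    then show ?thesis using x0 \<delta>(1) by (simp add: S_def)
  qed
  have eq: "q y = p (e * y + c)" if "y \<in> S" for y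
  proof (rule solves_unique[OF solves_subset[OF q S_sub] solves_subset[OF aff(1)] S x0S _ _ that])
    show "S \<subseteq> {x. e * x + c \<in> D}" using S_in by auto
    show "q x0 = p (e * x0 + c)" using t t_eq by simp
    show "deriv q x0 = deriv (\<lambda>x. p (e * x + c)) x0"
      using aff(2)[of x0, unfolded t_eq] t(1) e(2) by simp
  qed
  have "c = 0"
  proof (rule ccontr)
    assume "c \<noteq> 0"
    define T where "T = {x. e * x + c \<in> D}"
    have "open T"
      using open_vimage[OF open_D, of "\<lambda>x. e * x + c"] by (simp add: T_def vimage_def continuous_intros)
    moreover have "0 \<in> T" using \<open>c \<noteq> 0\<close> nc \<delta> by (auto simp: T_def)
    ultimately have "\<not> is_pole (\<lambda>x. p (e * x + c)) 0"
      using not_is_pole_holomorphic[of T 0] solvesD(1)[OF aff(1)] by (simp add: T_def)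
    moreover have "eventually (\<lambda>x. x \<in> S) (at 0)"
    proof -
      have "open (ball 0 (2 * \<delta>) - {- e * c})" by auto
      moreover have "0 \<in> ball 0 (2 * \<delta>) - {- e * c}" using \<delta> \<open>c \<noteq> 0\<close> e(1) by auto
      ultimately have "eventually (\<lambda>x. x \<in> ball 0 (2 * \<delta>) - {- e * c} - {0}) (at 0)"
        by (rule eventually_at_in_open)
      then show ?thesis by eventually_elim (auto simp: S_def)
    qed
    then have "eventually (\<lambda>x. q x = p (e * x + c)) (at 0)" by eventually_elim (rule eq)
    ultimately show False using pole is_pole_cong[of q "\<lambda>x. p (e * x + c)" 0 0] by simp
  qed
  have near: "q y = p y" if "y \<in> ball 0 (2 * \<delta>) - {0}" for y
  proof -
    have "y \<in> S" using that \<open>c = 0\<close> by (simp add: S_def)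
    from eq[OF this] have "q y = p (e * y)" using \<open>c = 0\<close> by simp
    then show ?thesis using e(1) p_even[of y] that \<delta> by auto
  qed
  have sub: "ball 0 (2 * \<delta>) - {0} \<subseteq> ball 0 (min \<rho> r) - {0 :: complex}" using \<delta> by auto
  have "ball 0 (2 * \<delta>) - {0 :: complex} \<noteq> {}"
  proof -
    have "complex_of_real \<delta> \<in> ball 0 (2 * \<delta>) - {0}" using \<delta> by simp
    then show ?thesis by blast
  qed
  then show ?thesis
    using near x sub
    by (intro analytic_continuation_open[of "ball 0 (2 * \<delta>) - {0}" "ball 0 (min \<rho> r) - {0}" q p x]
          holomorphic_on_subset[OF solvesD(1)[OF q]] holomorphic_on_subset[OF p_hol])
       (auto intro: connected_punctured_ball)
qed

section \<open>Continuation to the plane by duplication\<close>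

text \<open>
  The function \<open>duplicate (p (x / 2))\<close> solves the Weierstrass equation and has a pole at the
  origin, so it is \<open>p\<close> by uniqueness of the germ.
\<close>

lemma p_duplication:
  assumes x: "x \<in> ball 0 (r / 2) - {0}"
  shows "p (2 * x) = duplicate (p x)"
proof -
  define q where "q = (\<lambda>x. duplicate (p (x / 2)))"
  let ?E = "ball 0 (2 * r) - {0 :: complex}"
  have half: "y / 2 \<in> D" if "y \<in> ?E" for y
    using that by (auto simp: norm_divide)
  have E: "open ?E" "connected ?E" by (auto intro: connected_punctured_ball)
  have dq: "\<exists>q'. (q has_field_derivative q') (at y) \<and> q'\<^sup>2 = cubic (q y)" if y: "y \<in> ?E" for y
  proof -
    obtain d where d: "(duplicate has_field_derivative d) (at (p (y / 2)))"
      "d\<^sup>2 * cubic (p (y / 2)) = 4 * cubic (duplicate (p (y / 2)))"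
      using duplicate_derivative[OF p_cubic_nz[OF half[OF y]]] .
    have "((\<lambda>y. y / 2) has_field_derivative 1 / 2) (at y)" by (auto intro!: derivative_eq_intros)
    from DERIV_chain2[OF has_field_derivative_deriv[OF p_hol open_D half[OF y]] this]
    have "((\<lambda>y. p (y / 2)) has_field_derivative deriv p (y / 2) * (1 / 2)) (at y)" .
    from DERIV_chain2[OF d(1) this]
    have "(q has_field_derivative d * (deriv p (y / 2) * (1 / 2))) (at y)"
      by (simp add: q_def)
    moreover have "(d * (deriv p (y / 2) * (1 / 2)))\<^sup>2 = cubic (q y)"
      using d(2) p_ode[OF half[OF y]] by (simp add: q_def power_mult_distrib power_divide)
    ultimately show ?thesis by blast
  qed
  have q_hol: "q holomorphic_on ?E"
    using dq E by (subst holomorphic_on_open) blast+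
  have q_ode: "(deriv q y)\<^sup>2 = cubic (q y)" if "y \<in> ?E" for y
    using dq[OF that] DERIV_imp_deriv by metis
  have "isCont s 0"
    using s_hol r_pos holomorphic_on_imp_continuous_on continuous_on_interior[of "ball 0 r" s 0] by simp
  then have cont: "isCont (\<lambda>y. s (y / 2)) 0"
    by (intro isCont_o2[of _ "\<lambda>y. y / 2" s]) (auto intro!: continuous_intros)
  define N where "N = (\<lambda>y. 1 + g\<^sub>2 / 2 * s (y / 2) ^ 4 + 2 * g\<^sub>3 * s (y / 2) ^ 6 + g\<^sub>2\<^sup>2 / 16 * s (y / 2) ^ 8)"
  define M where "M = (\<lambda>y. (s (y / 2))\<^sup>2 * (4 - g\<^sub>2 * s (y / 2) ^ 4 - g\<^sub>3 * s (y / 2) ^ 6))"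
  have q_eq: "q y = N y / M y \<and> M y \<noteq> 0" if "y \<in> ?E" for y
  proof -
    have a: "s (y / 2) \<noteq> 0" using s_nz[OF half[OF that]] .
    have "cubic (p (y / 2)) * s (y / 2) ^ 8 = M y"
      using a by (simp add: cubic_def p_def M_def field_simps eval_nat_numeral)
    moreover have "(p (y / 2) ^ 4 + g\<^sub>2 / 2 * (p (y / 2))\<^sup>2 + 2 * g\<^sub>3 * p (y / 2) + g\<^sub>2\<^sup>2 / 16) * s (y / 2) ^ 8 = N y"
      using a by (simp add: p_def N_def field_simps eval_nat_numeral)
    moreover have "q y = (p (y / 2) ^ 4 + g\<^sub>2 / 2 * (p (y / 2))\<^sup>2 + 2 * g\<^sub>3 * p (y / 2)
        + g\<^sub>2\<^sup>2 / 16) * s (y / 2) ^ 8 / (cubic (p (y / 2)) * s (y / 2) ^ 8)"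
      using a by (simp add: q_def duplicate_def)
    ultimately show ?thesis
      using a p_cubic_nz[OF half[OF that]] by auto
  qed
  have ev: "eventually (\<lambda>y. y \<in> ?E) (at 0)"
    by (rule eventually_punctured_ball) (use r_pos in simp)
  have "is_pole (\<lambda>y. N y / M y) 0"
  proof (rule is_pole_divide)
    show "isCont N 0" unfolding N_def using cont by (intro continuous_intros)
    have "isCont M 0" unfolding M_def using cont by (intro continuous_intros)
    then have "(M \<longlongrightarrow> 0) (at 0)" using isContD s_0 by (fastforce simp: M_def)
    moreover have "eventually (\<lambda>y. M y \<noteq> 0) (at 0)"
      using ev by eventually_elim (use q_eq in auto)
    ultimately show "filterlim M (at 0) (at 0)" by (simp add: filterlim_at)
    show "N 0 \<noteq> 0" by (simp add: N_def s_0)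
  qed
  moreover have "eventually (\<lambda>y. N y / M y = q y) (at 0)"
    using ev by eventually_elim (use q_eq in auto)
  ultimately have pole: "is_pole q 0" by (rule is_pole_transform) simp
  have "solves q ?E"
    by (rule nonconstant_solves[OF q_hol E pole_imp_not_constant_on[OF pole ev] q_ode])
  from germ_unique[OF this pole] r_pos x have "q (2 * x) = p (2 * x)" by (simp add: norm_mult)
  then show ?thesis by (simp add: q_def)
qed

text \<open>
  By the duplication formula the \<open>n\<close>-fold iterate of \<open>duplicate\<close>, applied to \<open>p (x / 2 ^ n)\<close>, is
  an extension of the germ from the radius \<open>r\<close> to the radius \<open>r * 2 ^ n\<close>.
\<close>

definition stage :: "nat \<Rightarrow> complex \<Rightarrow> complex" where
  "stage n x = (duplicate ^^ n) (p (x / 2 ^ n))"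

lemma stage_0: "stage 0 = p" by (simp add: stage_def fun_eq_iff)

lemma stage_Suc: "stage (Suc n) x = duplicate (stage n (x / 2))"
  by (simp add: stage_def)

lemma stage_meromorphic: "stage n meromorphic_on ball 0 (r * 2 ^ n)"
proof (induction n)
  case 0
  have "p meromorphic_on ball 0 r"
    unfolding p_def
    by (intro meromorphic_intros analytic_on_imp_meromorphic_on)
       (simp add: analytic_on_open s_hol)
  then show ?case by (simp add: stage_0)
next
  case (Suc n)
  have "(\<lambda>x. stage n (x / 2)) meromorphic_on ball 0 (r * 2 ^ Suc n)"
    by (rule meromorphic_on_compose[OF Suc]) (auto intro!: analytic_intros simp: norm_divide)
  then have "(\<lambda>x. duplicate (stage n (x / 2))) meromorphic_on ball 0 (r * 2 ^ Suc n)"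
    unfolding duplicate_def cubic_def by (intro meromorphic_intros)
  then show ?case by (simp add: stage_Suc[abs_def])
qed

lemma stage_step:
  assumes "x \<in> ball 0 (r * 2 ^ n) - {0}"
  shows "stage (Suc n) x = stage n x"
proof -
  have "x / 2 ^ Suc n \<in> ball 0 (r / 2) - {0}"
    using assms by (auto simp: norm_divide norm_power field_simps)
  from p_duplication[OF this] show ?thesis
    by (simp add: stage_def funpow_swap1)
qed

lemma stage_eq:
  assumes "x \<in> ball 0 (r * 2 ^ n) - {0}" "n \<le> m"
  shows "stage m x = stage n x"
  using assms(2)
proof (induction m rule: dec_induct)
  case (step m)
  have "r * 2 ^ n \<le> r * 2 ^ m" using step r_pos by simp
  then have "x \<in> ball 0 (r * 2 ^ m) - {0}" using assms(1) by auto
  then show ?case using stage_step step by simp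
qed simp

text \<open>
  Consecutive stages agree wherever both are covered by the duplication formula, so choosing for
  each point the first disc that contains it gives a single function. At the origin and where
  a denominator vanishes its value is a meaningless default, which \<open>remove_sings\<close> replaces below.
\<close>

definition glued :: "complex \<Rightarrow> complex" where
  "glued x = stage (LEAST n. x \<in> ball 0 (r * 2 ^ n)) x"

lemma exhaust: "\<exists>n. (x :: complex) \<in> ball 0 (r * 2 ^ n)"
proof -
  obtain n where "norm x / r < 2 ^ n" using real_arch_pow[of 2 "norm x / r"] by auto
  then show ?thesis using r_pos by (intro exI[of _ n]) (simp add: field_simps)
qed

lemma glued_eq:
  assumes "x \<in> ball 0 (r * 2 ^ n) - {0}"
  shows "glued x = stage n x"
proof -
  let ?k = "LEAST n. x \<in> ball 0 (r * 2 ^ n)"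
  have "x \<in> ball 0 (r * 2 ^ ?k)" by (rule LeastI_ex[OF exhaust])
  moreover have "?k \<le> n" by (rule Least_le) (use assms in simp)
  ultimately show ?thesis using stage_eq[of x ?k n] assms by (simp add: glued_def)
qed

lemma glued_meromorphic: "glued meromorphic_on UNIV"
proof (subst meromorphic_on_meromorphic_at, rule ballI)
  fix z :: complex
  obtain n where n: "z \<in> ball 0 (r * 2 ^ n)" using exhaust by blast
  have "eventually (\<lambda>x. x \<in> ball 0 (r * 2 ^ n)) (at z)"
    using n by (intro eventually_at_in_open') auto
  moreover have "eventually (\<lambda>x. x \<noteq> 0) (at z)"
    by (rule eventually_neq_at_within)
  ultimately have "eventually (\<lambda>x. glued x = stage n x) (at z)"
    by eventually_elim (simp add: glued_eq)
  moreover have "stage n meromorphic_on {z}"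
    by (rule meromorphic_on_subset[OF stage_meromorphic]) (use n in simp)
  ultimately show "glued meromorphic_on {z}"
    using meromorphic_on_cong[of "{z}" glued "stage n" "{z}"] by simp
qed

definition wp :: "complex \<Rightarrow> complex" where "wp = remove_sings glued"

lemma wp_eq_p: "x \<in> D \<Longrightarrow> wp x = p x"
proof -
  assume x: "x \<in> D"
  have "eventually (\<lambda>y. y \<in> D) (nhds x)" using x open_D eventually_nhds_in_open by blast
  then have ev: "eventually (\<lambda>y. glued y = p y) (nhds x)"
    by eventually_elim (use glued_eq[of _ 0] in \<open>simp add: stage_0\<close>)
  have "p analytic_on {x}" using p_hol open_D x analytic_at by blast
  then have "glued analytic_on {x}" using analytic_at_cong[OF ev refl] by simp
  then have "wp x = glued x" by (simp add: wp_def)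
  then show "wp x = p x" using eventually_nhds_x_imp_x[OF ev] by simp
qed

lemma s_deriv_0_sq: "(deriv s 0)\<^sup>2 = 1"
  using s_ode[of 0] r_pos s_0 by simp

lemma eventually_D: "eventually (\<lambda>x. x \<in> D) (at 0)"
  by (rule eventually_punctured_ball[OF r_pos])

lemma wp_eventually_p: "eventually (\<lambda>x. wp x = p x) (at 0)"
  using eventually_D by eventually_elim (rule wp_eq_p)

lemma p_zorder: "zorder p 0 = -2"
proof -
  have s_an: "s analytic_on {0}" using s_hol r_pos analytic_at[of s 0] by force
  have "zorder s 0 = 1"
  proof (rule zorder_zero_eqI[OF s_hol open_ball])
    show "(deriv ^^ nat 1) s 0 \<noteq> 0" using s_deriv_0_sq by auto
  qed (use r_pos s_0 in auto)
  moreover have "eventually (\<lambda>x. s x \<noteq> 0) (at 0)"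
    using eventually_D by eventually_elim (rule s_nz)
  then have "zorder (\<lambda>x. s x powi (- 2)) 0 = - 2 * zorder s 0"
    by (intro zorder_power_int analytic_on_imp_meromorphic_on s_an eventually_frequently) auto
  moreover have "p = (\<lambda>x. s x powi (- 2))"
    by (simp add: p_def fun_eq_iff power_int_minus inverse_eq_divide)
  ultimately show ?thesis by simp
qed

text \<open>
  The differential equation is known near the pole and spreads over the set of all points that
  are not poles, which is connected because the poles are sparse.
\<close>

lemma wp_weierstrass: "weierstrass_p g\<^sub>2 g\<^sub>3 wp"
proof -
  have nice: "wp nicely_meromorphic_on UNIV"
    unfolding wp_def by (rule remove_sings_nicely_meromorphic[OF glued_meromorphic])
  let ?N = "{x. \<not> is_pole wp x}"
  note N = nicely_meromorphic_nonpoles[OF nice]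
  have DN: "D \<subseteq> ?N"
  proof
    fix x assume x: "x \<in> D"
    have "wp holomorphic_on D" using holomorphic_cong[of D D wp p] wp_eq_p p_hol by auto
    then show "x \<in> ?N" using not_is_pole_holomorphic[OF open_D x] by blast
  qed
  have D_ne: "of_real (r / 2) \<in> D" using r_pos by simp
  have ode: "(deriv wp x)\<^sup>2 = cubic (wp x)" if "x \<in> ?N" for x
  proof (rule analytic_continuation_open[OF open_D N(2) _ N(3) DN _ _ _ that])
    show "D \<noteq> {}" using D_ne by blast
    show "(\<lambda>x. (deriv wp x)\<^sup>2) holomorphic_on ?N" "(\<lambda>x. cubic (wp x)) holomorphic_on ?N"
      unfolding cubic_def using N(2,4) by (auto intro!: holomorphic_intros holomorphic_deriv)
    fix x assume x: "x \<in> D"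
    have "deriv wp x = deriv p x" by (rule deriv_cong_open[OF open_D x wp_eq_p])
    then show "(deriv wp x)\<^sup>2 = cubic (wp x)" using p_ode[OF x] wp_eq_p[OF x] by simp
  qed
  have "is_pole wp 0" using is_pole_cong[OF wp_eventually_p refl] p_pole by simp
  moreover have "zorder wp 0 = -2"
    using zorder_cong[OF wp_eventually_p refl] p_zorder by simp
  ultimately show ?thesis
    using nice ode by (auto simp: weierstrass_p_def cubic_def)
qed

lemma p_eq_on_germ_of_weierstrass:
  assumes P: "weierstrass_p g\<^sub>2 g\<^sub>3 P"
  shows "\<exists>\<rho>. 0 < \<rho> \<and> \<rho> \<le> r \<and> (\<forall>x\<in>ball 0 \<rho> - {0}. \<not> is_pole P x \<and> P x = p x)"
proof -
  have nice: "P nicely_meromorphic_on UNIV" and pole: "is_pole P 0"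
    and ode: "\<And>x. \<not> is_pole P x \<Longrightarrow> (deriv P x)\<^sup>2 = cubic (P x)"
    using P by (auto simp: weierstrass_p_def cubic_def)
  note N = nicely_meromorphic_nonpoles[OF nice]
  have "P meromorphic_on UNIV" using nice by (simp add: nicely_meromorphic_on_def)
  then have "isolated_singularity_at P 0"
    using meromorphic_on_isolated_singularity meromorphic_on_subset by blast
  then obtain \<rho> where \<rho>: "\<rho> > 0" "P analytic_on ball 0 \<rho> - {0}"
    by (auto simp: isolated_singularity_at_def)
  let ?E = "ball 0 \<rho> - {0 :: complex}"
  have np: "\<not> is_pole P x" if "x \<in> ?E" for x
    by (rule analytic_at_imp_no_pole, rule analytic_on_subset[OF \<rho>(2)]) (use that in simp)
  have "solves P ?E"
    by (rule nonconstant_solves)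
       (use \<rho> np ode pole_imp_not_constant_on[OF pole eventually_punctured_ball[OF \<rho>(1)]] in
        \<open>auto intro: analytic_imp_holomorphic connected_punctured_ball\<close>)
  from germ_unique[OF this pole \<rho>(1)]
  have "P x = p x" if "x \<in> ball 0 (min \<rho> r) - {0}" for x using that by blast
  then show ?thesis using \<rho>(1) r_pos np by (intro exI[of _ "min \<rho> r"]) auto
qed

end

lemma wp_germ_exists: "\<exists>s r. wp_germ g\<^sub>2 g\<^sub>3 s r"
proof -
  obtain s r where "r > 0" "s holomorphic_on ball 0 r" "s 0 = 0"
    "\<And>x. x \<in> ball 0 r \<Longrightarrow> (deriv s x)\<^sup>2 = 1 - g\<^sub>2 / 4 * s x ^ 4 - g\<^sub>3 / 4 * s x ^ 6"
    "\<And>x. x \<in> ball 0 r \<Longrightarrow> deriv s x \<noteq> 0"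
    "\<And>x. x \<in> ball 0 r \<Longrightarrow> s (- x) = - s x"
    "\<And>x. x \<in> ball 0 r \<Longrightarrow> s x = 0 \<Longrightarrow> x = 0"
    by (rule sqrt_inverse_integrand_uniformizer[of "\<lambda>w. 1 - g\<^sub>2 / 4 * w ^ 4 - g\<^sub>3 / 4 * w ^ 6"])
       (auto intro!: holomorphic_intros)
  then have "wp_germ g\<^sub>2 g\<^sub>3 s r" unfolding wp_germ_def by blast
  then show ?thesis by blast
qed

theorem weierstrass_p_exists: "\<exists>P. weierstrass_p g\<^sub>2 g\<^sub>3 P"
proof -
  obtain s r where "wp_germ g\<^sub>2 g\<^sub>3 s r" using wp_germ_exists by blast
  then show ?thesis using wp_germ.wp_weierstrass by blast
qed

lemma weierstrass_p_germ:
  assumes "weierstrass_p g\<^sub>2 g\<^sub>3 P"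
  obtains s r where "wp_germ g\<^sub>2 g\<^sub>3 s r"
    "\<And>x. x \<in> ball 0 r - {0} \<Longrightarrow> \<not> is_pole P x"
    "\<And>x. x \<in> ball 0 r - {0} \<Longrightarrow> P x = 1 / (s x)\<^sup>2"
proof -
  obtain s r where germ: "wp_germ g\<^sub>2 g\<^sub>3 s r" using wp_germ_exists by blast
  then interpret wp_germ g\<^sub>2 g\<^sub>3 s r .
  obtain \<rho> where \<rho>: "0 < \<rho>" "\<rho> \<le> r" "\<And>x. x \<in> ball 0 \<rho> - {0} \<Longrightarrow> \<not> is_pole P x \<and> P x = p x"
    using p_eq_on_germ_of_weierstrass[OF assms] by blast
  have "s holomorphic_on ball 0 \<rho>" by (rule holomorphic_on_subset[OF s_hol]) (use \<rho>(2) in auto)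
  then have "wp_germ g\<^sub>2 g\<^sub>3 s \<rho>"
    by unfold_locales (use \<rho> s_0 s_ode s_deriv_nz s_odd s_zero in auto)
  then show thesis using \<rho> by (intro that[of s \<rho>]) (auto simp: p_def)
qed

section \<open>The addition theorem and the translates of a Weierstrass function\<close>

context wp_germ
begin

text \<open>
  For the germ \<open>p = 1 / s\<^sup>2\<close> the poles at the origin cancel in the third abscissa: expanding with the
  equation for \<open>s\<close> gives the explicit holomorphic quotient \<open>num / den\<close>, whose value and derivative
  at \<open>0\<close> are \<open>a\<close> and \<open>b\<close>. Thus the chord construction with \<open>(a, b)\<close> solves the initial value
  problem for \<open>(a, b)\<close>.
\<close>

lemma chord_third_germ:
  assumes b: "b\<^sup>2 = cubic a"
  obtains T \<rho> where "0 < \<rho>" "\<rho> \<le> r" "solves T (ball 0 \<rho>)" "T 0 = a" "deriv T 0 = b"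
    "\<And>x. x \<in> ball 0 \<rho> - {0} \<Longrightarrow> p x \<noteq> a"
    "\<And>x. x \<in> ball 0 \<rho> - {0} \<Longrightarrow> T x = chord_third p a b x"
proof -
  define A where "A = ball 0 r \<inter> (\<lambda>x. 1 - a * (s x)\<^sup>2) -` (- {0})"
  have "open A"
    unfolding A_def
    by (rule continuous_open_preimage)
       (auto intro!: continuous_intros holomorphic_on_imp_continuous_on[OF s_hol])
  moreover have "0 \<in> A" using r_pos s_0 by (simp add: A_def)
  ultimately obtain \<rho> where \<rho>: "\<rho> > 0" "ball 0 \<rho> \<subseteq> A" using openE by blast
  let ?B = "ball 0 (min \<rho> r) :: complex set"
  have BA: "1 - a * (s x)\<^sup>2 \<noteq> 0" "x \<in> ball 0 r" if "x \<in> ?B" for x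
    using \<rho>(2) that by (auto simp: A_def)
  \<comment> \<open>num and den come from multiplying chord_third by 4 s^2 (1 - a s^2)^2 and cancelling s^2.\<close>
  define num where "num = (\<lambda>x. 4 * a + 4 * b * deriv s x * s x + (4 * a\<^sup>2 - g\<^sub>2) * (s x)\<^sup>2
                         - (2 * g\<^sub>3 + g\<^sub>2 * a) * s x ^ 4)"
  define den where "den = (\<lambda>x. 4 * (1 - a * (s x)\<^sup>2)\<^sup>2)"
  define T where "T = (\<lambda>x. num x / den x)"
  have s_hol': "s holomorphic_on ?B" by (rule holomorphic_on_subset[OF s_hol]) auto
  have T_hol: "T holomorphic_on ?B"
    unfolding T_def num_def den_def
    by (intro holomorphic_intros s_hol' holomorphic_deriv) (use BA in auto)
  have ne: "p x \<noteq> a" if "x \<in> ?B - {0}" for x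
    using BA[of x] that s_nz[of x] by (auto simp: p_def)
  have T_eq: "T x = chord_third p a b x" if x: "x \<in> ?B - {0}" for x
  proof -
    have xD: "x \<in> D" using x by auto
    define \<sigma> d where "\<sigma> = s x" "d = deriv s x"
    have nz: "\<sigma> \<noteq> 0" "1 - a * \<sigma>\<^sup>2 \<noteq> 0" using s_nz[OF xD] BA[of x] x by (auto simp: \<sigma>_d_def)
    have d2: "4 * d\<^sup>2 = 4 - g\<^sub>2 * \<sigma> ^ 4 - g\<^sub>3 * \<sigma> ^ 6"
      using s_ode[of x] x by (simp add: \<sigma>_d_def)
    have b2: "b\<^sup>2 = 4 * a ^ 3 - g\<^sub>2 * a - g\<^sub>3" using b by (simp add: cubic_def)
    have slope: "chord_slope p a b x = - ((2 * d + b * \<sigma> ^ 3) / (\<sigma> * (1 - a * \<sigma>\<^sup>2)))"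
    proof -
      have 1: "deriv p x - b = - (2 * d + b * \<sigma> ^ 3) / \<sigma> ^ 3"
        using nz by (simp add: p_deriv[OF xD] \<sigma>_d_def field_simps)
      have 2: "p x - a = (1 - a * \<sigma>\<^sup>2) / \<sigma>\<^sup>2"
        using nz by (simp add: p_def \<sigma>_d_def field_simps)
      show ?thesis unfolding chord_slope_def 1 2 using nz by (simp add: field_simps eval_nat_numeral)
    qed
    define c where "c = 1 - a * \<sigma>\<^sup>2"
    have "(2 * d + b * \<sigma> ^ 3)\<^sup>2 - 4 * c\<^sup>2 - 4 * a * \<sigma>\<^sup>2 * c\<^sup>2
       = \<sigma>\<^sup>2 * (4 * a + 4 * b * d * \<sigma> + (4 * a\<^sup>2 - g\<^sub>2) * \<sigma>\<^sup>2 - (2 * g\<^sub>3 + g\<^sub>2 * a) * \<sigma> ^ 4)"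
      using d2 b2 unfolding c_def by algebra
    also have "\<dots> = \<sigma>\<^sup>2 * num x" by (simp add: num_def \<sigma>_d_def)
    finally have "\<sigma>\<^sup>2 * num x = (2 * d + b * \<sigma> ^ 3)\<^sup>2 - 4 * c\<^sup>2 - 4 * a * \<sigma>\<^sup>2 * c\<^sup>2" by simp
    moreover have "chord_third p a b x = ((2 * d + b * \<sigma> ^ 3)\<^sup>2 - 4 * c\<^sup>2 - 4 * a * \<sigma>\<^sup>2 * c\<^sup>2) / (4 * \<sigma>\<^sup>2 * c\<^sup>2)"
    proof -
      have "chord_third p a b x = (2 * d + b * \<sigma> ^ 3)\<^sup>2 / (4 * \<sigma>\<^sup>2 * c\<^sup>2) - 1 / \<sigma>\<^sup>2 - a"
        unfolding chord_third_def slope c_def[symmetric]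
        by (simp add: power_divide power_mult_distrib p_def \<sigma>_d_def mult_ac)
      also have "\<dots> = ((2 * d + b * \<sigma> ^ 3)\<^sup>2 - 4 * c\<^sup>2 - 4 * a * \<sigma>\<^sup>2 * c\<^sup>2) / (4 * \<sigma>\<^sup>2 * c\<^sup>2)"
        using nz by (simp add: c_def[symmetric] diff_divide_distrib)
      finally show ?thesis .
    qed
    ultimately have "chord_third p a b x = (\<sigma>\<^sup>2 * num x) / (4 * \<sigma>\<^sup>2 * c\<^sup>2)" by simp
    also have "\<dots> = T x" using nz by (simp add: T_def den_def c_def \<sigma>_d_def)
    finally show ?thesis by simp
  qed
  have sub: "?B - {0} \<subseteq> D" by auto
  have "solves (chord_third p a b) (?B - {0})"
    by (rule chord_third_solves[OF solves_subset[OF p_solves sub] _ b ne]) auto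
  then have "solves T (?B - {0})"
    by (rule solves_cong) (use T_eq in auto)
  then have T_solves: "solves T ?B"
    by (intro solves_fill_puncture T_hol) (use \<rho>(1) r_pos in auto)
  have ds: "(s has_field_derivative deriv s 0) (at 0)"
    "(deriv s has_field_derivative deriv (deriv s) 0) (at 0)"
    using s_hol r_pos by (auto intro!: has_field_derivative_deriv[of _ "ball 0 r"] holomorphic_deriv)
  have dnum: "(num has_field_derivative 4 * b) (at 0)"
    unfolding num_def using s_deriv_0_sq
    by (auto intro!: derivative_eq_intros ds simp: s_0 power2_eq_square)
  have dden: "(den has_field_derivative 0) (at 0)"
    unfolding den_def by (auto intro!: derivative_eq_intros ds simp: s_0)
  have "(T has_field_derivative b) (at 0)"
    unfolding T_def
    by (rule DERIV_cong[OF DERIV_divide[OF dnum dden]]) (simp_all add: den_def s_0)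
  then have "deriv T 0 = b" by (rule DERIV_imp_deriv)
  moreover have "T 0 = a" by (simp add: T_def num_def den_def s_0)
  ultimately show thesis
    using \<rho>(1) r_pos T_solves ne T_eq by (intro that[of "min \<rho> r" T]) auto
qed

end

text \<open>
  A global Weierstrass function together with its germ. \<open>N\<close> will be the set of points that are
  not poles.
\<close>

locale weierstrass = wp_germ g\<^sub>2 g\<^sub>3 s r for g\<^sub>2 g\<^sub>3 s r +
  fixes P :: "complex \<Rightarrow> complex"
  assumes P: "weierstrass_p g\<^sub>2 g\<^sub>3 P"
    and germ_nonpole: "\<And>x. x \<in> ball 0 r - {0} \<Longrightarrow> \<not> is_pole P x"
    and germ_eq: "\<And>x. x \<in> ball 0 r - {0} \<Longrightarrow> P x = 1 / (s x)\<^sup>2"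
begin

definition N :: "complex set" where "N = {x. \<not> is_pole P x}"

lemma P_nice: "P nicely_meromorphic_on UNIV" and P_pole: "is_pole P 0"
  using P by (auto simp: weierstrass_p_def)

lemma poles_countable: "countable (- N)"
  and N_open: "open N" and N_connected: "connected N" and P_hol: "P holomorphic_on N"
  using nicely_meromorphic_nonpoles[OF P_nice] by (auto simp: N_def Collect_neg_eq)

lemma D_subset_N: "D \<subseteq> N"
  using germ_nonpole by (auto simp: N_def)

lemma P_eq_p: "x \<in> D \<Longrightarrow> P x = p x"
  using germ_eq by (simp add: p_def)

lemma D_ne: "D \<noteq> {}"
proof -
  have "of_real (r / 2) \<in> D" using r_pos by simp
  then show ?thesis by blast
qed

lemma P_solves: "solves P N"
proof (rule nonconstant_solves[OF P_hol N_open N_connected])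
  have "eventually (\<lambda>x. x \<in> N) (at 0)" using eventually_D by eventually_elim (use D_subset_N in auto)
  then show "\<not> P constant_on N" by (rule pole_imp_not_constant_on[OF P_pole])
qed (use P in \<open>auto simp: weierstrass_p_def cubic_def N_def\<close>)

lemma N_preimage:
  assumes "e = 1 \<or> e = -1"
  shows "open {x. e * x + c \<in> N}" and "countable (- {x. e * x + c \<in> N})"
proof -
  show "open {x. e * x + c \<in> N}"
    using open_vimage[OF N_open, of "\<lambda>x. e * x + c"] by (simp add: vimage_def continuous_intros)
  have "countable ((\<lambda>y. e * (y - c)) ` (- N))" using poles_countable by simp
  moreover have "- {x. e * x + c \<in> N} \<subseteq> (\<lambda>y. e * (y - c)) ` (- N)"
  proof
    fix x assume "x \<in> - {x. e * x + c \<in> N}"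
    then show "x \<in> (\<lambda>y. e * (y - c)) ` (- N)"
      using assms by (intro image_eqI[of _ _ "e * x + c"]) auto
  qed
  ultimately show "countable (- {x. e * x + c \<in> N})" by (rule countable_subset[rotated])
qed

lemma connected_Int_preimage:
  assumes U: "open U" "connected U" and e: "e = 1 \<or> e = -1"
  shows "connected (U \<inter> {x. e * x + c \<in> N})"
  using connected_open_diff_countable[OF _ U N_preimage(2)[OF e, of c]]
  by (simp add: Diff_eq)

text \<open>
  A function that is holomorphic on all of \<open>U\<close> and agrees somewhere with a translate or reflected
  translate of \<open>P\<close> does so on all of \<open>U\<close>. No pole of that translate can lie in \<open>U\<close>, because \<open>f\<close>
  would inherit it.
\<close>

lemma eq_P_extend:
  assumes U: "open U" "connected U" and f: "f holomorphic_on U" and e: "e = 1 \<or> e = -1"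
    and V: "open V" "V \<noteq> {}" "V \<subseteq> U" "\<And>x. x \<in> V \<Longrightarrow> e * x + c \<in> N \<and> f x = P (e * x + c)"
    and x: "x \<in> U"
  shows "e * x + c \<in> N" and "f x = P (e * x + c)"
proof -
  let ?M = "U \<inter> {x. e * x + c \<in> N}"
  have M: "open ?M" "connected ?M"
    using U(1) N_preimage[OF e, of c] connected_Int_preimage[OF U e, of c] by (auto intro!: open_Int)
  have *: "f y = P (e * y + c)" if "y \<in> ?M" for y
  proof (rule analytic_continuation_open[OF V(1) M(1) V(2) M(2) _ _ _ _ that])
    show "V \<subseteq> ?M" using V by blast
    show "f holomorphic_on ?M" using f by (rule holomorphic_on_subset) auto
    show "(\<lambda>y. P (e * y + c)) holomorphic_on ?M"
      using solvesD(1)[OF solves_affine(1)[OF P_solves N_open e]] by (rule holomorphic_on_subset) auto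
  qed (use V in blast)
  show inN: "e * x + c \<in> N"
  proof (rule ccontr)
    assume "e * x + c \<notin> N"
    then have "is_pole P (e * x + c)" by (simp add: N_def)
    then have pole: "is_pole (\<lambda>y. P (e * y + c)) x"
      unfolding is_pole_def by (rule filterlim_compose[OF _ filterlim_sign_affine[OF e]])
    have "P meromorphic_on UNIV" using P_nice by (simp add: nicely_meromorphic_on_def)
    then have "{y. is_pole P y} sparse_in UNIV"
      using meromorphic_on_imp_not_pole_cosparse by (fastforce simp: eventually_cosparse)
    then have "eventually (\<lambda>y. y \<in> N) (at (e * x + c))"
      by (simp add: sparse_in_eventually_iff N_def)
    then have "eventually (\<lambda>y. e * y + c \<in> N) (at x)"
      using filterlim_sign_affine[OF e, of c x] unfolding filterlim_iff by blast
    moreover have "eventually (\<lambda>y. y \<in> U) (at x)"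
      using U x by (intro eventually_at_in_open')
    ultimately have "eventually (\<lambda>y. P (e * y + c) = f y) (at x)"
      by eventually_elim (use * in auto)
    then have "is_pole f x" using pole is_pole_cong[of "\<lambda>y. P (e * y + c)" f x x] by simp
    then show False using not_is_pole_holomorphic[OF U(1) x f] by blast
  qed
  then show "f x = P (e * x + c)" using * x by blast
qed

lemma P_even:
  assumes x: "x \<in> N"
  shows "- x \<in> N" and "P (- x) = P x" and "deriv P (- x) = - deriv P x"
proof -
  have *: "- y \<in> N" "P y = P (- y)" if "y \<in> N" for y
  proof -
    have "-1 * z + 0 \<in> N \<and> P z = P (-1 * z + 0)" if z: "z \<in> D" for z
    proof -
      have "- z \<in> D" using z by simp
      then show ?thesis
        using D_subset_N P_eq_p[OF z] P_eq_p[of "- z"] p_even[of z] z by (simp add: subset_iff)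
    qed
    from eq_P_extend[OF N_open N_connected P_hol disjI2[OF refl] open_D D_ne D_subset_N this \<open>y \<in> N\<close>]
    show "- y \<in> N" "P y = P (- y)" by simp_all
  qed
  show xN: "- x \<in> N" by (rule *(1)[OF x])
  show "P (- x) = P x" by (rule *(2)[OF x, symmetric])
  have "deriv (\<lambda>y. P (-1 * y + 0)) (- x) = -1 * deriv P (-1 * - x + 0)"
    by (rule solves_affine(2)[OF P_solves N_open]) (use x in auto)
  moreover have "deriv (\<lambda>y. P (-1 * y + 0)) (- x) = deriv P (- x)"
    by (rule deriv_cong_open[OF N_open xN]) (simp flip: *(2))
  ultimately show "deriv P (- x) = - deriv P x" by simp
qed

text \<open>
  Both \<open>x \<mapsto> P (x + t)\<close> and the chord construction from the point \<open>(P t, P' t)\<close> solve the same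
  initial value problem at \<open>x = 0\<close>.
\<close>

lemma addition_near_zero:
  assumes t: "t \<in> N"
  defines "m \<equiv> \<lambda>x. (deriv P x - deriv P t) / (P x - P t)"
  obtains \<rho> where "0 < \<rho>" "\<rho> \<le> r"
    "\<And>x. x \<in> ball 0 \<rho> - {0} \<Longrightarrow> x + t \<in> N \<and> P x \<noteq> P t \<and>
        P (x + t) = (m x)\<^sup>2 / 4 - P x - P t \<and>
        deriv P (x + t) = m x * (P x - P (x + t)) - deriv P x"
proof -
  define a b where "a = P t" "b = deriv P t"
  have b: "b\<^sup>2 = cubic a" using solvesD(2)[OF P_solves t] by (simp add: a_b_def)
  obtain T \<rho> where T: "0 < \<rho>" "\<rho> \<le> r" "solves T (ball 0 \<rho>)" "T 0 = a" "deriv T 0 = b"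
    "\<And>x. x \<in> ball 0 \<rho> - {0} \<Longrightarrow> p x \<noteq> a"
    "\<And>x. x \<in> ball 0 \<rho> - {0} \<Longrightarrow> T x = chord_third p a b x"
    using chord_third_germ[OF b] by metis
  let ?S = "{x. 1 * x + t \<in> N}"
  have "open ?S" by (rule N_preimage) simp
  moreover have "0 \<in> ?S" using t by simp
  ultimately obtain \<sigma> where \<sigma>: "\<sigma> > 0" "ball 0 \<sigma> \<subseteq> ?S" using openE by blast
  let ?B = "ball 0 (min \<rho> \<sigma>) :: complex set"
  let ?E = "?B - {0}"
  note aff = solves_affine[OF P_solves N_open disjI1[OF refl], where c = t]
  have TP: "T x = P (1 * x + t)" if "x \<in> ?B" for x
  proof (rule solves_unique[OF solves_subset[OF T(3)] solves_subset[OF aff(1)] open_ball connected_ball _ _ _ that])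
    show "?B \<subseteq> ?S" using \<sigma> by auto
    show "deriv T 0 = deriv (\<lambda>x. P (1 * x + t)) 0"
      using aff(2)[of 0] t T(5) by (simp add: a_b_def)
  qed (use T \<sigma> in \<open>auto simp: a_b_def\<close>)
  have sub: "?E \<subseteq> D" using T(2) by auto
  have B0: "open ?E" by auto
  note pc = chord_third_solves[OF solves_subset[OF p_solves sub] B0 b, of]
  have dp: "deriv P x = deriv p x" if "x \<in> ?E" for x
    by (rule deriv_cong_open[OF open_D _ P_eq_p]) (use that sub in auto)
  have res: "x + t \<in> N \<and> P x \<noteq> P t \<and>
        P (x + t) = (m x)\<^sup>2 / 4 - P x - P t \<and>
        deriv P (x + t) = m x * (P x - P (x + t)) - deriv P x" if x: "x \<in> ?E" for x
  proof -
    have xD: "x \<in> D" and xN: "x + t \<in> N" using x sub \<sigma> by auto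
    have m: "m x = chord_slope p a b x"
      by (simp add: m_def chord_slope_def dp[OF x] P_eq_p[OF xD] a_b_def)
    have K: "chord_third p a b y = P (1 * y + t)" if "y \<in> ?E" for y
      using TP[of y] T(7)[of y] that by auto
    have "deriv (chord_third p a b) x = deriv (\<lambda>y. P (1 * y + t)) x"
      by (rule deriv_cong_open[OF B0 x K])
    also have "\<dots> = deriv P (x + t)" using aff(2)[of x] xN by simp
    finally have "deriv P (x + t) = m x * (P x - P (x + t)) - deriv P x"
      using pc(2)[OF _ x] T(6) K[OF x] by (simp add: m dp[OF x] P_eq_p[OF xD])
    moreover have "P (x + t) = (m x)\<^sup>2 / 4 - P x - P t"
      using K[OF x] by (simp add: chord_third_def m P_eq_p[OF xD] a_b_def)
    ultimately show ?thesis using xN T(6)[of x] x by (auto simp: P_eq_p[OF xD] a_b_def)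
  qed
  show thesis by (rule that[of "min \<rho> \<sigma>"]) (use T \<sigma> res in auto)
qed

text \<open>
  The polynomial form of the addition theorem also covers \<open>P x = P t\<close>, where the chord is not
  defined. It holds for all admissible \<open>x\<close> by the identity theorem, since it holds near \<open>0\<close>.
\<close>

lemma addition:
  assumes x: "x \<in> N" and t: "t \<in> N" and xt: "x + t \<in> N"
  shows "4 * (P x - P t)\<^sup>2 * (P x + P t + P (x + t)) = (deriv P x - deriv P t)\<^sup>2"
    and "(deriv P (x + t) + deriv P x) * (P x - P t) = (deriv P x - deriv P t) * (P x - P (x + t))"
proof -
  obtain \<rho> where \<rho>: "0 < \<rho>" "\<rho> \<le> r" and near:
    "\<And>x. x \<in> ball 0 \<rho> - {0} \<Longrightarrow> x + t \<in> N \<and> P x \<noteq> P t \<and>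
        P (x + t) = ((deriv P x - deriv P t) / (P x - P t))\<^sup>2 / 4 - P x - P t \<and>
        deriv P (x + t) = ((deriv P x - deriv P t) / (P x - P t)) * (P x - P (x + t)) - deriv P x"
    using addition_near_zero[OF t] by metis
  let ?M = "N \<inter> {x. 1 * x + t \<in> N}" and ?B = "ball 0 \<rho> - {0 :: complex}"
  have M: "open ?M" "connected ?M"
    using N_open N_preimage[of 1 t] connected_Int_preimage[OF N_open N_connected, of 1 t]
    by (auto intro!: open_Int)
  have B: "open ?B" by auto
  have "of_real (\<rho> / 2) \<in> ?B" using \<rho> by simp
  then have B_ne: "?B \<noteq> {}" by blast
  have "?B \<subseteq> D" using \<rho> by auto
  then have BM: "?B \<subseteq> ?M" using D_subset_N near by auto
  have hol: "P holomorphic_on ?M" "deriv P holomorphic_on ?M"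
    "(\<lambda>x. P (x + t)) holomorphic_on ?M" "(\<lambda>x. deriv P (x + t)) holomorphic_on ?M"
  proof -
    have d: "deriv P holomorphic_on N" by (rule holomorphic_deriv[OF P_hol N_open])
    show "P holomorphic_on ?M" "deriv P holomorphic_on ?M"
      using P_hol d by (auto elim: holomorphic_on_subset)
    have shift: "(\<lambda>x. x + t) holomorphic_on ?M" "(\<lambda>x. x + t) ` ?M \<subseteq> N"
      by (auto intro!: holomorphic_intros)
    show "(\<lambda>x. P (x + t)) holomorphic_on ?M" "(\<lambda>x. deriv P (x + t)) holomorphic_on ?M"
      using holomorphic_on_compose_gen[OF shift(1) P_hol shift(2)]
        holomorphic_on_compose_gen[OF shift(1) d shift(2)] by (simp_all only: o_def)
  qed
  have xM: "x \<in> ?M" using x xt by simp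
  have 1: "4 * (P x - P t)\<^sup>2 * (P x + P t + P (x + t)) = (deriv P x - deriv P t)\<^sup>2" if "x \<in> ?B" for x
    using near[OF that] by (simp add: power_divide field_simps)
  have 2: "(deriv P (x + t) + deriv P x) * (P x - P t) = (deriv P x - deriv P t) * (P x - P (x + t))"
    if "x \<in> ?B" for x
  proof -
    have *: "deriv P (x + t) + deriv P x = ((deriv P x - deriv P t) / (P x - P t)) * (P x - P (x + t))"
      and ne: "P x - P t \<noteq> 0"
      using near[OF that] by (metis diff_add_cancel, simp)
    show ?thesis unfolding * using ne by simp
  qed
  show "4 * (P x - P t)\<^sup>2 * (P x + P t + P (x + t)) = (deriv P x - deriv P t)\<^sup>2"
    by (rule analytic_continuation_open[OF B M(1) B_ne M(2) BM _ _ 1 xM, of "\<lambda>y. y"])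
       (intro holomorphic_intros hol)+
  show "(deriv P (x + t) + deriv P x) * (P x - P t) = (deriv P x - deriv P t) * (P x - P (x + t))"
    by (rule analytic_continuation_open[OF B M(1) B_ne M(2) BM _ _ 2 xM, of "\<lambda>y. y"])
       (intro holomorphic_intros hol)+
qed

lemma collinear:
  assumes x: "x \<in> N" "y \<in> N" "z \<in> N" and sum: "x + y + z = 0"
  shows "deriv P x * (P z - P y) + deriv P y * (P x - P z) + deriv P z * (P y - P x) = 0"
    and "4 * (P x - P y)\<^sup>2 * (P x + P y + P z) = (deriv P x - deriv P y)\<^sup>2"
proof -
  have z: "z = - (x + y)" using sum by algebra
  have xy: "x + y \<in> N" using P_even(1)[OF x(3)] unfolding z by (simp add: add.commute)
  note ev = P_even(2,3)[OF xy, folded z] and add = addition[OF x(1,2) xy]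
  show "4 * (P x - P y)\<^sup>2 * (P x + P y + P z) = (deriv P x - deriv P y)\<^sup>2"
    using add(1) ev by simp
  show "deriv P x * (P z - P y) + deriv P y * (P x - P z) + deriv P z * (P y - P x) = 0"
    using add(2) unfolding ev by algebra
qed

text \<open>
  If \<open>P\<close> stayed away from \<open>a\<close>, then \<open>1 / (P - a)\<close> would extend to a bounded entire function.
  Density is all that can be expected here: in the degenerate cases \<open>P\<close> omits the multiple root
  of the cubic.
\<close>

lemma P_values_dense:
  assumes "\<eta> > 0"
  shows "\<exists>x\<in>N. norm (P x - a) < \<eta>"
proof (rule ccontr)
  assume "\<not> ?thesis"
  then have far: "norm (P x - a) \<ge> \<eta>" if "x \<in> N" for x using that by force
  define F where "F = (\<lambda>x. 1 / (P x - a))"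
  have mero: "P meromorphic_on UNIV" using P_nice by (simp add: nicely_meromorphic_on_def)
  have F_mero: "F meromorphic_on UNIV"
    unfolding F_def by (intro meromorphic_intros mero)
  have evN: "eventually (\<lambda>y. y \<in> N) (at x)" for x
  proof -
    have "{y. is_pole P y} sparse_in UNIV"
      using meromorphic_on_imp_not_pole_cosparse[OF mero] by (simp add: eventually_cosparse)
    then show ?thesis by (simp add: sparse_in_eventually_iff N_def)
  qed
  have F_bound: "norm (F y) \<le> 1 / \<eta>" if "y \<in> N" for y
    using far[OF that] assms by (simp add: F_def norm_divide frac_le)
  define Q where "Q = remove_sings F"
  have iso: "isolated_singularity_at F x" for x
    using F_mero meromorphic_on_isolated_singularity meromorphic_on_subset by blast
  have Q_eq: "eventually (\<lambda>y. Q y = F y) (at x)" for x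
    unfolding Q_def by (rule eventually_remove_sings_eq_at[OF iso])
  have Q_bd_ev: "eventually (\<lambda>y. norm (Q y) \<le> 1 / \<eta>) (at x)" for x
    using Q_eq[of x] evN[of x] by eventually_elim (simp add: F_bound)
  have Q_nice: "Q nicely_meromorphic_on UNIV"
    unfolding Q_def by (rule remove_sings_nicely_meromorphic[OF F_mero])
  have no_pole: "\<not> is_pole Q x" for x
  proof
    assume "is_pole Q x"
    then have "eventually (\<lambda>y. norm (Q y) > 1 / \<eta>) (at x)"
      unfolding is_pole_def by (rule filterlim_at_infinity_imp_norm_at_top[THEN filterlim_at_top_dense[THEN iffD1, rule_format]])
    with Q_bd_ev[of x] have "eventually (\<lambda>y. False) (at x)"
      by eventually_elim simp
    then show False by simp
  qed
  have Q_hol: "Q holomorphic_on UNIV"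
    by (rule analytic_imp_holomorphic, rule nicely_meromorphic_without_singularities[OF Q_nice])
       (use no_pole in simp)
  have "norm (Q x) \<le> 1 / \<eta>" for x
  proof (rule tendsto_upperbound[OF _ Q_bd_ev[of x]])
    have "isCont Q x"
      using Q_hol holomorphic_on_imp_continuous_on continuous_on_eq_continuous_at open_UNIV by blast
    then show "((\<lambda>y. norm (Q y)) \<longlongrightarrow> norm (Q x)) (at x)"
      by (intro tendsto_norm) (simp add: isCont_def)
  qed simp
  then have "bounded (range Q)" by (auto simp: bounded_iff)
  from Liouville_theorem[OF Q_hol this] obtain c where c: "\<And>x. Q x = c"
    by (auto simp: constant_on_def)
  have "eventually (\<lambda>y. P y = a + 1 / c) (at 0)"
    using Q_eq[of 0] evN[of 0]
  proof eventually_elim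
    case (elim y)
    then have "P y - a \<noteq> 0" using far[of y] assms by auto
    moreover have "c = 1 / (P y - a)" using elim(1) c[of y] by (simp add: F_def)
    ultimately show ?case by simp
  qed
  then have "frequently (\<lambda>y. P y = a + 1 / c) (at 0)" by (simp add: eventually_frequently)
  then show False using frequently_const_imp_not_is_pole P_pole by blast
qed

text \<open>
  The open set \<open>f ` U\<close> contains a value \<open>P t\<close>. At that value the derivatives agree up to sign,
  since both are square roots of the cubic, and replacing \<open>t\<close> by \<open>- t\<close> corrects the sign. By
  uniqueness \<open>f\<close> is a translate of \<open>P\<close> near the point, and therefore on \<open>U\<close>.
\<close>

lemma solution_is_translate:
  assumes U: "open U" "connected U" and f: "f holomorphic_on U" and nc: "\<not> f constant_on U"
    and ode: "\<And>x. x \<in> U \<Longrightarrow> (deriv f x)\<^sup>2 = cubic (f x)"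
  obtains c where "\<And>x. x \<in> U \<Longrightarrow> x + c \<in> N \<and> f x = P (x + c)"
proof -
  have sol: "solves f U" by (rule nonconstant_solves[OF f U nc ode])
  have "open (f ` U)" by (rule open_mapping_thm[OF f U U(1) _ nc]) simp
  moreover obtain y where "y \<in> U" using nc by (auto simp: constant_on_def)
  then have "f y \<in> f ` U" by blast
  ultimately obtain \<eta> where \<eta>: "\<eta> > 0" "ball (f y) \<eta> \<subseteq> f ` U" by (rule openE)
  define a where "a = f y"
  obtain t where t: "t \<in> N" "norm (P t - a) < \<eta>" using P_values_dense[OF \<eta>(1)] by blast
  then have "P t \<in> f ` U" using \<eta>(2) by (auto simp: a_def dist_norm norm_minus_commute)
  then obtain x0 where x0: "x0 \<in> U" "f x0 = P t" by auto
  have "(deriv f x0)\<^sup>2 = (deriv P t)\<^sup>2"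
    using ode[OF x0(1)] solvesD(2)[OF P_solves t(1)] x0 by simp
  then have "deriv f x0 = deriv P t \<or> deriv f x0 = - deriv P t"
    by (simp add: power2_eq_iff)
  then obtain u where u: "u \<in> N" "f x0 = P u" "deriv f x0 = deriv P u"
    using P_even[OF t(1)] t(1) x0 by metis
  define c where "c = u - x0"
  let ?S = "{x. 1 * x + c \<in> N}"
  have "open (U \<inter> ?S)" using U N_preimage[of 1 c] by (auto intro: open_Int)
  moreover have x0S: "x0 \<in> U \<inter> ?S" using x0 u by (simp add: c_def)
  ultimately obtain \<rho> where \<rho>: "\<rho> > 0" "ball x0 \<rho> \<subseteq> U \<inter> ?S" using openE by blast
  note aff = solves_affine[OF P_solves N_open disjI1[OF refl], where c = c]
  have near: "f x = P (1 * x + c)" if "x \<in> ball x0 \<rho>" for x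
  proof (rule solves_unique[OF solves_subset[OF sol] solves_subset[OF aff(1)] open_ball connected_ball _ _ _ that])
    show "deriv f x0 = deriv (\<lambda>x. P (1 * x + c)) x0"
      using aff(2)[of x0] x0S u by (simp add: c_def)
  qed (use \<rho> u in \<open>auto simp: c_def\<close>)
  have "1 * x + c \<in> N" "f x = P (1 * x + c)" if "x \<in> U" for x
    by (rule eq_P_extend[OF U f _ open_ball[of x0 \<rho>] _ _ _ that]; use \<rho> near in auto)+
  then show thesis by (intro that[of c]) auto
qed

end

section \<open>Symmetries of the determinant equation\<close>

lemma three_times_differentiable_imp_holomorphic:
  "f three_times_differentiable_on U \<Longrightarrow> f holomorphic_on U"
  by (auto simp: three_times_differentiable_on_def holomorphic_on_def
        field_differentiable_at_within dest: spec[of _ "0 :: nat"])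

text \<open>
  The determinant expanded along its last row; with \<open>f' = m f + n\<close> and so on the sum collapses, so
  this is the condition that three points are collinear.
\<close>

lemma det_equation_iff:
  "det_equation U V W f g h \<longleftrightarrow>
     (\<forall>x\<in>U. \<forall>y\<in>V. \<forall>z\<in>W. x + y + z = 0 \<longrightarrow>
        deriv f x * (h z - g y) + deriv g y * (f x - h z) + deriv h z * (g y - f x) = 0)"
proof -
  have "det (vector [vector [1, 1, 1], vector [a, b, c], vector [a', b', c']] :: complex^3^3)
          = a' * (c - b) + b' * (a - c) + c' * (b - a)" for a b c a' b' c'
    by (simp add: det_3 vector_3 algebra_simps)
  then show ?thesis unfolding det_equation_def by simp
qed

lemma det_equation_commute:
  "det_equation U V W f g h \<longleftrightarrow> det_equation V U W g f h"
  "det_equation U V W f g h \<longleftrightarrow> det_equation U W V f h g"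
proof -
  have "det_equation V U W g f h" if "det_equation U V W f g h" for U V W f g h
    unfolding det_equation_iff
  proof (intro ballI impI)
    fix x y z assume xyz: "x \<in> V" "y \<in> U" "z \<in> W" and "x + y + z = 0"
    then have "y + x + z = 0" by (simp add: add_ac)
    with that xyz have "deriv f y * (h z - g x) + deriv g x * (f y - h z) + deriv h z * (g x - f y) = 0"
      unfolding det_equation_iff by blast
    then show "deriv g x * (h z - f y) + deriv f y * (g x - h z) + deriv h z * (f y - g x) = 0"
      by algebra
  qed
  then show "det_equation U V W f g h \<longleftrightarrow> det_equation V U W g f h" by blast
  have "det_equation U W V f h g" if "det_equation U V W f g h" for U V W f g h
    unfolding det_equation_iff
  proof (intro ballI impI)
    fix x y z assume xyz: "x \<in> U" "y \<in> W" "z \<in> V" and "x + y + z = 0"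
    then have "x + z + y = 0" by (simp add: add_ac)
    with that xyz have "deriv f x * (h y - g z) + deriv g z * (f x - h y) + deriv h y * (g z - f x) = 0"
      unfolding det_equation_iff by blast
    then show "deriv f x * (g z - h y) + deriv h y * (f x - g z) + deriv g z * (h y - f x) = 0"
      by algebra
  qed
  then show "det_equation U V W f g h \<longleftrightarrow> det_equation U W V f h g" by blast
qed

lemma arises_fromI:
  assumes "\<alpha> \<noteq> 0" "\<gamma>\<^sub>1 + \<gamma>\<^sub>2 + \<gamma>\<^sub>3 = 0"
    and "\<And>x. x \<in> U \<Longrightarrow> \<delta> * x + \<gamma>\<^sub>1 \<in> D \<and> f x = \<alpha> * p (\<delta> * x + \<gamma>\<^sub>1) + \<beta>"
    and "\<And>x. x \<in> V \<Longrightarrow> \<delta> * x + \<gamma>\<^sub>2 \<in> D \<and> g x = \<alpha> * q (\<delta> * x + \<gamma>\<^sub>2) + \<beta>"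
    and "\<And>x. x \<in> W \<Longrightarrow> \<delta> * x + \<gamma>\<^sub>3 \<in> D \<and> h x = \<alpha> * r (\<delta> * x + \<gamma>\<^sub>3) + \<beta>"
  shows "arises_from D p q r U V W f g h"
  using assms unfolding arises_from_def affine_transform_def by blast

lemma arises_from_commute:
  "arises_from D p q r U V W f g h \<longleftrightarrow> arises_from D q p r V U W g f h"
  "arises_from D p q r U V W f g h \<longleftrightarrow> arises_from D p r q U W V f h g"
proof -
  have "arises_from D q p r V U W g f h" if af: "arises_from D p q r U V W f g h"
    for p q r U V W f g h
  proof -
    obtain \<alpha> \<beta> \<delta> \<gamma>\<^sub>1 \<gamma>\<^sub>2 \<gamma>\<^sub>3 where *: "\<alpha> \<noteq> 0" "\<gamma>\<^sub>1 + \<gamma>\<^sub>2 + \<gamma>\<^sub>3 = 0"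
      "\<forall>x\<in>U. \<delta> * x + \<gamma>\<^sub>1 \<in> D \<and> f x = affine_transform \<alpha> \<beta> \<delta> \<gamma>\<^sub>1 p x"
      "\<forall>x\<in>V. \<delta> * x + \<gamma>\<^sub>2 \<in> D \<and> g x = affine_transform \<alpha> \<beta> \<delta> \<gamma>\<^sub>2 q x"
      "\<forall>x\<in>W. \<delta> * x + \<gamma>\<^sub>3 \<in> D \<and> h x = affine_transform \<alpha> \<beta> \<delta> \<gamma>\<^sub>3 r x"
      using af unfolding arises_from_def by blast
    moreover have "\<gamma>\<^sub>2 + \<gamma>\<^sub>1 + \<gamma>\<^sub>3 = 0" using *(2) by (simp add: add_ac)
    ultimately show ?thesis unfolding arises_from_def by blast
  qed
  then show "arises_from D p q r U V W f g h \<longleftrightarrow> arises_from D q p r V U W g f h" by blast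
  have "arises_from D p r q U W V f h g" if af: "arises_from D p q r U V W f g h"
    for p q r U V W f g h
  proof -
    obtain \<alpha> \<beta> \<delta> \<gamma>\<^sub>1 \<gamma>\<^sub>2 \<gamma>\<^sub>3 where *: "\<alpha> \<noteq> 0" "\<gamma>\<^sub>1 + \<gamma>\<^sub>2 + \<gamma>\<^sub>3 = 0"
      "\<forall>x\<in>U. \<delta> * x + \<gamma>\<^sub>1 \<in> D \<and> f x = affine_transform \<alpha> \<beta> \<delta> \<gamma>\<^sub>1 p x"
      "\<forall>x\<in>V. \<delta> * x + \<gamma>\<^sub>2 \<in> D \<and> g x = affine_transform \<alpha> \<beta> \<delta> \<gamma>\<^sub>2 q x"
      "\<forall>x\<in>W. \<delta> * x + \<gamma>\<^sub>3 \<in> D \<and> h x = affine_transform \<alpha> \<beta> \<delta> \<gamma>\<^sub>3 r x"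
      using af unfolding arises_from_def by blast
    moreover have "\<gamma>\<^sub>1 + \<gamma>\<^sub>3 + \<gamma>\<^sub>2 = 0" using *(2) by (simp add: add_ac)
    ultimately show ?thesis unfolding arises_from_def by blast
  qed
  then show "arises_from D p q r U V W f g h \<longleftrightarrow> arises_from D p r q U W V f h g" by blast
qed

lemma det_equation_cong:
  assumes "open U" "open V" "open W"
    and "\<And>x. x \<in> U \<Longrightarrow> x \<in> U' \<and> f x = f' x" "\<And>x. x \<in> V \<Longrightarrow> x \<in> V' \<and> g x = g' x"
        "\<And>x. x \<in> W \<Longrightarrow> x \<in> W' \<and> h x = h' x"
    and "det_equation U' V' W' f' g' h'"
  shows "det_equation U V W f g h"
proof -
  have d: "x \<in> U \<Longrightarrow> deriv f x = deriv f' x" "x \<in> V \<Longrightarrow> deriv g x = deriv g' x"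
    "x \<in> W \<Longrightarrow> deriv h x = deriv h' x" for x
    using deriv_cong_open assms(1-6) by metis+
  show ?thesis
    using assms(4-7) d unfolding det_equation_iff by simp
qed

lemma det_equation_affine_transform:
  assumes UVW: "open U" "open V" "open W"
    and fgh: "f holomorphic_on U" "g holomorphic_on V" "h holomorphic_on W"
    and sum: "\<gamma>\<^sub>1 + \<gamma>\<^sub>2 + \<gamma>\<^sub>3 = 0" and det: "det_equation U V W f g h"
  shows "det_equation {x. \<delta> * x + \<gamma>\<^sub>1 \<in> U} {x. \<delta> * x + \<gamma>\<^sub>2 \<in> V} {x. \<delta> * x + \<gamma>\<^sub>3 \<in> W}
          (affine_transform \<alpha> \<beta> \<delta> \<gamma>\<^sub>1 f) (affine_transform \<alpha> \<beta> \<delta> \<gamma>\<^sub>2 g)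
          (affine_transform \<alpha> \<beta> \<delta> \<gamma>\<^sub>3 h)"
proof -
  have d: "deriv (affine_transform \<alpha> \<beta> \<delta> \<gamma> p) x = \<alpha> * (\<delta> * deriv p (\<delta> * x + \<gamma>))"
    if "p holomorphic_on S" "open S" "\<delta> * x + \<gamma> \<in> S" for p S \<gamma> x
  proof -
    have "((\<lambda>x. \<delta> * x + \<gamma>) has_field_derivative \<delta>) (at x)"
      by (auto intro!: derivative_eq_intros)
    from DERIV_chain2[OF has_field_derivative_deriv[OF that] this]
    have "((\<lambda>x. p (\<delta> * x + \<gamma>)) has_field_derivative deriv p (\<delta> * x + \<gamma>) * \<delta>) (at x)" .
    from DERIV_add[OF DERIV_cmult[OF this, of \<alpha>] DERIV_const[of \<beta>]] show ?thesis
      unfolding affine_transform_def by (intro DERIV_imp_deriv) (simp add: mult_ac)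
  qed
  show ?thesis
    unfolding det_equation_iff
  proof (intro ballI impI)
    fix x y z
    assume xyz: "x \<in> {x. \<delta> * x + \<gamma>\<^sub>1 \<in> U}" "y \<in> {x. \<delta> * x + \<gamma>\<^sub>2 \<in> V}" "z \<in> {x. \<delta> * x + \<gamma>\<^sub>3 \<in> W}"
      and "x + y + z = 0"
    have "(\<delta> * x + \<gamma>\<^sub>1) + (\<delta> * y + \<gamma>\<^sub>2) + (\<delta> * z + \<gamma>\<^sub>3) = 0"
      using sum \<open>x + y + z = 0\<close> by algebra
    with det xyz have "deriv f (\<delta> * x + \<gamma>\<^sub>1) * (h (\<delta> * z + \<gamma>\<^sub>3) - g (\<delta> * y + \<gamma>\<^sub>2))
        + deriv g (\<delta> * y + \<gamma>\<^sub>2) * (f (\<delta> * x + \<gamma>\<^sub>1) - h (\<delta> * z + \<gamma>\<^sub>3))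
        + deriv h (\<delta> * z + \<gamma>\<^sub>3) * (g (\<delta> * y + \<gamma>\<^sub>2) - f (\<delta> * x + \<gamma>\<^sub>1)) = 0"
      unfolding det_equation_iff by blast
    moreover have "deriv (affine_transform \<alpha> \<beta> \<delta> \<gamma>\<^sub>1 f) x = \<alpha> * (\<delta> * deriv f (\<delta> * x + \<gamma>\<^sub>1))"
      "deriv (affine_transform \<alpha> \<beta> \<delta> \<gamma>\<^sub>2 g) y = \<alpha> * (\<delta> * deriv g (\<delta> * y + \<gamma>\<^sub>2))"
      "deriv (affine_transform \<alpha> \<beta> \<delta> \<gamma>\<^sub>3 h) z = \<alpha> * (\<delta> * deriv h (\<delta> * z + \<gamma>\<^sub>3))"
      using xyz fgh UVW d by auto
    ultimately show "deriv (affine_transform \<alpha> \<beta> \<delta> \<gamma>\<^sub>1 f) x * (affine_transform \<alpha> \<beta> \<delta> \<gamma>\<^sub>3 h z - affine_transform \<alpha> \<beta> \<delta> \<gamma>\<^sub>2 g y)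
        + deriv (affine_transform \<alpha> \<beta> \<delta> \<gamma>\<^sub>2 g) y * (affine_transform \<alpha> \<beta> \<delta> \<gamma>\<^sub>1 f x - affine_transform \<alpha> \<beta> \<delta> \<gamma>\<^sub>3 h z)
        + deriv (affine_transform \<alpha> \<beta> \<delta> \<gamma>\<^sub>3 h) z * (affine_transform \<alpha> \<beta> \<delta> \<gamma>\<^sub>2 g y - affine_transform \<alpha> \<beta> \<delta> \<gamma>\<^sub>1 f x) = 0"
      unfolding affine_transform_def by algebra
  qed
qed

lemma arises_from_imp_det_equation:
  assumes UVW: "open U" "open V" "open W" and D: "open D"
    and pqr: "p holomorphic_on D" "q holomorphic_on D" "r holomorphic_on D"
    and det: "det_equation D D D p q r" and af: "arises_from D p q r U V W f g h"
  shows "det_equation U V W f g h"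
proof -
  obtain \<alpha> \<beta> \<delta> \<gamma>\<^sub>1 \<gamma>\<^sub>2 \<gamma>\<^sub>3 where sum: "\<gamma>\<^sub>1 + \<gamma>\<^sub>2 + \<gamma>\<^sub>3 = 0"
    and eqs: "\<forall>x\<in>U. \<delta> * x + \<gamma>\<^sub>1 \<in> D \<and> f x = affine_transform \<alpha> \<beta> \<delta> \<gamma>\<^sub>1 p x"
      "\<forall>x\<in>V. \<delta> * x + \<gamma>\<^sub>2 \<in> D \<and> g x = affine_transform \<alpha> \<beta> \<delta> \<gamma>\<^sub>2 q x"
      "\<forall>x\<in>W. \<delta> * x + \<gamma>\<^sub>3 \<in> D \<and> h x = affine_transform \<alpha> \<beta> \<delta> \<gamma>\<^sub>3 r x"
    using af unfolding arises_from_def by blast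
  show ?thesis
    by (rule det_equation_cong[OF UVW _ _ _ det_equation_affine_transform[OF D D D pqr sum det, of \<delta> \<alpha> \<beta>]])
       (use eqs in auto)
qed

section \<open>Solutions with a constant function\<close>

lemma eventually_not_value:
  assumes f: "f holomorphic_on U" and U: "open U" "connected U" and nc: "\<not> (\<forall>x\<in>U. f x = c)"
    and x: "x \<in> U"
  shows "eventually (\<lambda>y. f y \<noteq> c) (at x)"
proof -
  have "f nicely_meromorphic_on U"
    by (rule analytic_on_imp_nicely_meromorphic_on) (simp add: analytic_on_open U f)
  from nicely_meromorphic_imp_constant_or_avoid[OF this U, of c] nc
  have "\<forall>\<^sub>\<approx>x\<in>U. f x \<noteq> c" by blast
  then show ?thesis using x by (simp add: eventually_cosparse_open_eq[OF U(1)])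
qed

lemma exponential_growth_solution:
  assumes f: "f holomorphic_on U" and U: "open U" "connected U"
    and ode: "\<And>x. x \<in> U \<Longrightarrow> deriv f x = \<mu> * (f x - c)"
  obtains A where "\<And>x. x \<in> U \<Longrightarrow> f x = A * exp (\<mu> * x) + c"
proof -
  have "((\<lambda>x. (f x - c) * exp (- (\<mu> * x))) has_field_derivative 0) (at x)" if "x \<in> U" for x
  proof (rule DERIV_cong[OF DERIV_mult[OF DERIV_diff[OF has_field_derivative_deriv[OF f U(1) that] DERIV_const]]])
    show "((\<lambda>x. exp (- (\<mu> * x))) has_field_derivative - \<mu> * exp (- (\<mu> * x))) (at x)"
      by (auto intro!: derivative_eq_intros)
  qed (simp add: ode[OF that])
  then have "(\<lambda>x. (f x - c) * exp (- (\<mu> * x))) constant_on U"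
    by (intro has_field_derivative_0_imp_constant_on U) (auto simp: has_field_derivative_at_within)
  then obtain A where A: "\<And>x. x \<in> U \<Longrightarrow> (f x - c) * exp (- (\<mu> * x)) = A"
    by (auto simp: constant_on_def)
  show thesis
  proof (rule that[of A])
    fix x assume "x \<in> U"
    from A[OF this] have "A * exp (\<mu> * x) = (f x - c) * (exp (- (\<mu> * x)) * exp (\<mu> * x))"
      by (simp add: mult.assoc)
    then show "f x = A * exp (\<mu> * x) + c" by (simp flip: exp_add)
  qed
qed

text \<open>
  With \<open>h = c\<close> the equation reads \<open>f' (g - c) = g' (f - c)\<close>. Fixing \<open>y\<close> with \<open>g y \<noteq> c\<close> gives
  \<open>f' = \<mu> (f - c)\<close> on an open set, hence on \<open>U\<close>, and fixing \<open>x\<close> gives the same equation for \<open>g\<close>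
  with the same \<open>\<mu>\<close>. For \<open>\<mu> = 0\<close> both functions are constants different from \<open>c\<close>.
\<close>

lemma constant_third_function:
  assumes U: "open U" "connected U" and V: "open V" "connected V" and W: "open W"
    and triple: "x0 \<in> U" "y0 \<in> V" "z0 \<in> W" "x0 + y0 + z0 = 0"
    and f: "f holomorphic_on U" and g: "g holomorphic_on V" and h: "\<And>z. z \<in> W \<Longrightarrow> h z = c"
  shows "det_equation U V W f g h \<longleftrightarrow>
           (\<forall>x\<in>U. f x = c) \<or> (\<forall>y\<in>V. g y = c) \<or> arises_from UNIV exp exp (\<lambda>_. 0) U V W f g h"
proof
  assume det: "det_equation U V W f g h"
  have dh: "deriv h z = 0" if "z \<in> W" for z
    using deriv_cong_open[OF W that, of h "\<lambda>_. c"] h by simp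
  have eq: "deriv f x * (c - g y) + deriv g y * (f x - c) = 0"
    if "x \<in> U" "y \<in> V" "- x - y \<in> W" for x y
    using det that h[OF that(3)] dh[OF that(3)] unfolding det_equation_iff by fastforce
  show "(\<forall>x\<in>U. f x = c) \<or> (\<forall>y\<in>V. g y = c) \<or> arises_from UNIV exp exp (\<lambda>_. 0) U V W f g h"
  proof (rule ccontr)
    assume "\<not> ?thesis"
    then have nf: "\<not> (\<forall>x\<in>U. f x = c)" and ng: "\<not> (\<forall>y\<in>V. g y = c)"
      and na: "\<not> arises_from UNIV exp exp (\<lambda>_. 0) U V W f g h" by auto
    have z0: "z0 = - x0 - y0" using triple(4) by algebra
    have openx: "open {x \<in> U. - x - b \<in> W}" and openy: "open {y \<in> V. - b - y \<in> W}" for b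
      using open_Int[OF U(1) open_vimage[OF W, of "\<lambda>x. - x - b"]]
        open_Int[OF V(1) open_vimage[OF W, of "\<lambda>y. - b - y"]]
      by (simp_all add: vimage_def Int_def continuous_intros)
    have "eventually (\<lambda>y. g y \<noteq> c \<and> y \<in> {y \<in> V. - x0 - y \<in> W}) (at y0)"
      using eventually_not_value[OF g V ng triple(2)] eventually_at_in_open'[OF openy, of y0 x0] triple z0
      by (auto intro: eventually_conj)
    then obtain y1 where y1: "g y1 \<noteq> c" "y1 \<in> V" "- x0 - y1 \<in> W"
      using eventually_happens[of _ "at y0"] by auto
    have "eventually (\<lambda>x. f x \<noteq> c \<and> x \<in> {x \<in> U. - x - y1 \<in> W}) (at x0)"
      using eventually_not_value[OF f U nf triple(1)] eventually_at_in_open'[OF openx, of x0 y1] triple y1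
      by (auto intro: eventually_conj)
    then obtain x1 where x1: "f x1 \<noteq> c" "x1 \<in> U" "- x1 - y1 \<in> W"
      using eventually_happens[of _ "at x0"] by auto
    define \<mu> where "\<mu> = deriv g y1 / (g y1 - c)"
    have \<mu>': "deriv f x1 = \<mu> * (f x1 - c)"
      using eq[OF x1(2) y1(2) x1(3)] y1(1) unfolding \<mu>_def by (simp add: field_simps)
    have odef: "deriv f x = \<mu> * (f x - c)" if "x \<in> U" for x
    proof (rule analytic_continuation_open[OF openx U(1) _ U(2) _ _ _ _ that])
      show "{x \<in> U. - x - y1 \<in> W} \<noteq> {}" using x1 by blast
      show "deriv f x = \<mu> * (f x - c)" if "x \<in> {x \<in> U. - x - y1 \<in> W}" for x
        using eq[of x y1] that y1 unfolding \<mu>_def by (simp add: field_simps)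
    qed (use f U in \<open>auto intro!: holomorphic_intros holomorphic_deriv\<close>)
    have odeg: "deriv g y = \<mu> * (g y - c)" if "y \<in> V" for y
    proof (rule analytic_continuation_open[OF openy V(1) _ V(2) _ _ _ _ that])
      show "{y \<in> V. - x1 - y \<in> W} \<noteq> {}" using x1 y1 by blast
      show "deriv g y = \<mu> * (g y - c)" if "y \<in> {y \<in> V. - x1 - y \<in> W}" for y
      proof -
        have "(f x1 - c) * (deriv g y - \<mu> * (g y - c)) = 0"
          using eq[of x1 y, OF x1(2)] that \<mu>' by simp algebra
        then show ?thesis using x1(1) by simp
      qed
    qed (use g V in \<open>auto intro!: holomorphic_intros holomorphic_deriv\<close>)
    obtain A where A: "\<And>x. x \<in> U \<Longrightarrow> f x = A * exp (\<mu> * x) + c"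
      using exponential_growth_solution[OF f U odef] by blast
    obtain B where B: "\<And>y. y \<in> V \<Longrightarrow> g y = B * exp (\<mu> * y) + c"
      using exponential_growth_solution[OF g V odeg] by blast
    have nz: "A \<noteq> 0" "B \<noteq> 0" using A B nf ng by auto
    have "arises_from UNIV exp exp (\<lambda>_. 0) U V W f g h"
      by (rule arises_fromI[where \<alpha> = 1 and \<beta> = c and \<delta> = \<mu> and \<gamma>\<^sub>1 = "Ln A"
            and \<gamma>\<^sub>2 = "Ln B" and \<gamma>\<^sub>3 = "- Ln A - Ln B"])
         (use A B h nz in \<open>auto simp: exp_add\<close>)
    with na show False by simp
  qed
next
  assume "(\<forall>x\<in>U. f x = c) \<or> (\<forall>y\<in>V. g y = c) \<or> arises_from UNIV exp exp (\<lambda>_. 0) U V W f g h"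
  then show "det_equation U V W f g h"
  proof (elim disjE)
    assume af: "arises_from UNIV exp exp (\<lambda>_. 0) U V W f g h"
    have "det_equation UNIV UNIV UNIV exp exp (\<lambda>_. 0)"
      by (simp add: det_equation_iff DERIV_imp_deriv[OF DERIV_exp] mult.commute)
    then show ?thesis
      by (intro arises_from_imp_det_equation[OF U(1) V(1) W open_UNIV _ _ _ _ af])
         (auto intro!: holomorphic_intros)
  next
    assume fc: "\<forall>x\<in>U. f x = c"
    have "det_equation UNIV V UNIV (\<lambda>_. c) g (\<lambda>_. c)" by (simp add: det_equation_iff)
    then show ?thesis by (rule det_equation_cong[rotated -1]) (use fc h U V W in auto)
  next
    assume gc: "\<forall>y\<in>V. g y = c"
    have "det_equation U UNIV UNIV f (\<lambda>_. c) (\<lambda>_. c)" by (simp add: det_equation_iff)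
    then show ?thesis by (rule det_equation_cong[rotated -1]) (use gc h U V W in auto)
  qed
qed

section \<open>Nonconstant solutions\<close>

text \<open>
  Nonconstant holomorphic functions take each value on a discrete set only. First \<open>y\<close> is moved,
  with \<open>x0\<close> fixed, to separate \<open>f\<close> from \<open>g\<close> and from \<open>h\<close>; then \<open>x\<close> is moved, with \<open>y1\<close> fixed,
  to separate \<open>g\<close> from \<open>h\<close> while keeping the first two conditions by continuity.
\<close>

lemma generic_triple:
  assumes U: "open U" "connected U" and V: "open V" "connected V" and W: "open W" "connected W"
    and triple: "x0 \<in> U" "y0 \<in> V" "z0 \<in> W" "x0 + y0 + z0 = 0"
    and f: "f holomorphic_on U" and g: "g holomorphic_on V" and h: "h holomorphic_on W"
    and nf: "\<not> f constant_on U" and ng: "\<not> g constant_on V" and nh: "\<not> h constant_on W"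
  obtains x1 y1 \<epsilon> where "\<epsilon> > 0" "ball x1 \<epsilon> \<subseteq> U" "ball y1 \<epsilon> \<subseteq> V"
    "\<And>x y. x \<in> ball x1 \<epsilon> \<Longrightarrow> y \<in> ball y1 \<epsilon> \<Longrightarrow>
       - x - y \<in> W \<and> f x \<noteq> g y \<and> f x \<noteq> h (- x - y) \<and> g y \<noteq> h (- x - y)"
proof -
  have nv: "\<not> (\<forall>x\<in>U. f x = c)" "\<not> (\<forall>x\<in>V. g x = c)" "\<not> (\<forall>x\<in>W. h x = c)" for c
    using nf ng nh by (auto simp: constant_on_def)
  have z0: "z0 = - x0 - y0" using triple(4) by algebra
  have contf: "isCont f x" if "x \<in> U" for x
    using that U f holomorphic_on_imp_continuous_on continuous_on_eq_continuous_at by blast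
  have contg: "isCont g x" if "x \<in> V" for x
    using that V g holomorphic_on_imp_continuous_on continuous_on_eq_continuous_at by blast
  have conth: "isCont h x" if "x \<in> W" for x
    using that W h holomorphic_on_imp_continuous_on continuous_on_eq_continuous_at by blast
  have lim: "filterlim (\<lambda>y. - b - y) (at (- b - y)) (at y)" for b y :: complex
    using filterlim_sign_affine[of "-1" "- b" y] by (simp add: minus_diff_commute[of b])
  have evh: "eventually (\<lambda>y. h (- b - y) \<noteq> c \<and> - b - y \<in> W) (at y)" if "- b - y \<in> W" for b y c
  proof -
    have "eventually (\<lambda>z. h z \<noteq> c \<and> z \<in> W) (at (- b - y))"
      using eventually_not_value[OF h W nv(3) that] eventually_at_in_open'[OF W(1) that]
      by (rule eventually_conj)
    then show ?thesis using lim unfolding filterlim_iff by blast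
  qed
  have "eventually (\<lambda>y. g y \<noteq> f x0 \<and> h (- x0 - y) \<noteq> f x0 \<and> - x0 - y \<in> W \<and> y \<in> V) (at y0)"
    using eventually_not_value[OF g V nv(2)[of "f x0"] triple(2)]
      evh[OF triple(3)[unfolded z0], of "f x0"] eventually_at_in_open'[OF V(1) triple(2)]
    by eventually_elim auto
  then obtain y1 where y1: "g y1 \<noteq> f x0" "h (- x0 - y1) \<noteq> f x0" "- x0 - y1 \<in> W" "y1 \<in> V"
    using eventually_happens[of _ "at y0"] by auto
  have contd: "isCont (\<lambda>x. f x - h (- x - y1)) x0"
  proof (intro continuous_intros contf triple)
    have "isCont (\<lambda>x. - x - y1) x0" by (intro continuous_intros)
    then show "isCont (\<lambda>x. h (- x - y1)) x0" by (rule isCont_o2) (rule conth[OF y1(3)])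
  qed
  have "eventually (\<lambda>x. f x \<noteq> g y1) (at x0)"
    by (rule tendsto_imp_eventually_ne[of f "f x0"])
       (use contf[OF triple(1)] y1 in \<open>auto simp: isCont_def\<close>)
  moreover have "eventually (\<lambda>x. f x - h (- x - y1) \<noteq> 0) (at x0)"
    by (rule tendsto_imp_eventually_ne[OF contd[unfolded isCont_def]]) (use y1 in auto)
  moreover have "eventually (\<lambda>x. h (- x - y1) \<noteq> g y1 \<and> - x - y1 \<in> W) (at x0)"
    using evh[of y1 x0 "g y1"] y1(3) unfolding minus_diff_commute[of y1] by simp
  moreover have "eventually (\<lambda>x. x \<in> U) (at x0)"
    by (rule eventually_at_in_open'[OF U(1) triple(1)])
  ultimately have "eventually (\<lambda>x. f x \<noteq> g y1 \<and> f x \<noteq> h (- x - y1) \<and> h (- x - y1) \<noteq> g y1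
      \<and> - x - y1 \<in> W \<and> x \<in> U) (at x0)"
    by eventually_elim auto
  then obtain x1 where x1: "f x1 \<noteq> g y1" "f x1 \<noteq> h (- x1 - y1)" "h (- x1 - y1) \<noteq> g y1"
      "- x1 - y1 \<in> W" "x1 \<in> U"
    using eventually_happens[of _ "at x0"] by auto
  define z1 where "z1 = - x1 - y1"
  \<comment> \<open>Discs of radius \<open>\<eta>\<close> around the three values are disjoint.\<close>
  define \<eta> where "\<eta> = min (dist (f x1) (g y1)) (min (dist (f x1) (h z1)) (dist (h z1) (g y1))) / 2"
  have \<eta>: "\<eta> > 0" "2 * \<eta> \<le> dist (f x1) (g y1)" "2 * \<eta> \<le> dist (f x1) (h z1)" "2 * \<eta> \<le> dist (h z1) (g y1)"
    using x1 by (auto simp: \<eta>_def z1_def)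
  have op: "\<exists>\<epsilon>>0. \<forall>x\<in>ball x1 \<epsilon>. x \<in> S \<and> dist (f x) (f x1) < \<eta>"
    if S: "open S" "x1 \<in> S" "isCont f x1" for S and f :: "complex \<Rightarrow> complex" and x1
  proof -
    have "eventually (\<lambda>x. dist (f x) (f x1) < \<eta>) (nhds x1)"
      using S(3) \<eta>(1) by (auto simp: continuous_within tendsto_iff eventually_at_filter elim!: eventually_mono)
    then have "eventually (\<lambda>x. x \<in> S \<and> dist (f x) (f x1) < \<eta>) (nhds x1)"
      using eventually_nhds_in_open[OF S(1,2)] by eventually_elim auto
    then show ?thesis by (auto simp: eventually_nhds_metric dist_commute)
  qed
  obtain a where a: "a > 0" "\<And>x. x \<in> ball x1 a \<Longrightarrow> x \<in> U \<and> dist (f x) (f x1) < \<eta>"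
    using op[OF U(1) x1(5) contf[OF x1(5)]] by blast
  obtain b where b: "b > 0" "\<And>x. x \<in> ball y1 b \<Longrightarrow> x \<in> V \<and> dist (g x) (g y1) < \<eta>"
    using op[OF V(1) y1(4) contg[OF y1(4)]] by blast
  obtain c where c: "c > 0" "\<And>x. x \<in> ball z1 c \<Longrightarrow> x \<in> W \<and> dist (h x) (h z1) < \<eta>"
    using op[OF W(1), of z1 h] x1(4) conth[OF x1(4)] unfolding z1_def by blast
  \<comment> \<open>Half of \<open>c\<close>, because \<open>- x - y\<close> moves by the sum of both displacements.\<close>
  define \<epsilon> where "\<epsilon> = min a (min b (c / 2))"
  show thesis
  proof (rule that[of \<epsilon> x1 y1])
    show "\<epsilon> > 0" using a b c by (simp add: \<epsilon>_def)
    show "ball x1 \<epsilon> \<subseteq> U" using a(2) by (auto simp: \<epsilon>_def)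
    show "ball y1 \<epsilon> \<subseteq> V" using b(2) by (auto simp: \<epsilon>_def)
    fix x y assume xy: "x \<in> ball x1 \<epsilon>" "y \<in> ball y1 \<epsilon>"
    have "z1 - (- x - y) = - (x1 - x) - (y1 - y)" by (simp add: z1_def)
    then have "dist z1 (- x - y) \<le> dist x1 x + dist y1 y"
      unfolding dist_norm by (metis norm_minus_cancel norm_triangle_ineq4)
    also have "\<dots> < c" using xy by (auto simp: \<epsilon>_def)
    finally have z: "- x - y \<in> ball z1 c" by simp
    have dx: "dist (f x) (f x1) < \<eta>" and dy: "dist (g y) (g y1) < \<eta>"
      and dz: "dist (h (- x - y)) (h z1) < \<eta>"
      using a(2)[of x] b(2)[of y] c(2)[OF z] xy by (auto simp: \<epsilon>_def)
    have sep: "p' \<noteq> q'" if "2 * \<eta> \<le> dist p q" "dist p' p < \<eta>" "dist q' q < \<eta>" for p q p' q' :: complex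
      using dist_triangle3[of p q p'] that by auto
    show "- x - y \<in> W \<and> f x \<noteq> g y \<and> f x \<noteq> h (- x - y) \<and> g y \<noteq> h (- x - y)"
      using c(2)[OF z] sep[OF \<eta>(2) dx dy] sep[OF \<eta>(3) dx dz] sep[OF \<eta>(4) dz dy] by auto
  qed
qed

text \<open>
  The amplitudes become translations of the argument. A common factor has to be split off so that
  the three translations add up to \<open>0\<close>; the geometric mean \<open>exp m\<close> of the amplitudes does this.
\<close>

lemma exponential_triple_arises:
  assumes "A \<noteq> 0" "B \<noteq> 0" "C \<noteq> 0"
    and "\<And>x. x \<in> U \<Longrightarrow> f x = A * exp (\<mu> * x) + c" "\<And>x. x \<in> V \<Longrightarrow> g x = B * exp (\<mu> * x) + c"
        "\<And>x. x \<in> W \<Longrightarrow> h x = C * exp (\<mu> * x) + c"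
  shows "arises_from UNIV exp exp exp U V W f g h"
proof -
  define m where "m = (Ln A + Ln B + Ln C) / 3"
  have e: "exp m * exp (\<mu> * x + (Ln X - m)) = X * exp (\<mu> * x)" if "X \<noteq> 0" for X x
  proof -
    have "exp m * exp (\<mu> * x + (Ln X - m)) = exp (Ln X + \<mu> * x)"
      by (simp flip: exp_add add: algebra_simps)
    then show ?thesis using that by (simp add: exp_add)
  qed
  have "(Ln A - m) + (Ln B - m) + (Ln C - m) = 0" by (simp add: m_def field_simps)
  then show ?thesis
    by (rule arises_fromI[where \<alpha> = "exp m" and \<beta> = c and \<delta> = \<mu>, rotated])
       (simp_all add: assms e)
qed

text \<open>
  As for exponentials, with the arithmetic mean of the constant terms as the common part.
\<close>

lemma linear_triple_arises:
  assumes "\<nu> \<noteq> 0"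
    and "\<And>x. x \<in> U \<Longrightarrow> f x = \<nu> * x + a" "\<And>x. x \<in> V \<Longrightarrow> g x = \<nu> * x + b"
        "\<And>x. x \<in> W \<Longrightarrow> h x = \<nu> * x + c"
  shows "arises_from UNIV (\<lambda>x. x) (\<lambda>x. x) (\<lambda>x. x) U V W f g h"
proof -
  define m where "m = (a + b + c) / 3"
  have "(a - m) / \<nu> + (b - m) / \<nu> + (c - m) / \<nu> = 0"
    by (simp add: m_def field_simps flip: add_divide_distrib)
  then show ?thesis
    by (rule arises_fromI[where \<alpha> = \<nu> and \<beta> = m and \<delta> = 1, rotated])
       (simp_all add: assms distrib_left)
qed

lemma straight_triple_arises:
  assumes U: "open U" "connected U" and V: "open V" "connected V" and W: "open W" "connected W"
    and f: "f holomorphic_on U" and g: "g holomorphic_on V" and h: "h holomorphic_on W"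
    and nf: "\<not> f constant_on U" and ng: "\<not> g constant_on V" and nh: "\<not> h constant_on W"
    and ode: "\<And>x. x \<in> U \<Longrightarrow> deriv f x = \<mu> * f x + \<nu>" "\<And>x. x \<in> V \<Longrightarrow> deriv g x = \<mu> * g x + \<nu>"
        "\<And>x. x \<in> W \<Longrightarrow> deriv h x = \<mu> * h x + \<nu>"
  shows "arises_from UNIV exp exp exp U V W f g h \<or>
         arises_from UNIV (\<lambda>x. x) (\<lambda>x. x) (\<lambda>x. x) U V W f g h"
proof (cases "\<mu> = 0")
  case False
  define c where "c = - \<nu> / \<mu>"
  have sol: "\<exists>A. A \<noteq> 0 \<and> (\<forall>x\<in>S. k x = A * exp (\<mu> * x) + c)"
    if k: "k holomorphic_on S" "open S" "connected S" "\<not> k constant_on S"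
      "\<And>x. x \<in> S \<Longrightarrow> deriv k x = \<mu> * k x + \<nu>" for k S
  proof -
    have "deriv k x = \<mu> * (k x - c)" if "x \<in> S" for x
      using k(5)[OF that] False by (simp add: c_def field_simps)
    from exponential_growth_solution[OF k(1-3) this]
    obtain A where A: "\<And>x. x \<in> S \<Longrightarrow> k x = A * exp (\<mu> * x) + c" by blast
    then have "A \<noteq> 0" using k(4) by (auto simp: constant_on_def)
    then show ?thesis using A by blast
  qed
  obtain A where "A \<noteq> 0" "\<forall>x\<in>U. f x = A * exp (\<mu> * x) + c" using sol[OF f U nf ode(1)] by blast
  moreover obtain B where "B \<noteq> 0" "\<forall>x\<in>V. g x = B * exp (\<mu> * x) + c" using sol[OF g V ng ode(2)] by blast
  moreover obtain C where "C \<noteq> 0" "\<forall>x\<in>W. h x = C * exp (\<mu> * x) + c" using sol[OF h W nh ode(3)] by blast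
  ultimately have "arises_from UNIV exp exp exp U V W f g h"
    by (intro exponential_triple_arises[of A B C _ _ \<mu> c]) auto
  then show ?thesis ..
next
  case True
  have sol: "\<exists>a. \<forall>x\<in>S. k x = \<nu> * x + a"
    if k: "k holomorphic_on S" "open S" "connected S"
      "\<And>x. x \<in> S \<Longrightarrow> deriv k x = \<mu> * k x + \<nu>" for k S
  proof -
    have "((\<lambda>x. k x - \<nu> * x) has_field_derivative 0) (at x)" if "x \<in> S" for x
      using DERIV_diff[OF has_field_derivative_deriv[OF k(1,2) that] DERIV_cmult[OF DERIV_ident, of \<nu>]]
        k(4)[OF that] True by simp
    then have "(\<lambda>x. k x - \<nu> * x) constant_on S"
      by (intro has_field_derivative_0_imp_constant_on k) (auto simp: has_field_derivative_at_within)
    then show ?thesis by (auto simp: constant_on_def diff_eq_eq add.commute)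
  qed
  obtain a where a: "\<forall>x\<in>U. f x = \<nu> * x + a" using sol[OF f U ode(1)] by blast
  moreover obtain b where "\<forall>x\<in>V. g x = \<nu> * x + b" using sol[OF g V ode(2)] by blast
  moreover obtain c where "\<forall>x\<in>W. h x = \<nu> * x + c" using sol[OF h W ode(3)] by blast
  moreover have "\<nu> \<noteq> 0" using nf a by (auto simp: constant_on_def)
  ultimately have "arises_from UNIV (\<lambda>x. x) (\<lambda>x. x) (\<lambda>x. x) U V W f g h"
    by (intro linear_triple_arises[of \<nu> _ _ a _ _ b _ _ c]) auto
  then show ?thesis ..
qed

text \<open>
  After the affine change \<open>k \<mapsto> (k - \<beta>) / \<alpha>\<close>, chosen to make the leading coefficient \<open>4\<close> and to
  remove the quadratic term, \<open>f\<close> and \<open>g\<close> are translates of one Weierstrass function \<open>P\<close> by \<open>\<gamma>\<^sub>1\<close>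
  and \<open>\<gamma>\<^sub>2\<close>. Periods make \<open>\<gamma>\<^sub>3\<close> ambiguous if it is obtained from a differential equation for \<open>h\<close>.
  It is therefore set to \<open>- \<gamma>\<^sub>1 - \<gamma>\<^sub>2\<close> at once; then \<open>h\<close> and the translate of \<open>P\<close> by \<open>\<gamma>\<^sub>3\<close> are both
  the third abscissa of the same chord.
\<close>

lemma curved_triple_arises:
  assumes U: "open U" "connected U" and V: "open V" "connected V" and W: "open W" "connected W"
    and f: "f holomorphic_on U" and g: "g holomorphic_on V" and h: "h holomorphic_on W"
    and nf: "\<not> f constant_on U" and ng: "\<not> g constant_on V"
    and \<kappa>: "\<kappa> \<noteq> 0"
    and ode: "\<And>x. x \<in> U \<Longrightarrow> (deriv f x)\<^sup>2 = 2 * \<kappa> * f x ^ 3 + c\<^sub>1 * (f x)\<^sup>2 + c\<^sub>2 * f x + c\<^sub>3"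
        "\<And>y. y \<in> V \<Longrightarrow> (deriv g y)\<^sup>2 = 2 * \<kappa> * g y ^ 3 + c\<^sub>1 * (g y)\<^sup>2 + c\<^sub>2 * g y + c\<^sub>3"
    and ball: "\<epsilon> > 0" "ball x1 \<epsilon> \<subseteq> U" "y1 \<in> V"
    and third: "\<And>x. x \<in> ball x1 \<epsilon> \<Longrightarrow> - x - y1 \<in> W \<and> f x \<noteq> g y1 \<and>
        (deriv f x - deriv g y1)\<^sup>2 = (f x - g y1)\<^sup>2 * (2 * \<kappa> * (f x + g y1 + h (- x - y1)) + c\<^sub>1)"
  shows "\<exists>g\<^sub>2 g\<^sub>3 P. weierstrass_p g\<^sub>2 g\<^sub>3 P \<and> arises_from {x. \<not> is_pole P x} P P P U V W f g h"
proof -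
  define \<alpha> \<beta> where "\<alpha> = 2 / \<kappa>" and "\<beta> = - c\<^sub>1 / (6 * \<kappa>)"
  have \<alpha>: "\<alpha> \<noteq> 0" "\<kappa> * \<alpha> = 2" and \<beta>: "6 * \<kappa> * \<beta> + c\<^sub>1 = 0"
    using \<kappa> by (auto simp: \<alpha>_def \<beta>_def)
  define g\<^sub>2 where "g\<^sub>2 = - (6 * \<kappa> * \<beta>\<^sup>2 + 2 * c\<^sub>1 * \<beta> + c\<^sub>2) / \<alpha>"
  define g\<^sub>3 where "g\<^sub>3 = - (2 * \<kappa> * \<beta> ^ 3 + c\<^sub>1 * \<beta>\<^sup>2 + c\<^sub>2 * \<beta> + c\<^sub>3) / \<alpha>\<^sup>2"
  have g23: "g\<^sub>2 * \<alpha> = - (6 * \<kappa> * \<beta>\<^sup>2 + 2 * c\<^sub>1 * \<beta> + c\<^sub>2)"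
    "g\<^sub>3 * \<alpha>\<^sup>2 = - (2 * \<kappa> * \<beta> ^ 3 + c\<^sub>1 * \<beta>\<^sup>2 + c\<^sub>2 * \<beta> + c\<^sub>3)"
    using \<alpha>(1) by (simp_all add: g\<^sub>2_def g\<^sub>3_def)
  obtain P where P: "weierstrass_p g\<^sub>2 g\<^sub>3 P" using weierstrass_p_exists by blast
  obtain s r where germ: "wp_germ g\<^sub>2 g\<^sub>3 s r" "\<And>x. x \<in> ball 0 r - {0} \<Longrightarrow> \<not> is_pole P x"
    "\<And>x. x \<in> ball 0 r - {0} \<Longrightarrow> P x = 1 / (s x)\<^sup>2"
    using weierstrass_p_germ[OF P] by blast
  interpret wp_germ g\<^sub>2 g\<^sub>3 s r by (rule germ(1))
  interpret weierstrass g\<^sub>2 g\<^sub>3 s r P by unfold_locales (use P germ in auto)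
  have normal: "(\<lambda>x. (k x - \<beta>) / \<alpha>) holomorphic_on S" "\<not> (\<lambda>x. (k x - \<beta>) / \<alpha>) constant_on S"
    "\<And>x. x \<in> S \<Longrightarrow> deriv (\<lambda>x. (k x - \<beta>) / \<alpha>) x = deriv k x / \<alpha>"
    "\<And>x. x \<in> S \<Longrightarrow> (deriv (\<lambda>x. (k x - \<beta>) / \<alpha>) x)\<^sup>2 = cubic ((k x - \<beta>) / \<alpha>)"
    if k: "k holomorphic_on S" "open S" "\<not> k constant_on S"
      "\<forall>x\<in>S. (deriv k x)\<^sup>2 = 2 * \<kappa> * k x ^ 3 + c\<^sub>1 * (k x)\<^sup>2 + c\<^sub>2 * k x + c\<^sub>3" for k S
  proof -
    show "(\<lambda>x. (k x - \<beta>) / \<alpha>) holomorphic_on S"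
      using \<alpha> by (intro holomorphic_intros k) auto
    show "\<not> (\<lambda>x. (k x - \<beta>) / \<alpha>) constant_on S"
    proof
      assume "(\<lambda>x. (k x - \<beta>) / \<alpha>) constant_on S"
      then obtain d where "\<And>x. x \<in> S \<Longrightarrow> (k x - \<beta>) / \<alpha> = d" by (auto simp: constant_on_def)
      then have "k x = d * \<alpha> + \<beta>" if "x \<in> S" for x using that \<alpha>(1) by (simp add: field_simps)
      with k(3) show False by (auto simp: constant_on_def)
    qed
    show d: "deriv (\<lambda>x. (k x - \<beta>) / \<alpha>) x = deriv k x / \<alpha>" if "x \<in> S" for x
      using DERIV_cdivide[OF DERIV_diff[OF has_field_derivative_deriv[OF k(1,2) that] DERIV_const[of \<beta>]], of \<alpha>]
      by (intro DERIV_imp_deriv) simp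
    show "(deriv (\<lambda>x. (k x - \<beta>) / \<alpha>) x)\<^sup>2 = cubic ((k x - \<beta>) / \<alpha>)" if "x \<in> S" for x
    proof -
      define X where "X = (k x - \<beta>) / \<alpha>"
      have X: "k x = \<alpha> * X + \<beta>" using \<alpha>(1) by (simp add: X_def)
      have "(deriv k x)\<^sup>2 = \<alpha>\<^sup>2 * cubic X"
        using bspec[OF k(4) that] \<alpha>(2) \<beta> g23 unfolding X cubic_def by algebra
      then show ?thesis unfolding d[OF that] power_divide X_def using \<alpha>(1) by simp
    qed
  qed
  have ode': "\<forall>x\<in>U. (deriv f x)\<^sup>2 = 2 * \<kappa> * f x ^ 3 + c\<^sub>1 * (f x)\<^sup>2 + c\<^sub>2 * f x + c\<^sub>3"
    "\<forall>y\<in>V. (deriv g y)\<^sup>2 = 2 * \<kappa> * g y ^ 3 + c\<^sub>1 * (g y)\<^sup>2 + c\<^sub>2 * g y + c\<^sub>3"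
    using ode by blast+
  note nF = normal[OF f U(1) nf ode'(1)] and nG = normal[OF g V(1) ng ode'(2)]
  obtain \<gamma>\<^sub>1 where \<gamma>\<^sub>1: "\<And>x. x \<in> U \<Longrightarrow> x + \<gamma>\<^sub>1 \<in> N \<and> (f x - \<beta>) / \<alpha> = P (x + \<gamma>\<^sub>1)"
    using solution_is_translate[OF U nF(1,2,4)] by blast
  obtain \<gamma>\<^sub>2 where \<gamma>\<^sub>2: "\<And>x. x \<in> V \<Longrightarrow> x + \<gamma>\<^sub>2 \<in> N \<and> (g x - \<beta>) / \<alpha> = P (x + \<gamma>\<^sub>2)"
    using solution_is_translate[OF V nG(1,2,4)] by blast
  define \<gamma>\<^sub>3 where "\<gamma>\<^sub>3 = - \<gamma>\<^sub>1 - \<gamma>\<^sub>2"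
  have dtrans: "deriv k x = \<alpha> * deriv P (x + \<gamma>)"
    if "\<And>x. x \<in> S \<Longrightarrow> x + \<gamma> \<in> N \<and> (k x - \<beta>) / \<alpha> = P (x + \<gamma>)" "open S" "x \<in> S"
      "deriv (\<lambda>x. (k x - \<beta>) / \<alpha>) x = deriv k x / \<alpha>" for k S x \<gamma>
  proof -
    have "deriv (\<lambda>x. (k x - \<beta>) / \<alpha>) x = deriv (\<lambda>x. P (1 * x + \<gamma>)) x"
      by (rule deriv_cong_open[OF that(2,3)]) (use that(1) in simp)
    also have "\<dots> = deriv P (x + \<gamma>)"
      using solves_affine(2)[OF P_solves N_open disjI1[OF refl], of x \<gamma>] that(1)[OF that(3)] by simp
    finally show ?thesis using that(4) \<alpha>(1) by (simp add: field_simps)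
  qed
  let ?B = "{z. - z - y1 \<in> ball x1 \<epsilon>}" and ?S = "{z. 1 * z + \<gamma>\<^sub>3 \<in> N}"
  have B_eq: "?B = ball (- x1 - y1) \<epsilon>"
  proof -
    have "dist x1 (- z - y1) = dist (- x1 - y1) z" for z
      unfolding dist_norm by (metis (no_types, opaque_lifting) diff_minus_eq_add minus_diff_commute norm_minus_commute diff_diff_add add.commute)
    then show ?thesis by auto
  qed
  have S: "open ?S" "countable (- ?S)" by (rule N_preimage; simp)+
  have "open (?B \<inter> ?S)" unfolding B_eq using S by auto
  \<comment> \<open>The poles of P are countable, a disc is not.\<close>
  moreover have "?B \<inter> ?S \<noteq> {}"
  proof
    assume "?B \<inter> ?S = {}"
    then have "?B \<subseteq> - ?S" by blast
    then have "countable ?B" using S(2) countable_subset by blast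
    then show False unfolding B_eq using uncountable_ball ball(1) by blast
  qed
  moreover have BW: "?B \<subseteq> W"
  proof
    fix z assume "z \<in> ?B"
    then have "- (- z - y1) - y1 \<in> W" using third by blast
    then show "z \<in> W" by simp
  qed
  then have "?B \<inter> ?S \<subseteq> W" by blast
  moreover have "1 * z + \<gamma>\<^sub>3 \<in> N \<and> (h z - \<beta>) / \<alpha> = P (1 * z + \<gamma>\<^sub>3)" if z: "z \<in> ?B \<inter> ?S" for z
  proof -
    define x where "x = - z - y1"
    have x: "x \<in> ball x1 \<epsilon>" "x \<in> U" and zx: "- x - y1 = z" and zN: "z + \<gamma>\<^sub>3 \<in> N"
      using z ball(2) by (auto simp: x_def)
    note th = third[OF x(1), unfolded zx]
    define X Y Z where "X = P (x + \<gamma>\<^sub>1)" "Y = P (y1 + \<gamma>\<^sub>2)" "Z = (h z - \<beta>) / \<alpha>"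
    have fX: "f x = \<alpha> * X + \<beta>" "g y1 = \<alpha> * Y + \<beta>" "h z = \<alpha> * Z + \<beta>"
      using \<gamma>\<^sub>1[OF x(2)] \<gamma>\<^sub>2[OF ball(3)] \<alpha>(1) unfolding X_Y_Z_def by (simp_all add: field_simps)
    have dX: "deriv f x = \<alpha> * deriv P (x + \<gamma>\<^sub>1)" "deriv g y1 = \<alpha> * deriv P (y1 + \<gamma>\<^sub>2)"
      using dtrans[OF \<gamma>\<^sub>1 U(1) x(2) nF(3)[OF x(2)]] dtrans[OF \<gamma>\<^sub>2 V(1) ball(3) nG(3)[OF ball(3)]] by auto
    have "\<alpha>\<^sup>2 * (deriv P (x + \<gamma>\<^sub>1) - deriv P (y1 + \<gamma>\<^sub>2))\<^sup>2 = \<alpha>\<^sup>2 * (4 * (X - Y)\<^sup>2 * (X + Y + Z))"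
      using th \<alpha>(2) \<beta> unfolding fX dX by algebra
    then have "(deriv P (x + \<gamma>\<^sub>1) - deriv P (y1 + \<gamma>\<^sub>2))\<^sup>2 = 4 * (X - Y)\<^sup>2 * (X + Y + Z)"
      using \<alpha>(1) by simp
    moreover have "4 * (X - Y)\<^sup>2 * (X + Y + P (z + \<gamma>\<^sub>3)) = (deriv P (x + \<gamma>\<^sub>1) - deriv P (y1 + \<gamma>\<^sub>2))\<^sup>2"
      unfolding X_Y_Z_def
      by (rule collinear(2)) (use \<gamma>\<^sub>1[OF x(2)] \<gamma>\<^sub>2[OF ball(3)] zN in \<open>auto simp: \<gamma>\<^sub>3_def x_def\<close>)
    moreover have "X \<noteq> Y" using th fX by auto
    ultimately have "Z = P (z + \<gamma>\<^sub>3)" by simp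
    then show ?thesis using zN by (simp add: X_Y_Z_def)
  qed
  moreover have H: "(\<lambda>z. (h z - \<beta>) / \<alpha>) holomorphic_on W"
    using \<alpha> by (intro holomorphic_intros h) auto
  ultimately have "1 * z + \<gamma>\<^sub>3 \<in> N" "(h z - \<beta>) / \<alpha> = P (1 * z + \<gamma>\<^sub>3)" if "z \<in> W" for z
    using eq_P_extend[OF W H disjI1[OF refl], of "?B \<inter> ?S" \<gamma>\<^sub>3 z] that by blast+
  then have \<gamma>\<^sub>3: "z + \<gamma>\<^sub>3 \<in> N \<and> (h z - \<beta>) / \<alpha> = P (z + \<gamma>\<^sub>3)" if "z \<in> W" for z
    using that by simp
  have undo: "k = \<alpha> * w + \<beta>" if "(k - \<beta>) / \<alpha> = w" for k w
    using that \<alpha>(1) by (auto simp: field_simps)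
  have "arises_from {x. \<not> is_pole P x} P P P U V W f g h"
  proof (rule arises_fromI[where \<alpha> = \<alpha> and \<beta> = \<beta> and \<delta> = 1 and \<gamma>\<^sub>1 = \<gamma>\<^sub>1 and \<gamma>\<^sub>2 = \<gamma>\<^sub>2 and \<gamma>\<^sub>3 = \<gamma>\<^sub>3])
    show "\<gamma>\<^sub>1 + \<gamma>\<^sub>2 + \<gamma>\<^sub>3 = 0" by (simp add: \<gamma>\<^sub>3_def)
  qed (use \<alpha> \<gamma>\<^sub>1 \<gamma>\<^sub>2 \<gamma>\<^sub>3 in \<open>auto simp: N_def intro!: undo\<close>)
  then show ?thesis using P by blast
qed

lemma nonconstant_solution_arises:
  assumes U: "open U" "connected U" and V: "open V" "connected V" and W: "open W" "connected W"
    and triple: "x0 \<in> U" "y0 \<in> V" "z0 \<in> W" "x0 + y0 + z0 = 0"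
    and f: "f holomorphic_on U" and g: "g holomorphic_on V" and h: "h holomorphic_on W"
    and nf: "\<not> f constant_on U" and ng: "\<not> g constant_on V" and nh: "\<not> h constant_on W"
    and det: "det_equation U V W f g h"
  shows "arises_from UNIV exp exp exp U V W f g h \<or>
         arises_from UNIV (\<lambda>x. x) (\<lambda>x. x) (\<lambda>x. x) U V W f g h \<or>
         (\<exists>g\<^sub>2 g\<^sub>3 P. weierstrass_p g\<^sub>2 g\<^sub>3 P \<and> arises_from {x. \<not> is_pole P x} P P P U V W f g h)"
proof -
  obtain x1 y1 \<epsilon> where \<epsilon>: "\<epsilon> > 0" "ball x1 \<epsilon> \<subseteq> U" "ball y1 \<epsilon> \<subseteq> V"
    and gen: "\<And>x y. x \<in> ball x1 \<epsilon> \<Longrightarrow> y \<in> ball y1 \<epsilon> \<Longrightarrow>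
       - x - y \<in> W \<and> f x \<noteq> g y \<and> f x \<noteq> h (- x - y) \<and> g y \<noteq> h (- x - y)"
    by (rule generic_triple[OF U V W triple f g h nf ng nh]) (rule that; blast)
  let ?A = "ball x1 \<epsilon>" and ?B = "ball y1 \<epsilon>"
  have centre: "x1 \<in> ?A" "y1 \<in> ?B" using \<epsilon>(1) by auto
  have hol: "f holomorphic_on ?A" "g holomorphic_on ?B"
    using f g \<epsilon>(2,3) holomorphic_on_subset by blast+
  interpret loc: collinear_triple f g h ?A ?B W
  proof
    fix x y assume xy: "x \<in> ?A" "y \<in> ?B"
    have "x + y + (- x - y) = 0" by simp
    then show "deriv f x * (h (- x - y) - g y) + deriv g y * (f x - h (- x - y))
            + deriv h (- x - y) * (g y - f x) = 0"
      using det gen[OF xy] xy \<epsilon> unfolding det_equation_iff by blast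
  qed (use gen W h hol in auto)
  obtain \<kappa> where \<kappa>: "\<And>x y. x \<in> ?A \<Longrightarrow> y \<in> ?B \<Longrightarrow> loc.curvature x y = \<kappa>"
    using loc.curvature_constant by blast
  have ne: "?A \<noteq> {}" "?B \<noteq> {}" using centre by blast+
  note fd = f holomorphic_deriv[OF f U(1)] and gd = g holomorphic_deriv[OF g V(1)]
    and hd = h holomorphic_deriv[OF h W(1)]
  show ?thesis
  proof (cases "\<kappa> = 0")
    case True
    obtain \<mu> \<nu> where \<mu>\<nu>: "\<And>x. x \<in> ?A \<Longrightarrow> deriv f x = \<mu> * f x + \<nu>"
      "\<And>y. y \<in> ?B \<Longrightarrow> deriv g y = \<mu> * g y + \<nu>"
      "\<And>x y. x \<in> ?A \<Longrightarrow> y \<in> ?B \<Longrightarrow> deriv h (- x - y) = \<mu> * h (- x - y) + \<nu>"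
      using loc.straight_case[OF centre] \<kappa> True by metis
    have odef: "deriv f x = \<mu> * f x + \<nu>" if "x \<in> U" for x
      by (rule analytic_continuation_open[OF open_ball U(1) ne(1) U(2) \<epsilon>(2) _ _ \<mu>\<nu>(1) that])
         (auto intro!: holomorphic_intros fd)
    have odeg: "deriv g x = \<mu> * g x + \<nu>" if "x \<in> V" for x
      by (rule analytic_continuation_open[OF open_ball V(1) ne(2) V(2) \<epsilon>(3) _ _ \<mu>\<nu>(2) that])
         (auto intro!: holomorphic_intros gd)
    let ?C = "{z. - z - y1 \<in> ?A}"
    have C: "open ?C"
      using open_vimage[OF open_ball, of "\<lambda>z. - z - y1" x1 \<epsilon>] by (simp add: vimage_def continuous_intros)
    have C_ne: "?C \<noteq> {}" using centre by (auto intro!: exI[of _ "- x1 - y1"])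
    have CW: "z \<in> W" and odeC: "deriv h z = \<mu> * h z + \<nu>" if "z \<in> ?C" for z
      using gen[of "- z - y1" y1] \<mu>\<nu>(3)[of "- z - y1" y1] centre(2) that by auto
    have odeh: "deriv h z = \<mu> * h z + \<nu>" if "z \<in> W" for z
      by (rule analytic_continuation_open[OF C W(1) C_ne W(2) _ _ _ odeC that])
         (auto intro!: holomorphic_intros hd CW)
    show ?thesis
      using straight_triple_arises[OF U V W f g h nf ng nh odef odeg odeh] by blast
  next
    case False
    obtain c1 c2 c3 where c:
      "\<And>x. x \<in> ?A \<Longrightarrow> (deriv f x)\<^sup>2 = 2 * \<kappa> * f x ^ 3 + c1 * (f x)\<^sup>2 + c2 * f x + c3"
      "\<And>y. y \<in> ?B \<Longrightarrow> (deriv g y)\<^sup>2 = 2 * \<kappa> * g y ^ 3 + c1 * (g y)\<^sup>2 + c2 * g y + c3"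
      "\<And>x y. x \<in> ?A \<Longrightarrow> y \<in> ?B \<Longrightarrow> (loc.slope x y)\<^sup>2 = 2 * \<kappa> * (f x + g y + h (- x - y)) + c1"
      using loc.cubic_case[OF centre \<kappa>] by metis
    have odef: "(deriv f x)\<^sup>2 = 2 * \<kappa> * f x ^ 3 + c1 * (f x)\<^sup>2 + c2 * f x + c3" if "x \<in> U" for x
      by (rule analytic_continuation_open[OF open_ball U(1) ne(1) U(2) \<epsilon>(2) _ _ c(1) that])
         (auto intro!: holomorphic_intros fd)
    have odeg: "(deriv g x)\<^sup>2 = 2 * \<kappa> * g x ^ 3 + c1 * (g x)\<^sup>2 + c2 * g x + c3" if "x \<in> V" for x
      by (rule analytic_continuation_open[OF open_ball V(1) ne(2) V(2) \<epsilon>(3) _ _ c(2) that])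
         (auto intro!: holomorphic_intros gd)
    have third: "- x - y1 \<in> W \<and> f x \<noteq> g y1 \<and>
        (deriv f x - deriv g y1)\<^sup>2 = (f x - g y1)\<^sup>2 * (2 * \<kappa> * (f x + g y1 + h (- x - y1)) + c1)"
      if "x \<in> ?A" for x
      using gen[OF that centre(2)] c(3)[OF that centre(2)] loc.slope_mult(1)[OF that centre(2)]
      by (metis mult.commute power_mult_distrib)
    have "y1 \<in> V" using centre \<epsilon>(3) by blast
    from curved_triple_arises[OF U V W f g h nf ng False odef odeg \<epsilon>(1,2) this third]
    show ?thesis by blast
  qed
qed

lemma weierstrass_p_det_equation:
  assumes "weierstrass_p g\<^sub>2 g\<^sub>3 P"
  defines "D \<equiv> {x. \<not> is_pole P x}"
  shows "det_equation D D D P P P"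
proof -
  obtain s r where germ: "wp_germ g\<^sub>2 g\<^sub>3 s r" "\<And>x. x \<in> ball 0 r - {0} \<Longrightarrow> \<not> is_pole P x"
    "\<And>x. x \<in> ball 0 r - {0} \<Longrightarrow> P x = 1 / (s x)\<^sup>2"
    using weierstrass_p_germ[OF assms(1)] by blast
  interpret wp_germ g\<^sub>2 g\<^sub>3 s r by (rule germ(1))
  interpret weierstrass g\<^sub>2 g\<^sub>3 s r P by unfold_locales (use assms(1) germ in auto)
  show ?thesis
    unfolding det_equation_iff using collinear(1) by (simp add: D_def N_def)
qed

theorem theorem2:
  fixes f g h :: "complex \<Rightarrow> complex" and U V W :: "complex set"
  assumes "open U" "connected U" "open V" "connected V" "open W" "connected W"
    and "\<exists>x\<in>U. \<exists>y\<in>V. \<exists>z\<in>W. x + y + z = 0"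
    and "f three_times_differentiable_on U"
    and "g three_times_differentiable_on V"
    and "h three_times_differentiable_on W"
  shows
    "(\<forall>\<alpha> \<beta> \<delta> \<gamma>\<^sub>1 \<gamma>\<^sub>2 \<gamma>\<^sub>3. \<gamma>\<^sub>1 + \<gamma>\<^sub>2 + \<gamma>\<^sub>3 = 0 \<and> det_equation U V W f g h \<longrightarrow>
        det_equation {x. \<delta> * x + \<gamma>\<^sub>1 \<in> U} {x. \<delta> * x + \<gamma>\<^sub>2 \<in> V} {x. \<delta> * x + \<gamma>\<^sub>3 \<in> W}
          (affine_transform \<alpha> \<beta> \<delta> \<gamma>\<^sub>1 f) (affine_transform \<alpha> \<beta> \<delta> \<gamma>\<^sub>2 g)
          (affine_transform \<alpha> \<beta> \<delta> \<gamma>\<^sub>3 h)) \<and>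
     (\<not> f constant_on U \<and> \<not> g constant_on V \<and> \<not> h constant_on W \<longrightarrow>
        (det_equation U V W f g h \<longleftrightarrow>
           arises_from UNIV exp exp exp U V W f g h \<or>
           arises_from UNIV (\<lambda>x. x) (\<lambda>x. x) (\<lambda>x. x) U V W f g h \<or>
           (\<exists>g\<^sub>2 g\<^sub>3 P. weierstrass_p g\<^sub>2 g\<^sub>3 P \<and>
              arises_from {x. \<not> is_pole P x} P P P U V W f g h))) \<and>
     (\<forall>c. (\<forall>z\<in>W. h z = c) \<longrightarrow>
        (det_equation U V W f g h \<longleftrightarrow>
           (\<forall>x\<in>U. f x = c) \<or> (\<forall>y\<in>V. g y = c) \<or>
           arises_from UNIV exp exp (\<lambda>_. 0) U V W f g h)) \<and>
     (\<forall>c. (\<forall>y\<in>V. g y = c) \<longrightarrow>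
        (det_equation U V W f g h \<longleftrightarrow>
           (\<forall>x\<in>U. f x = c) \<or> (\<forall>z\<in>W. h z = c) \<or>
           arises_from UNIV exp (\<lambda>_. 0) exp U V W f g h)) \<and>
     (\<forall>c. (\<forall>x\<in>U. f x = c) \<longrightarrow>
        (det_equation U V W f g h \<longleftrightarrow>
           (\<forall>y\<in>V. g y = c) \<or> (\<forall>z\<in>W. h z = c) \<or>
           arises_from UNIV (\<lambda>_. 0) exp exp U V W f g h))"
proof -
  obtain x0 y0 z0 where triple: "x0 \<in> U" "y0 \<in> V" "z0 \<in> W" "x0 + y0 + z0 = 0"
    using assms(7) by blast
  note U = assms(1,2) and V = assms(3,4) and W = assms(5,6)
  note f = three_times_differentiable_imp_holomorphic[OF assms(8)]
    and g = three_times_differentiable_imp_holomorphic[OF assms(9)]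
    and h = three_times_differentiable_imp_holomorphic[OF assms(10)]
  have converse: "det_equation U V W f g h"
    if "arises_from UNIV exp exp exp U V W f g h \<or>
        arises_from UNIV (\<lambda>x. x) (\<lambda>x. x) (\<lambda>x. x) U V W f g h \<or>
        (\<exists>g\<^sub>2 g\<^sub>3 P. weierstrass_p g\<^sub>2 g\<^sub>3 P \<and> arises_from {x. \<not> is_pole P x} P P P U V W f g h)"
    using that
  proof (elim disjE exE conjE)
    have "det_equation UNIV UNIV UNIV exp exp exp"
      by (simp add: det_equation_iff DERIV_imp_deriv[OF DERIV_exp] algebra_simps)
    then show "det_equation U V W f g h" if "arises_from UNIV exp exp exp U V W f g h"
      by (intro arises_from_imp_det_equation[OF U(1) V(1) W(1) open_UNIV _ _ _ _ that])
         (auto intro!: holomorphic_intros)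
    have "det_equation UNIV UNIV UNIV (\<lambda>x. x) (\<lambda>x. x) (\<lambda>x. x)"
      by (simp add: det_equation_iff)
    then show "det_equation U V W f g h" if "arises_from UNIV (\<lambda>x. x) (\<lambda>x. x) (\<lambda>x. x) U V W f g h"
      by (intro arises_from_imp_det_equation[OF U(1) V(1) W(1) open_UNIV _ _ _ _ that])
         (auto intro!: holomorphic_intros)
    fix g\<^sub>2 g\<^sub>3 P assume P: "weierstrass_p g\<^sub>2 g\<^sub>3 P" and af: "arises_from {x. \<not> is_pole P x} P P P U V W f g h"
    have "P nicely_meromorphic_on UNIV" using P by (simp add: weierstrass_p_def)
    note N = nicely_meromorphic_nonpoles(2,4)[OF this]
    show "det_equation U V W f g h"
      by (rule arises_from_imp_det_equation[OF U(1) V(1) W(1) N(1) N(2) N(2) N(2)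
            weierstrass_p_det_equation[OF P] af])
  qed
  have A: "det_equation U V W f g h \<longleftrightarrow>
           arises_from UNIV exp exp exp U V W f g h \<or>
           arises_from UNIV (\<lambda>x. x) (\<lambda>x. x) (\<lambda>x. x) U V W f g h \<or>
           (\<exists>g\<^sub>2 g\<^sub>3 P. weierstrass_p g\<^sub>2 g\<^sub>3 P \<and>
              arises_from {x. \<not> is_pole P x} P P P U V W f g h)"
    if "\<not> f constant_on U" "\<not> g constant_on V" "\<not> h constant_on W"
    using nonconstant_solution_arises[OF U V W triple f g h that] converse by blast
  have triple': "x0 + z0 + y0 = 0" "y0 + z0 + x0 = 0" using triple(4) by (simp_all add: add_ac)
  have Bh: "det_equation U V W f g h \<longleftrightarrow>
           (\<forall>x\<in>U. f x = c) \<or> (\<forall>y\<in>V. g y = c) \<or> arises_from UNIV exp exp (\<lambda>_. 0) U V W f g h"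
    if "\<forall>z\<in>W. h z = c" for c
    using constant_third_function[OF U V W(1) triple f g, of h c] that by blast
  have Bg: "det_equation U V W f g h \<longleftrightarrow>
           (\<forall>x\<in>U. f x = c) \<or> (\<forall>z\<in>W. h z = c) \<or> arises_from UNIV exp (\<lambda>_. 0) exp U V W f g h"
    if "\<forall>y\<in>V. g y = c" for c
    using constant_third_function[OF U W V(1) triple(1,3,2) triple'(1) f h, of g c] that
    unfolding det_equation_commute(2)[of U V W] arises_from_commute(2)[of _ _ _ _ U V W] by blast
  have Bf: "det_equation U V W f g h \<longleftrightarrow>
           (\<forall>y\<in>V. g y = c) \<or> (\<forall>z\<in>W. h z = c) \<or> arises_from UNIV (\<lambda>_. 0) exp exp U V W f g h"
    if "\<forall>x\<in>U. f x = c" for c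
    using constant_third_function[OF V W U(1) triple(2,3,1) triple'(2) g h, of f c] that
    unfolding det_equation_commute(1)[of U V W] det_equation_commute(2)[of V U W]
      arises_from_commute(1)[of _ _ _ _ U V W] arises_from_commute(2)[of _ _ _ _ V U W] by blast
  show ?thesis
    using det_equation_affine_transform[OF U(1) V(1) W(1) f g h] A Bh Bg Bf by blast
qed

end
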